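(* Let $n \geq 2$ be an integer and let $K$ be a nontrivial (i.e. $K\not\equiv 0$), nonpositive, continuous and radially symmetric function on $\mathbb{R}^{2n}$. Suppose that $\alpha_1(K)>0$. Then for any $\alpha \in (0, \alpha_1(K))$, there exists a radial solution $u_{\alpha}$ to $$(-\Delta)^n u = K(x)e^{2nu} \quad \text{in } \mathbb{R}^{2n}$$ satisfying $$\lim_{|x|\to \infty}\big[u_\alpha(x) - \alpha\ln |x|\big] = \ell \quad\text{for some } \ell \in \mathbb{R}.$$
   Context: $\alpha_1(K) := \sup\{\beta \in \mathbb{R} : K(x)(1+ |x|)^{2n\beta} \in L^1(\mathbb{R}^{2n})\}$, where the value $+\infty$ is allowed. A solution is a continuous function satisfying the equation in the sense of distributions. *)

theory Defs
  imports "HOL-Analysis.Analysis"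
begin

definition radial :: "('a::real_normed_vector \<Rightarrow> 'b) \<Rightarrow> bool" where
  "radial f \<longleftrightarrow> (\<forall>x y. norm x = norm y \<longrightarrow> f x = f y)"

definition partial :: "'a \<Rightarrow> ('a::euclidean_space \<Rightarrow> real) \<Rightarrow> 'a \<Rightarrow> real" where
  "partial b f x = frechet_derivative f (at x) b"

(* For k = Suc j, differentiability makes the partial derivatives genuine, and the recursion
   makes them continuous, so this is the usual class of k times continuously differentiable
   functions on the whole space. *)
fun Ck :: "nat \<Rightarrow> ('a::euclidean_space \<Rightarrow> real) \<Rightarrow> bool" where
  "Ck 0 f \<longleftrightarrow> continuous_on UNIV f"
| "Ck (Suc k) f \<longleftrightarrow> (\<forall>x. f differentiable (at x)) \<and> (\<forall>b\<in>Basis. Ck k (partial b f))"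

definition test_function :: "('a::euclidean_space \<Rightarrow> real) \<Rightarrow> bool" where
  "test_function \<phi> \<longleftrightarrow> (\<forall>k. Ck k \<phi>) \<and> compact (closure (support_on UNIV \<phi>))"

definition laplacian :: "('a::euclidean_space \<Rightarrow> real) \<Rightarrow> 'a \<Rightarrow> real" where
  "laplacian f x = (\<Sum>b\<in>Basis. partial b (partial b f) x)"

definition neg_laplacian_power :: "nat \<Rightarrow> ('a::euclidean_space \<Rightarrow> real) \<Rightarrow> 'a \<Rightarrow> real" where
  "neg_laplacian_power n = (\<lambda>f x. - laplacian f x) ^^ n"

(* The equation (- Laplacian)^n u = f in the sense of distributions, for continuous u and f;
   the operator is formally self-adjoint, so no sign appears when it is moved to \<phi>. *)
definition neg_laplacian_power_eq_distr ::
    "nat \<Rightarrow> ('a::euclidean_space \<Rightarrow> real) \<Rightarrow> ('a \<Rightarrow> real) \<Rightarrow> bool" where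
  "neg_laplacian_power_eq_distr n u f \<longleftrightarrow>
     (\<forall>\<phi>. test_function \<phi> \<longrightarrow>
        (LINT x|lborel. u x * neg_laplacian_power n \<phi> x) = (LINT x|lborel. f x * \<phi> x))"

definition is_solution ::
    "nat \<Rightarrow> ('a::euclidean_space \<Rightarrow> real) \<Rightarrow> ('a \<Rightarrow> real) \<Rightarrow> bool" where
  "is_solution n K u \<longleftrightarrow>
     continuous_on UNIV u \<and>
     neg_laplacian_power_eq_distr n u (\<lambda>x. K x * exp (2 * real n * u x))"

(* The supremum is taken in the extended reals, so that it may be infinite. *)
definition alpha1 :: "nat \<Rightarrow> ('a::euclidean_space \<Rightarrow> real) \<Rightarrow> ereal" where
  "alpha1 n K =
     Sup {ereal \<beta> | \<beta>. integrable lborel (\<lambda>x. K x * (1 + norm x) powr (2 * real n * \<beta>))}"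

end

theory Submission
  imports Defs "HOL-Real_Asymp.Real_Asymp"
begin

text \<open>Write \<open>u = c + \<alpha> ln (1 + |x|) - \<alpha> Q p (x)\<close>, where
  \<open>q(x, y) = ln (1 + |x|) + ln (1 + |y|) - ln |x - y| \<ge> 0\<close>, \<open>p\<close> is a probability density with
  respect to \<open>W = |K| (1 + |x|)\<^sup>2\<^sup>n\<^sup>\<alpha> dx\<close> and \<open>Q p (x)\<close> is the \<open>W\<close>-integral of \<open>q(x, y) p(y)\<close>.
  Up to constants \<open>u\<close> is \<open>\<alpha>\<close> times the logarithmic potential of \<open>p W\<close>, so that the equation becomes
  the fixed point equation \<open>p = exp (- a Q p) / Z\<close> with \<open>a = 2 n \<alpha>\<close> and \<open>Z\<close> the normalizing constant.

  The logarithmic interaction is repulsive: \<open>- ln |x - y|\<close> is a mixture of Gaussians, hence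
  positive semidefinite on densities of total mass 0. With respect to this energy form the map
  \<open>p \<mapsto> exp (- a Q p) / Z\<close> is antimonotone, and a relaxed iteration is a contraction. Uniqueness
  of the fixed point makes \<open>p\<close> radial. Radiality of \<open>W\<close> also gives an integrable bound for
  \<open>q(r i, y)\<close> that does not depend on \<open>r\<close> (\<open>i\<close> a coordinate vector), and dominated convergence
  then yields both continuity and the behaviour at infinity. That \<open>ln |x|\<close> is a fundamental
  solution follows from the explicit formula for \<open>(- laplacian)\<^sup>n ln (|x|\<^sup>2 + e)\<close> in dimension
  \<open>2 n\<close>, as \<open>e\<close> tends to 0.\<close>

section \<open>Integrability of logarithmic singularities\<close>

text \<open>The sign of \<open>K\<close> makes the problem repulsive: for \<open>K\<close>
  nonpositive and \<alpha> > 0 the exponent of the fixed point equation is \<open>- a Q p\<close>,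
  so no smallness of \<alpha> is asked for. That \<alpha> lies strictly below the supremum leaves a
  spare power of \<open>1 + |x|\<close>, and this pays for integrating \<open>ln (1 + |x|)\<close>
  against \<open>W\<close>. The obstacle is that \<open>K\<close> is only continuous, so the density
  of \<open>W\<close> may be unbounded and the integral of \<open>q(x, y)\<close> in
  \<open>y\<close> has no evident bound uniform in \<open>x\<close>. Radiality repairs this:
  averaged over a sphere, a logarithmic singularity costs a constant factor. The terms
  \<open>ln (1 + |x|) + ln (1 + |y|)\<close> make \<open>q\<close> nonnegative and leave the energy
  of densities of total mass 0 unchanged. The energy form gives no complete norm, so contraction in
  it does not by itself produce a limit. Antimonotonicity is therefore used quantitatively: each
  step of the iteration also controls the L2 distance of successive Gibbs densities, which yields
  almost everywhere convergence of the iterates.\<close>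

lemma log_pole_le_suminf:
  fixes t :: real
  shows "ennreal (max 0 (- ln \<bar>t\<bar>)) \<le> (\<Sum>k. indicator {s. \<bar>s\<bar> \<le> exp (- real k)} t)"
proof (cases "t = 0 \<or> 1 \<le> \<bar>t\<bar>")
  case True
  then have "max 0 (- ln \<bar>t\<bar>) = 0" by (auto simp: max_def)
  then show ?thesis by simp
next
  case False
  define L where "L = - ln \<bar>t\<bar>"
  \<comment> \<open>Discrete layer cake: all \<open>k < N\<close> satisfy
    \<open>|t| \<le> exp (- k)\<close>, and there are at least \<open>L\<close> of them. The point
    \<open>t = 0\<close> was split off because there \<open>ln 0 = 0\<close>.\<close>
  define N where "N = nat \<lceil>L\<rceil>"
  have L: "0 < L" using False by (simp add: L_def)
  have ind: "indicator {s. \<bar>s\<bar> \<le> exp (- real k)} t = (1 :: ennreal)" if "k < N" for k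
  proof -
    have "real k \<le> L" using that L unfolding N_def by linarith
    then have "ln \<bar>t\<bar> \<le> - real k" by (simp add: L_def)
    then have "\<bar>t\<bar> \<le> exp (- real k)" using False by (metis exp_le_cancel_iff exp_ln zero_less_abs_iff)
    then show ?thesis by simp
  qed
  have "ennreal (max 0 (- ln \<bar>t\<bar>)) = ennreal L" using L by (simp add: L_def)
  also have "\<dots> \<le> ennreal (real N)" unfolding N_def using L by (intro ennreal_leI) linarith
  also have "\<dots> = (\<Sum>k<N. indicator {s. \<bar>s\<bar> \<le> exp (- real k)} t)"
    using ind by (simp add: ennreal_of_nat_eq_real_of_nat)
  also have "\<dots> \<le> (\<Sum>k. indicator {s. \<bar>s\<bar> \<le> exp (- real k)} t)"
    by (intro sum_le_suminf) auto
  finally show ?thesis .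
qed

lemma emeasure_slab_le:
  fixes b :: "'a::euclidean_space"
  assumes b: "b \<in> Basis" and e: "0 \<le> e" "e \<le> 1"
  shows "emeasure lborel ({z. \<bar>z \<bullet> b\<bar> \<le> e} \<inter> cball 0 1) \<le> ennreal (2 ^ DIM('a) * e)"
proof -
  \<comment> \<open>Corner of the box with half-width \<open>e\<close> in direction \<open>b\<close>
    and half-width 1 in all other directions.\<close>
  let ?u = "One - (1 - e) *\<^sub>R b :: 'a"
  have u: "?u \<bullet> i = (if i = b then e else 1)" if "i \<in> Basis" for i
    using that b by (simp add: inner_diff_left inner_Basis)
  have "({z. \<bar>z \<bullet> b\<bar> \<le> e} \<inter> cball 0 1) \<subseteq> cbox (- ?u) ?u"
  proof
    fix z :: 'a assume z: "z \<in> {z. \<bar>z \<bullet> b\<bar> \<le> e} \<inter> cball 0 1"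
    have "\<bar>z \<bullet> i\<bar> \<le> 1" if "i \<in> Basis" for i
      using z Basis_le_norm[OF that, of z] by simp
    then have "\<bar>z \<bullet> i\<bar> \<le> ?u \<bullet> i" if "i \<in> Basis" for i
      unfolding u[OF that] using z that by auto
    then show "z \<in> cbox (- ?u) ?u" unfolding mem_box inner_minus_left
      by (intro ballI) (metis abs_le_iff minus_le_iff)
  qed
  then have "emeasure lborel ({z. \<bar>z \<bullet> b\<bar> \<le> e} \<inter> cball 0 1) \<le> emeasure lborel (cbox (- ?u) ?u)"
    by (intro emeasure_mono) auto
  also have "\<dots> = ennreal (\<Prod>i\<in>Basis. (?u - - ?u) \<bullet> i)"
    using u e by (subst emeasure_lborel_cbox) (auto simp: inner_minus_left simp del: minus_diff_eq)
  also have "(\<Prod>i\<in>Basis. (?u - - ?u) \<bullet> i) = (\<Prod>i\<in>(Basis :: 'a set). 2 * (if i = b then e else 1))"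
  proof (rule prod.cong[OF refl])
    fix i :: 'a assume i: "i \<in> Basis"
    have "(?u - - ?u) \<bullet> i = 2 * (?u \<bullet> i)" by (simp add: inner_diff_left)
    then show "(?u - - ?u) \<bullet> i = 2 * (if i = b then e else 1)" by (simp only: u[OF i])
  qed
  also have "\<dots> = 2 ^ DIM('a) * e"
    using b by (simp add: prod.distrib prod.delta)
  finally show ?thesis .
qed

text \<open>The slabs of half-width \<open>exp (- k)\<close> meet the unit ball in sets of
  geometrically decaying measure. A singularity along a hyperplane is treated, not just one at a
  point, because the uniform bound for the kernel on an axis has this shape; point singularities are
  dominated by it.\<close>

lemma log_slab_nn_integral_finite:
  fixes b :: "'a::euclidean_space"
  assumes b: "b \<in> Basis"
  shows "(\<integral>\<^sup>+z. ennreal (max 0 (- ln \<bar>z \<bullet> b\<bar>)) * indicator (cball 0 1) z \<partial>lborel) < \<infinity>"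
proof -
  have slab: "{z. \<bar>z \<bullet> b\<bar> \<le> c} \<inter> cball 0 1 \<in> sets borel" for c
    by (intro borel_closed closed_Int closed_Collect_le continuous_intros closed_cball)
  have "(\<integral>\<^sup>+z. ennreal (max 0 (- ln \<bar>z \<bullet> b\<bar>)) * indicator (cball 0 1) z \<partial>lborel)
    \<le> (\<integral>\<^sup>+z. (\<Sum>k. indicator ({z. \<bar>z \<bullet> b\<bar> \<le> exp (- real k)} \<inter> cball 0 1) z) \<partial>lborel)"
  proof (rule nn_integral_mono)
    fix z :: 'a
    show "ennreal (max 0 (- ln \<bar>z \<bullet> b\<bar>)) * indicator (cball 0 1) z
      \<le> (\<Sum>k. indicator ({z. \<bar>z \<bullet> b\<bar> \<le> exp (- real k)} \<inter> cball 0 1) z)"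
      using log_pole_le_suminf[of "z \<bullet> b"] by (auto simp: indicator_def)
  qed
  also have "\<dots> = (\<Sum>k. emeasure lborel ({z. \<bar>z \<bullet> b\<bar> \<le> exp (- real k)} \<inter> cball 0 1))"
    by (subst nn_integral_suminf) (auto intro!: borel_measurable_indicator slab simp: slab)
  also have "\<dots> \<le> (\<Sum>k. ennreal (2 ^ DIM('a) * exp (- real k)))"
    by (intro suminf_le emeasure_slab_le b) auto
  also have "\<dots> < \<infinity>"
  proof -
    have "summable (\<lambda>k. 2 ^ DIM('a) * exp (- 1) ^ k :: real)"
      by (intro summable_mult summable_geometric) auto
    moreover have "exp (- real k) = exp (- 1) ^ k" for k
      using exp_of_nat_mult[of k "- 1 :: real"] by simp
    ultimately show ?thesis by (simp add: suminf_ennreal2 less_top[symmetric])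
  qed
  finally show ?thesis .
qed

lemma log_slab_integrable:
  fixes b :: "'a::euclidean_space"
  assumes "b \<in> Basis"
  shows "integrable lborel (\<lambda>z. max 0 (- ln \<bar>z \<bullet> b\<bar>) * indicator (cball 0 1) z)"
proof (rule integrableI_nonneg)
  have [measurable]: "cball 0 1 \<in> sets (borel :: 'a measure)" by (simp add: borel_closed)
  show "(\<lambda>z. max 0 (- ln \<bar>z \<bullet> b\<bar>) * indicator (cball 0 1) z) \<in> borel_measurable lborel"
    by measurable
  show "(\<integral>\<^sup>+z. ennreal (max 0 (- ln \<bar>z \<bullet> b\<bar>) * indicator (cball 0 1) z) \<partial>lborel) < \<infinity>"
    using log_slab_nn_integral_finite[OF assms]
    by (simp only: ennreal_mult' ennreal_indicator max.cobounded1)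
qed auto

lemma log_pole_integrable: "integrable lborel (\<lambda>z::'a::euclidean_space. max 0 (- ln (norm z)))"
proof -
  obtain b :: 'a where b: "b \<in> Basis" using nonempty_Basis by blast
  show ?thesis
  proof (rule Bochner_Integration.integrable_bound[OF log_slab_integrable[OF b]])
    show "AE z in lborel. norm (max 0 (- ln (norm z))) \<le> norm (max 0 (- ln \<bar>z \<bullet> b\<bar>) * indicator (cball 0 1) z)"
      using AE_lborel_inner_neq[OF b, of 0]
    proof eventually_elim
      fix z :: 'a assume z: "z \<bullet> b \<noteq> 0"
      then have n: "0 < norm z" by auto
      show "norm (max 0 (- ln (norm z))) \<le> norm (max 0 (- ln \<bar>z \<bullet> b\<bar>) * indicator (cball 0 1) z)"
      proof (cases "norm z \<le> 1")
        case True
        have "ln \<bar>z \<bullet> b\<bar> \<le> ln (norm z)" using z Basis_le_norm[OF b, of z] n by simp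
        then show ?thesis using True by auto
      next
        case False then show ?thesis by (simp add: max_def)
      qed
    qed
  qed auto
qed

section \<open>Affine substitutions, and the logarithm integrated against functions of bounded
  support\<close>

lemma lborel_nn_integral_affine:
  fixes f :: "'a::euclidean_space \<Rightarrow> ennreal"
  assumes [measurable]: "f \<in> borel_measurable borel" and c: "c \<noteq> 0"
  shows "(\<integral>\<^sup>+x. f x \<partial>lborel) = ennreal (\<bar>c\<bar> ^ DIM('a)) * (\<integral>\<^sup>+x. f (t + c *\<^sub>R x) \<partial>lborel)"
  by (subst lborel_affine[OF c, of t])
     (simp add: nn_integral_density nn_integral_distr nn_integral_cmult)

lemma lborel_integral_affine:
  fixes f :: "'a::euclidean_space \<Rightarrow> real"
  assumes [measurable]: "f \<in> borel_measurable borel" and c: "c \<noteq> 0"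
  shows "(\<integral>x. f x \<partial>lborel) = \<bar>c\<bar> ^ DIM('a) * (\<integral>x. f (t + c *\<^sub>R x) \<partial>lborel)"
  by (subst lborel_affine[OF c, of t]) (simp add: integral_density integral_distr)

lemma lborel_integrable_affine:
  fixes f :: "'a::euclidean_space \<Rightarrow> real"
  assumes f: "integrable lborel f" and c: "c \<noteq> 0"
  shows "integrable lborel (\<lambda>x. f (t + c *\<^sub>R x))"
proof -
  have [measurable]: "f \<in> borel_measurable borel" using f by auto
  have "integrable (density (distr lborel borel (\<lambda>x. t + c *\<^sub>R x)) (\<lambda>_. ennreal (\<bar>c\<bar> ^ DIM('a)))) f"
    using f lborel_affine[OF c, of t] by metis
  then show ?thesis using c
    by (subst (asm) integrable_density) (auto simp: integrable_distr_eq)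
qed

lemma lborel_integral_translation:
  fixes f :: "'a::euclidean_space \<Rightarrow> real"
  assumes "f \<in> borel_measurable borel"
  shows "(\<integral>x. f (x + t) \<partial>lborel) = (\<integral>x. f x \<partial>lborel)"
  using lborel_integral_affine[OF assms, of 1 t] by (simp add: add.commute)

lemma log_pole_translate_integrable:
  "integrable lborel (\<lambda>x::'a::euclidean_space. max 0 (- ln (norm (x - y))))"
  using lborel_integrable_affine[OF log_pole_integrable, of 1 "- y"] by simp

lemma log_pole_translate_integral:
  "(\<integral>x. max 0 (- ln (norm (x - y))) \<partial>lborel) =
    (\<integral>x. max 0 (- ln (norm x)) \<partial>(lborel :: 'a measure))"
  for y :: "'a::euclidean_space"
  using lborel_integral_translation[of "\<lambda>x. max 0 (- ln (norm x))" "- y"] by simp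

text \<open>From above, \<open>|x - y| \<le> (1 + |x|) (1 + |y|)\<close>; from below, the pole
  itself is kept as a term. On the diagonal \<open>ln 0 = 0\<close>, so nothing is claimed
  there.\<close>

lemma abs_ln_norm_diff_le:
  fixes x y :: "'a::real_normed_vector"
  shows "\<bar>ln (norm (x - y))\<bar> \<le> max 0 (- ln (norm (x - y))) + ln (1 + norm x) + ln (1 + norm y)"
proof (cases "x = y")
  case False
  have "norm (x - y) \<le> (1 + norm x) * (1 + norm y)"
    using norm_triangle_ineq4[of x y] mult_nonneg_nonneg[OF norm_ge_zero[of x] norm_ge_zero[of y]]
    unfolding distrib_left distrib_right by linarith
  then have "ln (norm (x - y)) \<le> ln ((1 + norm x) * (1 + norm y))"
    using False by (intro ln_mono) auto
  also have "\<dots> = ln (1 + norm x) + ln (1 + norm y)"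
    by (intro ln_mult_pos) (auto simp: add_pos_nonneg)
  finally show ?thesis by (auto simp: max_def)
qed simp

text \<open>Meant for Fubini with \<open>\<psi>\<close> an iterated Laplacian of a test function:
  growth in \<open>y\<close> no faster than \<open>ln (1 + |y|)\<close> is integrable against the
  weighted measure.\<close>

lemma log_norm_diff_local_integrable:
  fixes \<psi> :: "'a::euclidean_space \<Rightarrow> real"
  assumes [measurable]: "\<psi> \<in> borel_measurable borel"
    and \<psi>: "\<And>x. \<bar>\<psi> x\<bar> \<le> C" "\<And>x. R < norm x \<Longrightarrow> \<psi> x = 0"
  obtains D where "0 \<le> D"
    "\<And>y. integrable lborel (\<lambda>x. ln (norm (x - y)) * \<psi> x)"
    "\<And>y. (\<integral>x. \<bar>ln (norm (x - y)) * \<psi> x\<bar> \<partial>lborel) \<le> D + D * ln (1 + norm y)"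
proof -
  define V where "V = (\<integral>x. indicator (cball 0 R) x \<partial>(lborel :: 'a measure) :: real)"
  define I where "I = (\<integral>x. max 0 (- ln (norm x)) \<partial>(lborel :: 'a measure))"
  define l where "l = ln (1 + max 0 R)"
  have V: "0 \<le> V" "0 \<le> I" "0 \<le> l" "0 \<le> C"
    unfolding V_def I_def l_def using \<psi>(1)[of 0] by (auto intro!: integral_nonneg_AE)
  have ind: "integrable lborel (\<lambda>x::'a. indicator (cball 0 R) x :: real)"
    using emeasure_lborel_cball_finite[of "0::'a" R] by (auto simp: less_top)
  let ?dom = "\<lambda>y x::'a. C * max 0 (- ln (norm (x - y))) + C * (l + ln (1 + norm y)) * indicator (cball 0 R) x"
  have dom: "integrable lborel (?dom y)" for y
    using ind log_pole_translate_integrable[of y] by auto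
  have le: "\<bar>ln (norm (x - y)) * \<psi> x\<bar> \<le> ?dom y x" for x y
  proof (cases "R < norm x")
    case True then show ?thesis using \<psi>(2) V by simp
  next
    case False
    have "\<bar>ln (norm (x - y)) * \<psi> x\<bar> \<le> (max 0 (- ln (norm (x - y))) + ln (1 + norm x) + ln (1 + norm y)) * C"
      unfolding abs_mult by (intro mult_mono abs_ln_norm_diff_le \<psi>) auto
    also have "\<dots> \<le> (max 0 (- ln (norm (x - y))) + l + ln (1 + norm y)) * C"
      using False V by (intro mult_right_mono add_right_mono add_left_mono) (auto simp: l_def add_pos_nonneg)
    finally show ?thesis using False by (simp add: algebra_simps)
  qed
  have int: "integrable lborel (\<lambda>x. ln (norm (x - y)) * \<psi> x)" for y
    by (rule Bochner_Integration.integrable_bound[OF dom[of y]])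
       (measurable, auto intro!: AE_I2 order_trans[OF le])
  have "(\<integral>x. \<bar>ln (norm (x - y)) * \<psi> x\<bar> \<partial>lborel) \<le> (\<integral>x. ?dom y x \<partial>lborel)" for y
    by (intro integral_mono integrable_abs int dom le)
  also have "(\<integral>x. ?dom y x \<partial>lborel) = C * I + C * (l + ln (1 + norm y)) * V" for y
    using ind log_pole_translate_integrable[of y]
    by (simp add: log_pole_translate_integral V_def I_def)
  also have "C * I + C * (l + ln (1 + norm y)) * V \<le>
      (C * I + C * l * V + C * V) + (C * I + C * l * V + C * V) * ln (1 + norm y)" for y
  proof -
    have "0 \<le> (C * I + C * l * V) * ln (1 + norm y) + C * V" using V by auto
    then show ?thesis by (simp add: algebra_simps)
  qed
  finally have "(\<integral>x. \<bar>ln (norm (x - y)) * \<psi> x\<bar> \<partial>lborel) \<le>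
      (C * I + C * l * V + C * V) + (C * I + C * l * V + C * V) * ln (1 + norm y)" for y .
  then show thesis using that[of "C * I + C * l * V + C * V"] V int by auto
qed

section \<open>Rotation invariance and polar coordinates\<close>

text \<open>The uniqueness argument for Haar measure: a translation invariant measure is proportional to
  Lebesgue measure, and the factor is 1 because orthogonal maps preserve the unit ball.\<close>

lemma lborel_distr_orthogonal:
  fixes f :: "'a::euclidean_space \<Rightarrow> 'a"
  assumes f: "orthogonal_transformation f"
  shows "distr lborel borel f = lborel"
proof -
  have lin: "linear f" by (rule orthogonal_transformation_linear[OF f])
  have norm_f: "norm (f x) = norm x" for x by (rule orthogonal_transformation_norm[OF f])
  have surj: "surj f" by (rule orthogonal_transformation_surj[OF f])
  have [measurable]: "f \<in> borel_measurable borel"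
    using linear_continuous_on[of f UNIV] lin
    by (intro borel_measurable_continuous_onI) (simp add: linear_conv_bounded_linear)
  have trans: "(\<integral>\<^sup>+x. h (t + x) \<partial>lborel) = (\<integral>\<^sup>+x. h x \<partial>lborel)"
    if [measurable]: "h \<in> borel_measurable borel" for h :: "'a \<Rightarrow> ennreal" and t
    using lborel_nn_integral_affine[OF that, of 1 t] by simp
  have trans_f: "(\<integral>\<^sup>+x. h (f x + t) \<partial>lborel) = (\<integral>\<^sup>+x. h (f x) \<partial>lborel)"
    if [measurable]: "h \<in> borel_measurable borel" for h :: "'a \<Rightarrow> ennreal" and t
  proof -
    obtain s where s: "t = f s" using surj by (metis surj_def)
    have "(\<integral>\<^sup>+x. h (f x + t) \<partial>lborel) = (\<integral>\<^sup>+x. h (f (s + x)) \<partial>lborel)"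
      by (simp add: s linear_add[OF lin] add.commute)
    also have "\<dots> = (\<integral>\<^sup>+x. h (f x) \<partial>lborel)" by (rule trans) measurable
    finally show ?thesis .
  qed
  let ?B = "cball (0::'a) 1"
  let ?b = "\<lambda>y. indicator ?B y :: ennreal"
  have B[measurable]: "?B \<in> sets borel" by (simp add: borel_closed)
  have Bf: "?b (- f x) = ?b x" for x by (simp add: indicator_def norm_f)
  define v where "v = emeasure lborel ?B"
  have v: "v \<noteq> 0" "v \<noteq> \<infinity>"
    using emeasure_lborel_cball_finite[of "0::'a" 1] content_cball_pos[of 1 "0::'a"]
    by (auto simp: v_def measure_def)
  show ?thesis
  proof (rule measure_eqI)
    fix A :: "'a set" assume "A \<in> sets (distr lborel borel f)"
    then have A[measurable]: "A \<in> sets borel" by simp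
    let ?a = "indicator A :: 'a \<Rightarrow> ennreal"
    have "emeasure (distr lborel borel f) A * v = (\<integral>\<^sup>+x. ?a (f x) \<partial>lborel) * v"
    proof -
      have "emeasure (distr lborel borel f) A = (\<integral>\<^sup>+x. ?a x \<partial>distr lborel borel f)" by simp
      also have "\<dots> = (\<integral>\<^sup>+x. ?a (f x) \<partial>lborel)" by (rule nn_integral_distr) measurable
      finally show ?thesis by simp
    qed
    also have "\<dots> = (\<integral>\<^sup>+y. (\<integral>\<^sup>+x. ?a (f x) \<partial>lborel) * ?b y \<partial>lborel)"
      by (subst nn_integral_cmult) (simp_all add: v_def)
    also have "\<dots> = (\<integral>\<^sup>+y. (\<integral>\<^sup>+x. ?a (f x + y) * ?b y \<partial>lborel) \<partial>lborel)"
    proof (intro nn_integral_cong)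
      fix y
      show "(\<integral>\<^sup>+x. ?a (f x) \<partial>lborel) * ?b y = (\<integral>\<^sup>+x. ?a (f x + y) * ?b y \<partial>lborel)"
        using trans_f[of ?a y] by (subst nn_integral_multc) simp_all
    qed
    also have "\<dots> = (\<integral>\<^sup>+x. (\<integral>\<^sup>+y. ?a (f x + y) * ?b y \<partial>lborel) \<partial>lborel)"
      by (rule lborel_pair.Fubini'[where f = "\<lambda>x y. ?a (f x + y) * ?b y"]) simp
    \<comment> \<open>Translating \<open>y\<close> by \<open>f x\<close> moves \<open>f\<close> from
      the arbitrary set \<open>A\<close> to the unit ball, where its effect is known: the ball is
      symmetric and \<open>f\<close> preserves norms.\<close>
    also have "\<dots> = (\<integral>\<^sup>+x. (\<integral>\<^sup>+y. ?a y * ?b (y - f x) \<partial>lborel) \<partial>lborel)"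
    proof (rule nn_integral_cong)
      fix x
      show "(\<integral>\<^sup>+y. ?a (f x + y) * ?b y \<partial>lborel) = (\<integral>\<^sup>+y. ?a y * ?b (y - f x) \<partial>lborel)"
        using trans[of "\<lambda>y. ?a y * ?b (y - f x)" "f x"] by simp
    qed
    also have "\<dots> = (\<integral>\<^sup>+y. (\<integral>\<^sup>+x. ?a y * ?b (y - f x) \<partial>lborel) \<partial>lborel)"
      by (rule lborel_pair.Fubini'[where f = "\<lambda>x y. ?a y * ?b (y - f x)", symmetric]) simp
    also have "\<dots> = (\<integral>\<^sup>+y. ?a y * v \<partial>lborel)"
    proof (intro nn_integral_cong)
      fix y
      have "(\<integral>\<^sup>+x. ?b (y - f x) \<partial>lborel) = (\<integral>\<^sup>+x. ?b (- (f x + - y)) \<partial>lborel)" by simp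
      also have "\<dots> = (\<integral>\<^sup>+x. ?b (- f x) \<partial>lborel)" by (rule trans_f) measurable
      also have "\<dots> = v" unfolding Bf by (simp add: v_def)
      finally show "(\<integral>\<^sup>+x. ?a y * ?b (y - f x) \<partial>lborel) = ?a y * v"
        by (subst nn_integral_cmult) simp_all
    qed
    also have "\<dots> = emeasure lborel A * v" by (simp add: nn_integral_multc)
    finally show "emeasure (distr lborel borel f) A = emeasure lborel A"
      using v by (simp add: mult.commute[of _ v] ennreal_mult_cancel_left)
  qed simp
qed

text \<open>By scaling, the two measures \<open>k dy\<close> and \<open>dy\<close> give proportional masses to all balls around 0, so
  their images under the norm are proportional.\<close>

lemma nn_integral_homogeneous_radial:
  fixes k :: "'a::euclidean_space \<Rightarrow> ennreal" and g :: "real \<Rightarrow> ennreal"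
  assumes k[measurable]: "k \<in> borel_measurable borel"
    and hom: "\<And>c y. 0 < c \<Longrightarrow> k (c *\<^sub>R y) = k y"
    and fin: "(\<integral>\<^sup>+y. k y * indicator (cball 0 1) y \<partial>lborel) < \<infinity>"
  obtains C where "C < \<infinity>" "\<And>g. g \<in> borel_measurable borel \<Longrightarrow>
    (\<integral>\<^sup>+y. k y * g (norm y) \<partial>lborel) = C * (\<integral>\<^sup>+y. g (norm y) \<partial>(lborel :: 'a measure))"
proof -
  have cb[measurable]: "cball 0 R \<in> sets (borel :: 'a measure)" for R by (simp add: borel_closed)
  define v where "v = emeasure lborel (cball (0::'a) 1)"
  have v: "v \<noteq> 0" "v \<noteq> \<infinity>"
    using emeasure_lborel_cball_finite[of "0::'a" 1] content_cball_pos[of 1 "0::'a"]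
    by (auto simp: v_def measure_def)
  define N where "N = (\<integral>\<^sup>+y. k y * indicator (cball 0 1) y \<partial>lborel)"
  define C where "C = N / v"
  have C: "C < \<infinity>" using fin v unfolding C_def N_def[symmetric]
    by (cases N; cases v) (auto simp: divide_ennreal)
  define L where "L = distr (lborel :: 'a measure) borel norm"
  define A where "A = distr (density lborel k) borel norm"
  have scale: "(\<integral>\<^sup>+y. h y * indicator (cball 0 R) y \<partial>lborel) =
      ennreal (R ^ DIM('a)) * (\<integral>\<^sup>+y. h y * indicator (cball 0 1) y \<partial>lborel)"
    if [measurable]: "h \<in> borel_measurable borel" and "\<And>c y. 0 < c \<Longrightarrow> h (c *\<^sub>R y) = h y"
      and R: "0 < R" for h :: "'a \<Rightarrow> ennreal" and R
  proof -
    have "(\<integral>\<^sup>+y. h y * indicator (cball 0 R) y \<partial>lborel) =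
      ennreal (R ^ DIM('a)) * (\<integral>\<^sup>+y. h (R *\<^sub>R y) * indicator (cball 0 R) (R *\<^sub>R y) \<partial>lborel)"
      using lborel_nn_integral_affine[of "\<lambda>y. h y * indicator (cball 0 R) y" R 0] R by simp
    also have "(\<lambda>y. h (R *\<^sub>R y) * indicator (cball 0 R) (R *\<^sub>R y)) = (\<lambda>y::'a. h y * indicator (cball 0 1) y)"
      using that by (auto simp: fun_eq_iff indicator_def)
    finally show ?thesis .
  qed
  have pre: "norm -` {..R} = cball (0::'a) R" for R by auto
  have eA: "emeasure A {..R} = (\<integral>\<^sup>+y. k y * indicator (cball 0 R) y \<partial>lborel)" for R
    by (simp add: A_def emeasure_distr emeasure_density pre)
  have eL: "emeasure L {..R} = (\<integral>\<^sup>+y. 1 * indicator (cball 0 R) y \<partial>(lborel :: 'a measure))" for R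
    by (simp add: L_def emeasure_distr pre)
  have eq: "emeasure A {..R} = C * emeasure L {..R}" for R
  proof -
    consider "R < 0" | "R = 0" | "0 < R" by linarith
    then show ?thesis
    proof cases
      case 1 then show ?thesis by (simp add: eA eL)
    next
      \<comment> \<open>Scaling is available only for positive radii. The ball of radius 0 is a null
        set, whatever the value of \<open>k\<close> at the origin.\<close>
      case 2
      have "(\<integral>\<^sup>+y. k y * indicator {0} y \<partial>lborel) = 0"
        using AE_lborel_singleton[of "0::'a"]
        by (subst nn_integral_0_iff_AE) (auto simp: indicator_def elim!: eventually_mono)
      then show ?thesis using 2 by (simp add: eA eL)
    next
      case 3
      have "C * v = N" using v unfolding C_def by (simp add: ennreal_divide_times ennreal_divide_self less_top)
      moreover have "(\<integral>\<^sup>+y. 1 * indicator (cball 0 1) y \<partial>(lborel :: 'a measure)) = v" by (simp add: v_def)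
      ultimately have "ennreal (R ^ DIM('a)) * N =
          C * (ennreal (R ^ DIM('a)) * (\<integral>\<^sup>+y. 1 * indicator (cball 0 1) y \<partial>(lborel :: 'a measure)))"
        by (simp only: mult.left_commute[of C])
      moreover have "emeasure L {..R} =
          ennreal (R ^ DIM('a)) * (\<integral>\<^sup>+y. 1 * indicator (cball 0 1) y \<partial>(lborel :: 'a measure))"
        unfolding eL by (rule scale[OF _ _ 3]) auto
      moreover have "emeasure A {..R} = ennreal (R ^ DIM('a)) * N"
        unfolding eA N_def by (rule scale[OF k hom 3])
      ultimately show ?thesis by (simp only:)
    qed
  qed
  have "A = density L (\<lambda>_. C)"
  proof (rule measure_eqI_generator_eq)
    let ?E = "range (atMost :: real \<Rightarrow> real set)"
    show "Int_stable ?E" by (auto simp: Int_stable_def)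
    show "?E \<subseteq> Pow UNIV" by simp
    show "sets A = sigma_sets UNIV ?E" "sets (density L (\<lambda>_. C)) = sigma_sets UNIV ?E"
      by (simp_all add: A_def L_def borel_eq_atMost)
    show "range (\<lambda>i. {..real i}) \<subseteq> ?E" by auto
    show "(\<Union>i. {..real i}) = UNIV" by (auto intro: real_arch_simple)
    show "emeasure A X = emeasure (density L (\<lambda>_. C)) X" if "X \<in> ?E" for X
    proof -
      from that obtain R where X: "X = {..R}" by auto
      have "emeasure (density L (\<lambda>_. C)) X = C * emeasure L X"
        unfolding X by (subst emeasure_density) (auto simp: L_def nn_integral_cmult)
      then show ?thesis using eq X by simp
    qed
    show "emeasure A {..real i} \<noteq> \<infinity>" for i
    proof -
      have "emeasure L {..real i} < \<infinity>"
        using emeasure_lborel_cball_finite[of "0::'a" "real i"] by (simp add: eL)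
      then show ?thesis unfolding eq using C by (auto simp: ennreal_mult_eq_top_iff less_top)
    qed
  qed
  then have "(\<integral>\<^sup>+y. k y * g (norm y) \<partial>lborel) = C * (\<integral>\<^sup>+y. g (norm y) \<partial>(lborel :: 'a measure))"
    if [measurable]: "g \<in> borel_measurable borel" for g
  proof -
    have "(\<integral>\<^sup>+y. k y * g (norm y) \<partial>lborel) = (\<integral>\<^sup>+r. g r \<partial>A)"
      by (simp add: A_def nn_integral_distr nn_integral_density)
    also have "\<dots> = (\<integral>\<^sup>+r. C * g r \<partial>L)"
      unfolding \<open>A = density L (\<lambda>_. C)\<close> by (subst nn_integral_density) (auto simp: L_def)
    also have "\<dots> = C * (\<integral>\<^sup>+y. g (norm y) \<partial>(lborel :: 'a measure))"
      by (simp add: L_def nn_integral_distr nn_integral_cmult)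
    finally show ?thesis .
  qed
  then show thesis using that C by blast
qed

section \<open>Test functions and integration by parts\<close>

lemma partial_eq: "(f has_derivative D) (at x) \<Longrightarrow> partial b f x = D b"
  unfolding partial_def by (simp add: frechet_derivative_at[symmetric])

lemma differentiable_frechet:
  "f differentiable (at x) \<Longrightarrow> (f has_derivative frechet_derivative f (at x)) (at x)"
  by (simp add: frechet_derivative_works)

lemma partial_add:
  assumes "f differentiable (at x)" "g differentiable (at x)"
  shows "partial b (\<lambda>x. f x + g x) x = partial b f x + partial b g x"
  using partial_eq[OF has_derivative_add[OF assms[THEN differentiable_frechet]]] by (simp add: partial_def)

lemma partial_diff:
  assumes "f differentiable (at x)" "g differentiable (at x)"
  shows "partial b (\<lambda>x. f x - g x) x = partial b f x - partial b g x"
  using partial_eq[OF has_derivative_diff[OF assms[THEN differentiable_frechet]]] by (simp add: partial_def)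

lemma partial_mult:
  assumes "f differentiable (at x)" "g differentiable (at x)"
  shows "partial b (\<lambda>x. f x * g x) x = f x * partial b g x + partial b f x * g x"
  using partial_eq[OF has_derivative_mult[OF assms[THEN differentiable_frechet]]] by (simp add: partial_def)

lemma partial_minus:
  assumes "f differentiable (at x)"
  shows "partial b (\<lambda>x. - f x) x = - partial b f x"
  using partial_eq[OF has_derivative_minus[OF assms[THEN differentiable_frechet]]] by (simp add: partial_def)

lemma partial_const: "partial b (\<lambda>_. c) x = 0"
  by (rule partial_eq[of _ "\<lambda>_. 0"]) simp

lemma Ck_const: "Ck k (\<lambda>_. c)"
proof (induction k arbitrary: c)
  case (Suc k)
  have "partial b (\<lambda>_. c) = (\<lambda>_::'a. 0)" for b :: 'a by (intro ext partial_const)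
  then show ?case using Suc by simp
qed simp

lemma Ck_add: "Ck k f \<Longrightarrow> Ck k g \<Longrightarrow> Ck k (\<lambda>x. f x + g x)"
proof (induction k arbitrary: f g)
  case (Suc k)
  have "partial b (\<lambda>x. f x + g x) = (\<lambda>x. partial b f x + partial b g x)" for b
    using Suc.prems by (intro ext partial_add) auto
  then show ?case using Suc by auto
qed (auto intro: continuous_intros)

lemma Ck_minus: "Ck k f \<Longrightarrow> Ck k (\<lambda>x. - f x)"
proof (induction k arbitrary: f)
  case (Suc k)
  have "partial b (\<lambda>x. - f x) = (\<lambda>x. - partial b f x)" for b
    using Suc.prems by (intro ext partial_minus) auto
  then show ?case using Suc by auto
qed (auto intro: continuous_intros)

lemma Ck_sum: "finite A \<Longrightarrow> (\<And>i. i \<in> A \<Longrightarrow> Ck k (f i)) \<Longrightarrow> Ck k (\<lambda>x. \<Sum>i\<in>A. f i x)"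
  by (induction A rule: finite_induct) (auto intro: Ck_const Ck_add)

lemma test_function_iff:
  "test_function \<phi> \<longleftrightarrow> (\<forall>k. Ck k \<phi>) \<and> (\<exists>R. \<forall>x. R < norm x \<longrightarrow> \<phi> x = 0)"
proof -
  have "compact (closure (support_on UNIV \<phi>)) \<longleftrightarrow> bounded (support_on UNIV \<phi>)"
    by (auto simp: compact_eq_bounded_closed intro: bounded_subset[OF _ closure_subset])
  also have "\<dots> \<longleftrightarrow> (\<exists>R. \<forall>x. R < norm x \<longrightarrow> \<phi> x = 0)"
    by (auto simp: bounded_iff support_on_def not_le[symmetric])
  finally show ?thesis by (simp add: test_function_def)
qed

lemma partial_zero_outside:
  assumes "\<And>x. R < norm x \<Longrightarrow> \<phi> x = 0" "R < norm x"
  shows "partial b \<phi> x = 0"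
proof -
  have "((\<lambda>_. 0 :: real) has_derivative (\<lambda>_. 0)) (at x)" by simp
  then have "(\<phi> has_derivative (\<lambda>_. 0)) (at x)"
  proof (rule has_derivative_transform_within_open)
    show "open {x. R < norm x}" by (intro open_Collect_less continuous_intros)
  qed (use assms in auto)
  then show ?thesis using partial_eq by metis
qed

lemma test_function_partial:
  assumes \<phi>: "test_function \<phi>" and b: "b \<in> Basis"
  shows "test_function (partial b \<phi>)"
proof -
  have "Ck k (partial b \<phi>)" for k
    using \<phi> b by (metis Ck.simps(2) test_function_def)
  then show ?thesis using \<phi> partial_zero_outside unfolding test_function_iff by metis
qed

lemma test_function_differentiable: "test_function \<phi> \<Longrightarrow> \<phi> differentiable (at x)"
  unfolding test_function_def by (metis Ck.simps(2))

lemma test_function_continuous: "test_function \<phi> \<Longrightarrow> continuous_on UNIV \<phi>"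
  unfolding test_function_def by (metis Ck.simps(1))

lemma test_function_neg_laplacian:
  assumes \<phi>: "test_function \<phi>" shows "test_function (\<lambda>x. - laplacian \<phi> x)"
proof -
  have pp: "test_function (partial b (partial b \<phi>))" if "b \<in> Basis" for b
    using \<phi> that by (intro test_function_partial)
  obtain R where R: "\<And>x. R < norm x \<Longrightarrow> \<phi> x = 0" using \<phi> by (auto simp: test_function_iff)
  have "Ck k (\<lambda>x. - laplacian \<phi> x)" for k
    unfolding laplacian_def using pp by (intro Ck_minus Ck_sum) (auto simp: test_function_def)
  moreover have "- laplacian \<phi> x = 0" if "R < norm x" for x
  proof -
    have "partial b \<phi> x = 0" if "R < norm x" for b x by (rule partial_zero_outside[OF R that])
    then have "partial b (partial b \<phi>) x = 0" for b by (rule partial_zero_outside[OF _ that])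
    then show ?thesis by (simp add: laplacian_def)
  qed
  ultimately show ?thesis unfolding test_function_iff by blast
qed

lemma neg_laplacian_power_Suc:
  "neg_laplacian_power (Suc k) \<phi> = (\<lambda>x. - laplacian (neg_laplacian_power k \<phi>) x)"
  by (simp add: neg_laplacian_power_def)

lemma test_function_neg_laplacian_power:
  "test_function \<phi> \<Longrightarrow> test_function (neg_laplacian_power k \<phi>)"
  by (induction k) (auto simp: neg_laplacian_power_Suc test_function_neg_laplacian,
      simp add: neg_laplacian_power_def)

lemma continuous_compact_support_bounded:
  fixes f :: "'a::euclidean_space \<Rightarrow> real"
  assumes f: "continuous_on UNIV f" and R: "\<And>x. R < norm x \<Longrightarrow> f x = 0"
  obtains C where "0 < C" "\<And>x. \<bar>f x\<bar> \<le> C"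
proof -
  have "compact (f ` cball 0 R)"
    using f by (intro compact_continuous_image continuous_on_subset[OF f]) auto
  then obtain C where C: "0 < C" "\<forall>y\<in>f ` cball 0 R. norm y \<le> C"
    using compact_imp_bounded bounded_pos by metis
  have "\<bar>f x\<bar> \<le> C" for x
    using C R[of x] by (cases "R < norm x") auto
  then show thesis using that C(1) by blast
qed

lemma cball_indicator_integrable:
  "integrable lborel (\<lambda>x::'a::euclidean_space. indicator (cball c R) x :: real)"
  using emeasure_lborel_cball_finite[of c R] by (auto simp: less_top)

lemma continuous_compact_support_integrable:
  fixes f :: "'a::euclidean_space \<Rightarrow> real"
  assumes f: "continuous_on UNIV f" and R: "\<And>x. R < norm x \<Longrightarrow> f x = 0"
  shows "integrable lborel f"
proof -
  obtain C where C: "0 < C" "\<And>x. \<bar>f x\<bar> \<le> C" using continuous_compact_support_bounded[OF f R] by blast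
  show ?thesis
  proof (rule Bochner_Integration.integrable_bound)
    show "integrable lborel (\<lambda>x. C * indicator (cball 0 R) x)"
      using cball_indicator_integrable by auto
    show "f \<in> borel_measurable lborel" using f by (simp add: borel_measurable_continuous_onI)
    show "AE x in lborel. norm (f x) \<le> norm (C * indicator (cball 0 R) x)"
      using C R by (intro AE_I2) (auto simp: indicator_def not_le)
  qed
qed

text \<open>Differentiating the translation invariance of the integral under the integral sign.\<close>

lemma integral_partial_eq_0:
  fixes F :: "'a::euclidean_space \<Rightarrow> real"
  assumes d: "\<And>x. F differentiable (at x)" and c: "continuous_on UNIV (partial b F)"
    and b: "b \<in> Basis" and R: "\<And>x. R < norm x \<Longrightarrow> F x = 0"
  shows "(\<integral>x. partial b F x \<partial>lborel) = 0"
proof -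
  have cF: "continuous_on UNIV F"
    using d by (intro differentiable_imp_continuous_on) (auto simp: differentiable_on_def)
  then have [measurable]: "F \<in> borel_measurable borel" by (rule borel_measurable_continuous_onI)
  have iF: "integrable lborel F" by (rule continuous_compact_support_integrable[OF cF R])
  have pR: "R < norm x \<Longrightarrow> partial b F x = 0" for x by (rule partial_zero_outside[OF R])
  obtain C where C: "0 < C" "\<And>x. \<bar>partial b F x\<bar> \<le> C"
    using continuous_compact_support_bounded[OF c pR] by blast
  \<comment> \<open>Increments of at most 1 keep all difference quotients supported in
    \<open>cball 0 (R + 1)\<close>, so that one integrable bound serves for every
    \<open>k\<close>.\<close>
  define e where "e k = inverse (real (Suc k))" for k
  have e: "0 < e k" "e k \<le> 1" for k by (auto simp: e_def inverse_le_1_iff)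
  define G where "G k x = (F (x + e k *\<^sub>R b) - F x) / e k" for k x
  have line: "((\<lambda>t. F (x + t *\<^sub>R b)) has_real_derivative partial b F (x + t *\<^sub>R b)) (at t)" for x t
  proof -
    have "((\<lambda>t. x + t *\<^sub>R b) has_derivative (\<lambda>v. v *\<^sub>R b)) (at t)"
      by (auto intro!: derivative_eq_intros)
    then have "((\<lambda>t. F (x + t *\<^sub>R b)) has_derivative
        (\<lambda>v. frechet_derivative F (at (x + t *\<^sub>R b)) (v *\<^sub>R b))) (at t)"
      by (rule has_derivative_compose[OF _ differentiable_frechet[OF d]])
    moreover have "frechet_derivative F (at y) (s *\<^sub>R b) = s * partial b F y" for y s
      unfolding partial_def
      using linear_cmul[OF linear_frechet_derivative[OF d]] by simp
    ultimately show ?thesis by (simp add: has_field_derivative_def mult_commute_abs)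
  qed
  have mvt: "\<exists>z. 0 < z \<and> z < e k \<and> G k x = partial b F (x + z *\<^sub>R b)" for k x
  proof -
    obtain z where "0 < z" "z < e k"
      "F (x + e k *\<^sub>R b) - F (x + 0 *\<^sub>R b) = (e k - 0) * partial b F (x + z *\<^sub>R b)"
      using MVT2[where a = 0 and b = "e k" and f = "\<lambda>t. F (x + t *\<^sub>R b)"
        and f' = "\<lambda>t. partial b F (x + t *\<^sub>R b)"] e(1)[of k] line by blast
    then show ?thesis using e(1)[of k] by (auto simp: G_def field_simps)
  qed
  have "(\<lambda>k. \<integral>x. G k x \<partial>lborel) \<longlonglongrightarrow> (\<integral>x. partial b F x \<partial>lborel)"
  proof (rule integral_dominated_convergence)
    show "partial b F \<in> borel_measurable lborel"
      using c by (simp add: borel_measurable_continuous_onI)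
    show "G k \<in> borel_measurable lborel" for k unfolding G_def[abs_def] by measurable
    show "integrable lborel (\<lambda>x. C * indicator (cball 0 (R + 1)) x :: real)"
      using cball_indicator_integrable by auto
    show "AE x in lborel. (\<lambda>k. G k x) \<longlonglongrightarrow> partial b F x"
    proof (rule AE_I2)
      fix x
      have "((\<lambda>h. (F (x + (0 + h) *\<^sub>R b) - F (x + 0 *\<^sub>R b)) / h) \<longlongrightarrow> partial b F (x + 0 *\<^sub>R b)) (at 0)"
        using line[of x 0] unfolding DERIV_def .
      then have "((\<lambda>h. (F (x + h *\<^sub>R b) - F x) / h) \<longlongrightarrow> partial b F x) (at 0)" by simp
      moreover have "filterlim e (at 0) sequentially"
        unfolding filterlim_at using LIMSEQ_inverse_real_of_nat by (auto simp: e_def[abs_def] add.commute)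
      ultimately show "(\<lambda>k. G k x) \<longlonglongrightarrow> partial b F x"
        unfolding G_def by (rule filterlim_compose)
    qed
    show "AE x in lborel. norm (G k x) \<le> C * indicator (cball 0 (R + 1)) x" for k
    proof (rule AE_I2)
      fix x
      show "norm (G k x) \<le> C * indicator (cball 0 (R + 1)) x"
      proof (cases "norm x \<le> R + 1")
        case True
        then show ?thesis using mvt[of k x] C(2) by auto
      next
        case False
        have "norm x \<le> norm (x + e k *\<^sub>R b) + norm (e k *\<^sub>R b)"
          using norm_triangle_ineq4[of "x + e k *\<^sub>R b" "e k *\<^sub>R b"] by simp
        then have "R < norm (x + e k *\<^sub>R b)" using False b e[of k] by simp
        then show ?thesis using False R by (simp add: G_def)
      qed
    qed
  qed
  moreover have "(\<integral>x. G k x \<partial>lborel) = 0" for k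
  proof -
    have i: "integrable lborel (\<lambda>x. F (x + e k *\<^sub>R b))"
      using lborel_integrable_affine[OF iF, of 1 "e k *\<^sub>R b"] by (simp add: add.commute)
    show ?thesis unfolding G_def using i iF lborel_integral_translation[of F "e k *\<^sub>R b"] by simp
  qed
  ultimately show ?thesis by (simp add: LIMSEQ_const_iff)
qed

text \<open>In each basis direction the difference of the two integrands is the derivative of
  \<open>f * partial b \<phi> - partial b f * \<phi>\<close>: the products of first derivatives
  cancel, and \<open>\<phi>\<close> gives this function bounded support although \<open>f\<close>
  has none.\<close>

lemma green_test_function:
  fixes f :: "'a::euclidean_space \<Rightarrow> real"
  assumes f: "\<And>x. f differentiable (at x)"
    and f': "\<And>b x. b \<in> Basis \<Longrightarrow> partial b f differentiable (at x)"
    and f'': "\<And>b. b \<in> Basis \<Longrightarrow> continuous_on UNIV (partial b (partial b f))"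
    and \<phi>: "test_function \<phi>"
  shows "(\<integral>x. f x * laplacian \<phi> x \<partial>lborel) = (\<integral>x. laplacian f x * \<phi> x \<partial>lborel)"
proof -
  obtain R where R: "\<And>x. R < norm x \<Longrightarrow> \<phi> x = 0" using \<phi> by (auto simp: test_function_iff)
  have cf: "continuous_on UNIV f"
    using f by (intro differentiable_imp_continuous_on) (auto simp: differentiable_on_def)
  have t': "test_function (partial b \<phi>)" if "b \<in> Basis" for b
    using \<phi> that by (rule test_function_partial)
  have t'': "test_function (partial b (partial b \<phi>))" if "b \<in> Basis" for b
    by (rule test_function_partial[OF t'[OF that] that])
  have R': "R < norm x \<Longrightarrow> partial b \<phi> x = 0" for b x by (rule partial_zero_outside[OF R])
  have R'': "R < norm x \<Longrightarrow> partial b (partial b \<phi>) x = 0" for b x by (rule partial_zero_outside[OF R'])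
  have i1: "integrable lborel (\<lambda>x. f x * partial b (partial b \<phi>) x)" if "b \<in> Basis" for b
    using R'' test_function_continuous[OF t''] that cf
    by (intro continuous_compact_support_integrable[where R = R] continuous_intros) auto
  have i2: "integrable lborel (\<lambda>x. partial b (partial b f) x * \<phi> x)" if "b \<in> Basis" for b
    using R test_function_continuous[OF \<phi>] that f''
    by (intro continuous_compact_support_integrable[where R = R] continuous_intros) auto
  have eq: "(\<integral>x. f x * partial b (partial b \<phi>) x \<partial>lborel) = (\<integral>x. partial b (partial b f) x * \<phi> x \<partial>lborel)"
    if b: "b \<in> Basis" for b
  proof -
    let ?F = "\<lambda>x. f x * partial b \<phi> x - partial b f x * \<phi> x"
    note df = f f'[OF b] test_function_differentiable[OF \<phi>] test_function_differentiable[OF t'[OF b]]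
    have p: "partial b ?F x = f x * partial b (partial b \<phi>) x - partial b (partial b f) x * \<phi> x" for x
    proof -
      have "partial b ?F x = partial b (\<lambda>x. f x * partial b \<phi> x) x - partial b (\<lambda>x. partial b f x * \<phi> x) x"
        by (intro partial_diff differentiable_mult df)
      then show ?thesis using df by (simp add: partial_mult)
    qed
    have "(\<integral>x. partial b ?F x \<partial>lborel) = 0"
    proof (rule integral_partial_eq_0[OF _ _ b])
      show "?F differentiable (at x)" for x
        by (intro differentiable_diff differentiable_mult df)
      show "continuous_on UNIV (partial b ?F)"
        unfolding p[abs_def]
        using cf f''[OF b] test_function_continuous[OF \<phi>] test_function_continuous[OF t''[OF b]]
        by (intro continuous_intros)
      show "?F x = 0" if "R < norm x" for x using R[OF that] R'[OF that] by simp
    qed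
    then show ?thesis unfolding p using i1[OF b] i2[OF b] by simp
  qed
  have "(\<integral>x. f x * laplacian \<phi> x \<partial>lborel) = (\<Sum>b\<in>Basis. \<integral>x. f x * partial b (partial b \<phi>) x \<partial>lborel)"
    unfolding laplacian_def sum_distrib_left by (rule Bochner_Integration.integral_sum[OF i1])
  also have "\<dots> = (\<Sum>b\<in>Basis. \<integral>x. partial b (partial b f) x * \<phi> x \<partial>lborel)"
    by (intro sum.cong refl eq)
  also have "\<dots> = (\<integral>x. laplacian f x * \<phi> x \<partial>lborel)"
    unfolding laplacian_def sum_distrib_right by (rule Bochner_Integration.integral_sum[OF i2, symmetric])
  finally show ?thesis .
qed

section \<open>The logarithm as fundamental solution\<close>

lemma has_derivative_norm_diff_power2:
  fixes x y :: "'a::real_inner"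
  shows "((\<lambda>x. (norm (x - y))\<^sup>2) has_derivative (\<lambda>v. 2 * ((x - y) \<bullet> v))) (at x)"
  unfolding power2_norm_eq_inner
  by (auto intro!: derivative_eq_intros simp: inner_commute)

text \<open>Radial functions enter through \<open>s = |x - y|^2\<close>, which is smooth even at
  \<open>x = y\<close>; the chain rule gives the Laplacian \<open>4 s h'' + 2 d h'\<close> in
  dimension \<open>d\<close>. The derivatives at \<open>s = 0\<close> are two-sided, which suits
  functions of \<open>s + e\<close> with \<open>e > 0\<close>.\<close>

lemma green_radial:
  fixes y :: "'a::euclidean_space" and h h' h'' :: "real \<Rightarrow> real"
  assumes h: "\<And>s. 0 \<le> s \<Longrightarrow> (h has_real_derivative h' s) (at s)"
    and h': "\<And>s. 0 \<le> s \<Longrightarrow> (h' has_real_derivative h'' s) (at s)"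
    and h'': "continuous_on {0..} h''" and \<phi>: "test_function \<phi>"
  shows "(\<integral>x. h ((norm (x - y))\<^sup>2) * - laplacian \<phi> x \<partial>lborel) =
    (\<integral>x. - (4 * (norm (x - y))\<^sup>2 * h'' ((norm (x - y))\<^sup>2) + 2 * real DIM('a) * h' ((norm (x - y))\<^sup>2)) * \<phi> x \<partial>lborel)"
proof -
  let ?s = "\<lambda>x. (norm (x - y))\<^sup>2"
  let ?f = "\<lambda>x. h (?s x)"
  have chain: "((\<lambda>x. g (?s x)) has_derivative (\<lambda>v. g' (?s x) * (2 * ((x - y) \<bullet> v)))) (at x)"
    if "(g has_real_derivative g' (?s x)) (at (?s x))" for g g' x
    using has_derivative_compose[OF has_derivative_norm_diff_power2 that[unfolded has_field_derivative_def]]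
    by simp
  have d1: "(?f has_derivative (\<lambda>v. h' (?s x) * (2 * ((x - y) \<bullet> v)))) (at x)" for x
    by (rule chain) (simp add: h)
  have p1: "partial b ?f = (\<lambda>x. h' (?s x) * (2 * ((x - y) \<bullet> b)))" for b
    by (rule ext, rule partial_eq[OF d1])
  have d2: "((\<lambda>x. h' (?s x) * (2 * ((x - y) \<bullet> b))) has_derivative
      (\<lambda>v. h' (?s x) * (2 * (v \<bullet> b)) + h'' (?s x) * (2 * ((x - y) \<bullet> v)) * (2 * ((x - y) \<bullet> b)))) (at x)"
    for x b
  proof (rule has_derivative_mult)
    show "((\<lambda>x. h' (?s x)) has_derivative (\<lambda>v. h'' (?s x) * (2 * ((x - y) \<bullet> v)))) (at x)"
      by (rule chain) (simp add: h')
    show "((\<lambda>x. 2 * ((x - y) \<bullet> b)) has_derivative (\<lambda>v. 2 * (v \<bullet> b))) (at x)"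
      by (auto intro!: derivative_eq_intros)
  qed
  have p2: "partial b (partial b ?f) = (\<lambda>x. h' (?s x) * 2 + h'' (?s x) * 4 * ((x - y) \<bullet> b)\<^sup>2)"
    if "b \<in> Basis" for b
    unfolding p1 using that
    by (intro ext, subst partial_eq[OF d2]) (simp add: power2_eq_square)
  have cont: "continuous_on UNIV (\<lambda>x. g (?s x))" if "continuous_on {0..} g" for g :: "real \<Rightarrow> real"
    by (rule continuous_on_compose2[OF that]) (auto intro!: continuous_intros)
  have ch': "continuous_on {0..} h'"
    using h' by (intro DERIV_continuous_on[of _ h' h'']) (auto intro: has_field_derivative_at_within)
  have green: "(\<integral>x. ?f x * laplacian \<phi> x \<partial>lborel) = (\<integral>x. laplacian ?f x * \<phi> x \<partial>lborel)"
  proof (rule green_test_function[OF _ _ _ \<phi>])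
    show "?f differentiable (at x)" for x using d1 by (auto simp: differentiable_def)
    show "partial b ?f differentiable (at x)" for b x
      unfolding p1 using d2 by (auto simp: differentiable_def)
    show "continuous_on UNIV (partial b (partial b ?f))" if "b \<in> Basis" for b
      unfolding p2[OF that] by (intro continuous_intros cont h'' ch')
  qed
  have "laplacian ?f x = 4 * ?s x * h'' (?s x) + 2 * real DIM('a) * h' (?s x)" for x
  proof -
    have "laplacian ?f x = (\<Sum>b\<in>(Basis::'a set). h' (?s x) * 2 + h'' (?s x) * 4 * ((x - y) \<bullet> b)\<^sup>2)"
      unfolding laplacian_def using p2 by (intro sum.cong) auto
    also have "\<dots> = 2 * real DIM('a) * h' (?s x) + h'' (?s x) * 4 * (\<Sum>b\<in>(Basis::'a set). ((x - y) \<bullet> b)\<^sup>2)"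
      by (simp add: sum.distrib sum_distrib_left)
    also have "(\<Sum>b\<in>(Basis::'a set). ((x - y) \<bullet> b)\<^sup>2) = ?s x"
      unfolding power2_norm_eq_inner by (subst euclidean_inner) (simp add: power2_eq_square)
    finally show ?thesis by simp
  qed
  then show ?thesis using green by (simp del: minus_add_distrib)
qed

text \<open>Coefficients of the powers of \<open>1 / (s + e)\<close> in the iterated Laplacian of
  the logarithm. The product runs over \<open>k = i + 1, ..., j\<close>, so that
  \<open>j = n\<close> brings in the factor \<open>n - n\<close> unless
  \<open>i = n\<close>.\<close>

definition rad_coeff :: "nat \<Rightarrow> nat \<Rightarrow> nat \<Rightarrow> real" where
  "rad_coeff n j i = real (j choose i) * (\<Prod>k\<in>{i<..j}. real n - real k)"

lemma rad_coeff_Suc_0: "rad_coeff n (Suc j) 0 = (real n - 1 - real j) * rad_coeff n j 0"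
proof -
  have "{0<..Suc j} = insert (Suc j) {0<..j}" by auto
  then show ?thesis by (simp add: rad_coeff_def)
qed

text \<open>Pascal's rule on the left; after division by the common product the identity reduces to
  the absorption law \<open>(i + 1) (j choose (i + 1)) = (j - i) (j choose i)\<close>.\<close>

lemma rad_coeff_Suc_Suc:
  assumes "i \<le> j"
  shows "rad_coeff n (Suc j) (Suc i) =
    (real n - 1 - real j - real (Suc i)) * rad_coeff n j (Suc i) + rad_coeff n j i"
proof (cases "i = j")
  case True then show ?thesis by (simp add: rad_coeff_def)
next
  case False
  then have ij: "i < j" using assms by simp
  define P where "P = (\<Prod>k\<in>{Suc i<..j}. real n - real k)"
  have "{Suc i<..Suc j} = insert (Suc j) {Suc i<..j}" using ij by auto
  then have 1: "(\<Prod>k\<in>{Suc i<..Suc j}. real n - real k) = (real n - 1 - real j) * P" by (simp add: P_def)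
  have "{i<..j} = insert (Suc i) {Suc i<..j}" using ij by auto
  then have 2: "(\<Prod>k\<in>{i<..j}. real n - real k) = (real n - real (Suc i)) * P" by (simp add: P_def)
  have "Suc i * (j choose Suc i) = (j - i) * (j choose i)"
    using ij binomial_absorption[of i j] binomial_absorb_comp[of j i] by simp
  then have "real (Suc i * (j choose Suc i)) = real ((j - i) * (j choose i))" by (rule arg_cong)
  then have 3: "real (Suc i) * real (j choose Suc i) = (real j - real i) * real (j choose i)"
    using ij by (simp only: of_nat_mult of_nat_diff less_imp_le)
  define A where "A = real (j choose i)"
  define B where "B = real (j choose Suc i)"
  have "(A + B) * (real n - 1 - real j) =
      (real n - 1 - real j - real (Suc i)) * B + A * (real n - real (Suc i))"
    using 3 unfolding A_def[symmetric] B_def[symmetric] by (simp add: algebra_simps)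
  then have "(A + B) * ((real n - 1 - real j) * P) =
      (real n - 1 - real j - real (Suc i)) * (B * P) + A * ((real n - real (Suc i)) * P)"
    by (metis (no_types, opaque_lifting) distrib_right mult.assoc)
  then show ?thesis
    unfolding rad_coeff_def 1 2 P_def[symmetric] by (simp add: A_def B_def)
qed

text \<open>This is where the dimension \<open>2 n\<close> matters: for \<open>i < n\<close> the
  product contains the factor 0, and only the top power survives.\<close>

lemma rad_coeff_diag: "rad_coeff n n i = (if i = n then 1 else 0)"
proof -
  consider "i < n" | "i = n" | "n < i" by linarith
  then show ?thesis
    by cases (auto simp: rad_coeff_def binomial_eq_0)
qed

text \<open>In dimension \<open>2 n\<close>, \<open>rad_log n e j\<close> is, as a function of \<open>s = |x|\<^sup>2\<close>, the function
  \<open>(- laplacian)\<^sup>j ln (|x|\<^sup>2 + e)\<close>. All terms but one vanish for \<open>j = n\<close>.\<close>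

definition rad_log :: "nat \<Rightarrow> real \<Rightarrow> nat \<Rightarrow> real \<Rightarrow> real" where
  "rad_log n e j s = (if j = 0 then ln (s + e)
     else - (4 ^ j) * (\<Sum>i\<le>j. (fact (j + i - 1) * rad_coeff n j i * e ^ i) * (1 / (s + e) ^ (j + i))))"

lemma DERIV_inverse_power:
  assumes "s + e \<noteq> (0 :: real)"
  shows "((\<lambda>s. c * (1 / (s + e) ^ m)) has_real_derivative c * (- real m / (s + e) ^ Suc m)) (at s)"
proof -
  have "((\<lambda>s. c * inverse (s + e) ^ m) has_real_derivative
      c * (real m * (inverse (s + e) ^ (m - Suc 0) * - (inverse (s + e) ^ Suc (Suc 0))))) (at s)"
    using assms by (auto intro!: derivative_eq_intros)
  moreover have "c * (real m * (inverse (s + e) ^ (m - Suc 0) * - (inverse (s + e) ^ Suc (Suc 0)))) =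
      c * (- real m / (s + e) ^ Suc m)"
  proof -
    define i where "i = inverse (s + e)"
    have i: "z / (s + e) ^ k = z * i ^ k" for z k by (simp add: i_def divide_inverse power_inverse)
    show ?thesis unfolding i i_def[symmetric] by (cases m) (simp_all add: algebra_simps)
  qed
  moreover have "(\<lambda>s. c * (1 / (s + e) ^ m)) = (\<lambda>s. c * inverse (s + e) ^ m)"
    by (simp add: divide_inverse power_inverse)
  ultimately show ?thesis by (simp only:)
qed

text \<open>Writing \<open>s = (s + e) - e\<close> in \<open>4 s h'' + 4 n h'\<close> turns each
  power of \<open>1 / (s + e)\<close> into a combination of the next two powers; collecting equal
  powers gives the recursion of \<open>rad_coeff\<close>. The case \<open>j = 0\<close> stands apart
  because \<open>rad_log\<close> is then the logarithm itself.\<close>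

lemma green_rad_log:
  fixes y :: "'a::euclidean_space"
  assumes d: "DIM('a) = 2 * n" and e: "0 < e" and \<phi>: "test_function \<phi>"
  shows "(\<integral>x. rad_log n e j ((norm (x - y))\<^sup>2) * - laplacian \<phi> x \<partial>lborel) =
    (\<integral>x. rad_log n e (Suc j) ((norm (x - y))\<^sup>2) * \<phi> x \<partial>lborel)"
proof (cases j)
  case 0
  have ne: "s + e \<noteq> 0" if "0 \<le> s" for s using that e by simp
  have "- (4 * s * (- 1 / (s + e) ^ 2) + 2 * real DIM('a) * (1 / (s + e) ^ 1)) = rad_log n e (Suc j) s"
    if "0 \<le> s" for s
  proof -
    have r: "rad_coeff n 1 0 = real n - 1" "rad_coeff n 1 1 = 1"
      using rad_coeff_Suc_0[of n 0] by (simp_all add: rad_coeff_def)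
    have "rad_log n e (Suc j) s = - 4 * ((real n - 1) * (1 / (s + e)) + e * (1 / (s + e) ^ 2))"
      using r 0 by (simp add: rad_log_def numeral_2_eq_2)
    moreover have "s * (1 / (s + e) ^ 2) = 1 / (s + e) - e * (1 / (s + e) ^ 2)"
    proof -
      define w where "w = s + e"
      have "s = w - e" "w \<noteq> 0" using ne[OF that] by (simp_all add: w_def)
      then show ?thesis by (simp add: power2_eq_square diff_divide_distrib)
    qed
    moreover have "- (4 * s * (- 1 / (s + e) ^ 2) + 2 * real DIM('a) * (1 / (s + e) ^ 1)) =
        4 * (s * (1 / (s + e) ^ 2)) - 4 * real n * (1 / (s + e))" by (simp add: d)
    moreover have "4 * (X - E) - 4 * real n * X = - 4 * ((real n - 1) * X + E)" for X E :: real
      by (simp add: algebra_simps)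
    ultimately show ?thesis by (simp only:)
  qed
  note eq = this[OF zero_le_power2]
  show ?thesis
    unfolding eq[symmetric]
  proof (rule green_radial[where h' = "\<lambda>s. 1 / (s + e) ^ 1" and h'' = "\<lambda>s. - 1 / (s + e) ^ 2", OF _ _ _ \<phi>])
    show "(rad_log n e j has_real_derivative 1 / (s + e) ^ 1) (at s)" if "0 \<le> s" for s
      unfolding rad_log_def using that e 0 by (auto intro!: derivative_eq_intros)
    show "((\<lambda>s. 1 / (s + e) ^ 1) has_real_derivative - 1 / (s + e) ^ 2) (at s)" if "0 \<le> s" for s
      using DERIV_inverse_power[OF ne[OF that], of 1 1] by (simp add: power2_eq_square)
    show "continuous_on {0..} (\<lambda>s. - 1 / (s + e) ^ 2)"
      using e by (intro continuous_intros) (auto simp: add_nonneg_pos)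
  qed
next
  case (Suc k)
  then have j: "0 < j" by simp
  define c where "c i = - (4 ^ j) * (fact (j + i - 1) * rad_coeff n j i * e ^ i)" for i
  have ne: "s + e \<noteq> 0" if "0 \<le> s" for s using that e by simp
  let ?h = "\<lambda>s. \<Sum>i\<le>j. c i * (1 / (s + e) ^ (j + i))"
  let ?h' = "\<lambda>s. \<Sum>i\<le>j. c i * (- real (j + i) / (s + e) ^ Suc (j + i))"
  let ?h'' = "\<lambda>s. \<Sum>i\<le>j. c i * (real (j + i) * real (Suc (j + i)) / (s + e) ^ Suc (Suc (j + i)))"
  have L: "rad_log n e j = ?h"
    using j by (auto simp: rad_log_def fun_eq_iff c_def sum_distrib_left mult.assoc)
  have eq: "- (4 * s * ?h'' s + 2 * real DIM('a) * ?h' s) = rad_log n e (Suc j) s" if s: "0 \<le> s" for s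
  proof -
    define W where "W i = 1 / (s + e) ^ (Suc j + i)" for i
    have t: "- (4 * s * (c i * (real (j + i) * real (Suc (j + i)) / (s + e) ^ Suc (Suc (j + i))))
        + 2 * real DIM('a) * (c i * (- real (j + i) / (s + e) ^ Suc (j + i)))) =
      - (4 ^ Suc j) * (fact (j + i) * ((real n - 1 - real j - real i) * rad_coeff n j i) * e ^ i * W i
        + fact (j + Suc i) * rad_coeff n j i * e ^ Suc i * W (Suc i))" for i
    proof -
      define X where "X = 1 / (s + e) ^ Suc (j + i)"
      define Y where "Y = X / (s + e)"
      define m where "m = real (j + i)"
      have s2: "s * Y = X - e * Y"
        using ne[OF s] by (simp add: Y_def field_simps)
      have f: "fact (j + i) = m * (fact (j + i - 1) :: real)"
        using j by (simp add: m_def fact_reduce)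
      have W: "W i = X" "W (Suc i) = Y" by (simp_all add: W_def X_def Y_def)
      have "- (4 * s * (c i * (m * (m + 1) * Y)) + 2 * (2 * real n) * (c i * (- m * X)))
        = - (4 * c i * m * (m + 1) * (s * Y)) + 4 * real n * c i * m * X"
        by (simp add: algebra_simps)
      also have "\<dots> = 4 * c i * m * ((real n - 1 - m) * X + e * (m + 1) * Y)"
        unfolding s2 by (simp add: algebra_simps)
      also have "\<dots> = - (4 ^ Suc j) * (fact (j + i) * ((real n - 1 - m) * rad_coeff n j i) * e ^ i * X
        + (m + 1) * fact (j + i) * rad_coeff n j i * e ^ Suc i * Y)"
        unfolding c_def f by (simp add: algebra_simps)
      finally have main: "- (4 * s * (c i * (m * (m + 1) * Y)) + 2 * (2 * real n) * (c i * (- m * X))) =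
        - (4 ^ Suc j) * (fact (j + i) * ((real n - 1 - m) * rad_coeff n j i) * e ^ i * X
        + (m + 1) * fact (j + i) * rad_coeff n j i * e ^ Suc i * Y)" .
      have div: "A / (s + e) ^ Suc (j + i) = A * X" "A / (s + e) ^ Suc (Suc (j + i)) = A * Y" for A
        by (simp_all add: X_def Y_def)
      have m: "real (Suc (j + i)) = m + 1" "real n - 1 - real j - real i = real n - 1 - m"
        "fact (j + Suc i) = (m + 1) * (fact (j + i) :: real)" "real DIM('a) = 2 * real n"
        by (simp_all add: m_def d algebra_simps)
      show ?thesis
        unfolding div m W m_def[symmetric] by (rule main)
    qed
    have "- (4 * s * ?h'' s + 2 * real DIM('a) * ?h' s) =
      (\<Sum>i\<le>j. - (4 * s * (c i * (real (j + i) * real (Suc (j + i)) / (s + e) ^ Suc (Suc (j + i))))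
        + 2 * real DIM('a) * (c i * (- real (j + i) / (s + e) ^ Suc (j + i)))))"
      by (simp only: sum_distrib_left sum.distrib sum_negf)
    also have "\<dots> = - (4 ^ Suc j) *
      ((\<Sum>i\<le>j. fact (j + i) * ((real n - 1 - real j - real i) * rad_coeff n j i) * e ^ i * W i)
        + (\<Sum>i\<le>j. fact (j + Suc i) * rad_coeff n j i * e ^ Suc i * W (Suc i)))"
      by (simp only: t sum_distrib_left[symmetric] sum.distrib)
    \<comment> \<open>The added term \<open>i = Suc j\<close> vanishes because
      \<open>j choose Suc j = 0\<close>. With it, splitting off \<open>i = 0\<close> and shifting
      aligns this sum with the second one.\<close>
    also have "(\<Sum>i\<le>j. fact (j + i) * ((real n - 1 - real j - real i) * rad_coeff n j i) * e ^ i * W i) =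
      (\<Sum>i\<le>Suc j. fact (j + i) * ((real n - 1 - real j - real i) * rad_coeff n j i) * e ^ i * W i)"
      by (simp add: rad_coeff_def)
    also have "\<dots> = fact j * rad_coeff n (Suc j) 0 * W 0 +
      (\<Sum>i\<le>j. fact (j + Suc i) * ((real n - 1 - real j - real (Suc i)) * rad_coeff n j (Suc i)) * e ^ Suc i * W (Suc i))"
      by (subst sum.atMost_Suc_shift) (simp add: rad_coeff_Suc_0)
    also have "\<dots> + (\<Sum>i\<le>j. fact (j + Suc i) * rad_coeff n j i * e ^ Suc i * W (Suc i)) =
      fact j * rad_coeff n (Suc j) 0 * W 0 +
      (\<Sum>i\<le>j. fact (j + Suc i) * rad_coeff n (Suc j) (Suc i) * e ^ Suc i * W (Suc i))"
      unfolding add.assoc sum.distrib[symmetric]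
      by (intro arg_cong2[of _ _ _ _ "(+)"] refl sum.cong)
         (simp only: rad_coeff_Suc_Suc atMost_iff, simp only: distrib_left distrib_right)
    also have "\<dots> = (\<Sum>i\<le>Suc j. fact (j + i) * rad_coeff n (Suc j) i * e ^ i * W i)"
      by (subst sum.atMost_Suc_shift) simp
    finally show ?thesis unfolding rad_log_def W_def by simp
  qed
  note eq' = eq[OF zero_le_power2]
  show ?thesis
    unfolding eq'[symmetric] unfolding L
  proof (rule green_radial[where h = ?h and h' = ?h' and h'' = ?h'', OF _ _ _ \<phi>])
    show "(?h has_real_derivative ?h' s) (at s)" if "0 \<le> s" for s
      by (intro DERIV_sum DERIV_inverse_power ne that)
    show "(?h' has_real_derivative ?h'' s) (at s)" if "0 \<le> s" for s
    proof (rule DERIV_sum)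
      fix i
      have f: "(\<lambda>s. c i * (- real (j + i) / (s + e) ^ Suc (j + i))) =
          (\<lambda>s. (c i * - real (j + i)) * (1 / (s + e) ^ Suc (j + i)))"
        by (simp del: power_Suc of_nat_add)
      have v: "c i * (real (j + i) * real (Suc (j + i)) / Z) = (c i * - real (j + i)) * (- real (Suc (j + i)) / Z)"
        for Z by (simp del: of_nat_add of_nat_Suc)
      show "((\<lambda>s. c i * (- real (j + i) / (s + e) ^ Suc (j + i))) has_real_derivative
        c i * (real (j + i) * real (Suc (j + i)) / (s + e) ^ Suc (Suc (j + i)))) (at s)"
        unfolding f v by (rule DERIV_inverse_power[OF ne[OF that]])
    qed
    show "continuous_on {0..} ?h''"
      using e by (intro continuous_intros) (auto simp: add_nonneg_pos)
  qed
qed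

lemma rad_log_top:
  assumes "0 < n"
  shows "rad_log n e n s = - (4 ^ n * fact (2 * n - 1)) * (e ^ n / (s + e) ^ (2 * n))"
proof -
  have "rad_log n e n s = - (4 ^ n) *
    (\<Sum>i\<le>n. if i = n then fact (2 * n - 1) * e ^ n * (1 / (s + e) ^ (2 * n)) else 0)"
    unfolding rad_log_def using assms
    by (subst if_not_P, simp, intro arg_cong2[of _ _ _ _ times] sum.cong refl)
       (auto simp: rad_coeff_diag mult_2)
  then show ?thesis by simp
qed

text \<open>The Laplacians pass from the test function to the logarithm one at a time. The kernel
  that remains is an approximate identity: it is a fixed integrable function dilated by
  \<open>sqrt e\<close>, and the factor \<open>e ^ n\<close> preserves its mass exactly in dimension
  \<open>2 n\<close>.\<close>

lemma log_regularized_distr: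
  fixes y :: "'a::euclidean_space"
  assumes d: "DIM('a) = 2 * n" and e: "0 < e" and \<phi>: "test_function \<phi>"
  shows "(\<integral>x. ln ((norm (x - y))\<^sup>2 + e) * neg_laplacian_power n \<phi> x \<partial>lborel) =
    - (4 ^ n * fact (2 * n - 1)) * (\<integral>x. e ^ n / ((norm (x - y))\<^sup>2 + e) ^ (2 * n) * \<phi> x \<partial>lborel)"
proof -
  have "k \<le> n \<Longrightarrow> (\<integral>x. rad_log n e 0 ((norm (x - y))\<^sup>2) * neg_laplacian_power n \<phi> x \<partial>lborel) =
    (\<integral>x. rad_log n e k ((norm (x - y))\<^sup>2) * neg_laplacian_power (n - k) \<phi> x \<partial>lborel)" for k
  proof (induction k)
    case (Suc k)
    then have "n - k = Suc (n - Suc k)" by simp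
    then show ?case
      using Suc green_rad_log[OF d e test_function_neg_laplacian_power[OF \<phi>, of "n - Suc k"], of k y]
      by (simp add: neg_laplacian_power_Suc)
  qed simp
  from this[of n] have "(\<integral>x. ln ((norm (x - y))\<^sup>2 + e) * neg_laplacian_power n \<phi> x \<partial>lborel) =
    (\<integral>x. rad_log n e n ((norm (x - y))\<^sup>2) * \<phi> x \<partial>lborel)"
    by (simp add: rad_log_def neg_laplacian_power_def)
  moreover have "0 < n" using d DIM_positive[where 'a = 'a] by simp
  ultimately show ?thesis 
    by (simp only: rad_log_top mult.assoc integral_mult_right_zero)
qed

section \<open>From the regularized logarithm to the logarithm\<close>

lemma nn_integral_inverse_square_finite: "(\<integral>\<^sup>+t. ennreal (1 / (1 + t\<^sup>2)) \<partial>lborel) < \<infinity>"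
proof -
  let ?f = "\<lambda>t::real. 1 / (1 + t\<^sup>2)"
  have half: "(\<integral>\<^sup>+t. ennreal (?f t) * indicator {0..} t \<partial>lborel) = ennreal (pi / 2 - arctan 0)"
  proof (rule nn_integral_FTC_atLeast)
    show "DERIV arctan t :> ?f t" for t using DERIV_arctan[of t] by (simp add: inverse_eq_divide)
    show "(arctan \<longlongrightarrow> pi / 2) at_top" by (rule tendsto_arctan_at_top)
  qed auto
  have "(\<integral>\<^sup>+t. ennreal (?f t) \<partial>lborel) \<le>
    (\<integral>\<^sup>+t. ennreal (?f t) * indicator {0..} t + ennreal (?f (0 + (-1) *\<^sub>R t)) * indicator {0..} (0 + (-1) *\<^sub>R t) \<partial>lborel)"
    by (intro nn_integral_mono) (auto simp: indicator_def)
  also have "\<dots> = (\<integral>\<^sup>+t. ennreal (?f t) * indicator {0..} t \<partial>lborel) +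
    (\<integral>\<^sup>+t. ennreal (?f (0 + (-1) *\<^sub>R t)) * indicator {0..} (0 + (-1) *\<^sub>R t) \<partial>lborel)"
    by (rule nn_integral_add) auto
  also have "(\<integral>\<^sup>+t. ennreal (?f (0 + (-1) *\<^sub>R t)) * indicator {0..} (0 + (-1) *\<^sub>R t) \<partial>lborel) =
    (\<integral>\<^sup>+t. ennreal (?f t) * indicator {0..} t \<partial>lborel)"
    using lborel_nn_integral_affine[of "\<lambda>t. ennreal (?f t) * indicator {0..} t" "-1" 0] by simp
  also have "\<dots> + \<dots> < \<infinity>" unfolding half by (simp add: ennreal_plus[symmetric] del: ennreal_plus)
  finally show ?thesis .
qed

text \<open>Each factor \<open>|z|^2 + 1\<close> dominates one \<open>1 + (z \<bullet> b)^2\<close>,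
  so the function is at most a product of one-dimensional arctangent derivatives. The exponent is
  the one of the regularized kernel in dimension \<open>2 n\<close>.\<close>

lemma inverse_power_integrable:
  "integrable lborel (\<lambda>z::'a::euclidean_space. 1 / ((norm z)\<^sup>2 + 1) ^ DIM('a))"
proof (rule integrableI_nonneg)
  have "(\<integral>\<^sup>+z. ennreal (1 / ((norm z)\<^sup>2 + 1) ^ DIM('a)) \<partial>(lborel :: 'a measure)) \<le>
    (\<integral>\<^sup>+z. (\<Prod>b\<in>Basis. ennreal (1 / (1 + (z \<bullet> b)\<^sup>2))) \<partial>(lborel :: 'a measure))"
  proof (rule nn_integral_mono)
    fix z :: 'a
    have "(\<Prod>b\<in>(Basis::'a set). 1 + (z \<bullet> b)\<^sup>2) \<le> (\<Prod>b\<in>(Basis::'a set). (norm z)\<^sup>2 + 1)"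
      using Basis_le_norm[of _ z] by (intro prod_mono) (auto simp: abs_le_square_iff[symmetric])
    then have "1 / ((norm z)\<^sup>2 + 1) ^ DIM('a) \<le> 1 / (\<Prod>b\<in>(Basis::'a set). 1 + (z \<bullet> b)\<^sup>2)"
    proof (intro divide_left_mono)
      have "0 < (\<Prod>b\<in>(Basis::'a set). 1 + (z \<bullet> b)\<^sup>2)"
        by (intro prod_pos) (auto intro: add_pos_nonneg)
      then show "0 < ((norm z)\<^sup>2 + 1) ^ DIM('a) * (\<Prod>b\<in>(Basis::'a set). 1 + (z \<bullet> b)\<^sup>2)"
        by (intro mult_pos_pos zero_less_power add_nonneg_pos) auto
    qed auto
    also have "\<dots> = (\<Prod>b\<in>(Basis::'a set). 1 / (1 + (z \<bullet> b)\<^sup>2))" by (simp add: prod_dividef)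
    finally show "ennreal (1 / ((norm z)\<^sup>2 + 1) ^ DIM('a)) \<le> (\<Prod>b\<in>Basis. ennreal (1 / (1 + (z \<bullet> b)\<^sup>2)))"
      by (subst prod_ennreal) (auto intro: ennreal_leI)
  qed
  also have "\<dots> = (\<Prod>b\<in>(Basis::'a set). \<integral>\<^sup>+t. ennreal (1 / (1 + t\<^sup>2)) \<partial>lborel)"
    by (rule nn_integral_lborel_prod) auto
  also have "\<dots> < \<infinity>" using nn_integral_inverse_square_finite by (simp add: power_less_top_ennreal)
  finally show "(\<integral>\<^sup>+z. ennreal (1 / ((norm z)\<^sup>2 + 1) ^ DIM('a)) \<partial>(lborel :: 'a measure)) < \<infinity>" .
qed auto

lemma lborel_integral_pos:
  fixes f :: "'a::euclidean_space \<Rightarrow> real"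
  assumes f: "integrable lborel f" "\<And>x. 0 < f x"
  shows "0 < (\<integral>x. f x \<partial>lborel)"
proof -
  have "(\<integral>x. f x \<partial>lborel) \<noteq> 0"
  proof
    assume "(\<integral>x. f x \<partial>lborel) = 0"
    then have "AE x in lborel. f x = 0"
      using f by (subst (asm) integral_nonneg_eq_0_iff_AE) (auto simp: less_imp_le)
    then have "AE x in (lborel :: 'a measure). False" by (rule AE_mp) (auto simp: f(2)[THEN less_imp_neq, symmetric])
    then show False by (auto simp: AE_iff_measurable[OF _ refl] dest!: AE_E)
  qed
  moreover have "0 \<le> (\<integral>x. f x \<partial>lborel)" using f by (intro integral_nonneg_AE) (auto simp: less_imp_le)
  ultimately show ?thesis by simp
qed

text \<open>Passing to the limit in the regularized identity: after the substitution
  \<open>x = y + sqrt e z\<close> the right-hand side is an average of \<open>\<phi>\<close> around \<open>y\<close>.\<close>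

theorem log_fundamental_solution:
  assumes d: "DIM('a::euclidean_space) = 2 * n"
  obtains \<gamma> :: real where "0 < \<gamma>"
    "\<And>\<phi> (y::'a). test_function \<phi> \<Longrightarrow>
      (\<integral>x. ln (norm (x - y)) * neg_laplacian_power n \<phi> x \<partial>lborel) = - \<gamma> * \<phi> y"
proof -
  let ?w = "\<lambda>z::'a. 1 / ((norm z)\<^sup>2 + 1) ^ (2 * n)"
  have iw: "integrable lborel ?w" using inverse_power_integrable[where 'a = 'a] by (simp add: d)
  have wpos: "0 < ?w z" for z by (auto intro!: zero_less_power add_nonneg_pos)
  define J where "J = (\<integral>z. ?w z \<partial>lborel)"
  have J: "0 < J" unfolding J_def by (rule lborel_integral_pos[OF iw wpos])
  define c where "c = (4 ^ n * fact (2 * n - 1) :: real)"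
  \<comment> \<open>\<open>J\<close> is the mass of the approximate identity and \<open>c\<close>
    the constant of the regularized identity; the division by 2 comes from
    \<open>ln (|x - y|^2) = 2 ln |x - y|\<close>.\<close>
  have "(\<integral>x. ln (norm (x - y)) * neg_laplacian_power n \<phi> x \<partial>lborel) = - (c * J / 2) * \<phi> y"
    if \<phi>: "test_function \<phi>" for \<phi> and y :: 'a
  proof -
    let ?\<psi> = "neg_laplacian_power n \<phi>"
    define e where "e k = inverse (real (Suc k))" for k
    have e: "0 < e k" "e k \<le> 1" for k by (auto simp: e_def inverse_le_1_iff)
    have e0: "e \<longlonglongrightarrow> 0" unfolding e_def[abs_def] by (rule LIMSEQ_inverse_real_of_nat)
    have \<psi>t: "test_function ?\<psi>" by (rule test_function_neg_laplacian_power[OF \<phi>])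
    then obtain R where R: "\<And>x. R < norm x \<Longrightarrow> ?\<psi> x = 0" by (auto simp: test_function_iff)
    have c\<psi>: "continuous_on UNIV ?\<psi>" by (rule test_function_continuous[OF \<psi>t])
    have [measurable]: "?\<psi> \<in> borel_measurable borel" by (rule borel_measurable_continuous_onI[OF c\<psi>])
    obtain C where C: "0 < C" "\<And>x. \<bar>?\<psi> x\<bar> \<le> C"
      using continuous_compact_support_bounded[OF c\<psi> R] by blast
    obtain D where "\<And>y. integrable lborel (\<lambda>x. ln (norm (x - y)) * ?\<psi> x)"
      using log_norm_diff_local_integrable[of ?\<psi> C R] C R by auto
    note int_log = this
    have "(\<lambda>k. \<integral>x. ln ((norm (x - y))\<^sup>2 + e k) * ?\<psi> x \<partial>lborel) \<longlonglongrightarrow>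
      (\<integral>x. 2 * (ln (norm (x - y)) * ?\<psi> x) \<partial>lborel)"
    proof (rule integral_dominated_convergence)
      \<comment> \<open>Since \<open>0 < e k \<le> 1\<close>, the regularized logarithm lies between
        \<open>ln (|x - y|^2)\<close> and \<open>ln (1 + |x - y|^2)\<close>; the bound adds the
        absolute values of both.\<close>
      let ?dom = "\<lambda>x. 2 * \<bar>ln (norm (x - y)) * ?\<psi> x\<bar> + ln (1 + (norm (x - y))\<^sup>2) * \<bar>?\<psi> x\<bar>"
      have "integrable lborel (\<lambda>x. ln (1 + (norm (x - y))\<^sup>2) * \<bar>?\<psi> x\<bar>)"
        using R by (intro continuous_compact_support_integrable[where R = R] continuous_intros c\<psi>)
           (auto simp: add_pos_nonneg intro!: less_imp_neq[symmetric])
      then show "integrable lborel ?dom" using integrable_abs[OF int_log[of y]] by auto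
      have ne: "AE x in lborel. x \<noteq> y" by (rule AE_lborel_singleton)
      have sq: "2 * ln (norm (x - y)) = ln ((norm (x - y))\<^sup>2)" if "x \<noteq> y" for x
        using that by (simp add: ln_realpow)
      show "AE x in lborel. (\<lambda>k. ln ((norm (x - y))\<^sup>2 + e k) * ?\<psi> x) \<longlonglongrightarrow> 2 * (ln (norm (x - y)) * ?\<psi> x)"
        using ne
      proof eventually_elim
        fix x assume x: "x \<noteq> y"
        have "(\<lambda>k. ln ((norm (x - y))\<^sup>2 + e k) * ?\<psi> x) \<longlonglongrightarrow> ln ((norm (x - y))\<^sup>2 + 0) * ?\<psi> x"
          using x by (intro tendsto_intros e0) auto
        then show "(\<lambda>k. ln ((norm (x - y))\<^sup>2 + e k) * ?\<psi> x) \<longlonglongrightarrow> 2 * (ln (norm (x - y)) * ?\<psi> x)"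
          by (simp add: mult.assoc[symmetric] sq[OF x])
      qed
      show "AE x in lborel. norm (ln ((norm (x - y))\<^sup>2 + e k) * ?\<psi> x) \<le> ?dom x" for k
        using ne
      proof eventually_elim
        fix x assume x: "x \<noteq> y"
        have p: "0 < (norm (x - y))\<^sup>2" using x by simp
        have "ln ((norm (x - y))\<^sup>2) \<le> ln ((norm (x - y))\<^sup>2 + e k)"
          using p e(1)[of k] by (intro ln_mono) auto
        moreover have "ln ((norm (x - y))\<^sup>2 + e k) \<le> ln (1 + (norm (x - y))\<^sup>2)"
          using p e[of k] by (intro ln_mono add_pos_pos) auto
        moreover have "0 \<le> ln (1 + (norm (x - y))\<^sup>2)" by simp
        ultimately have "\<bar>ln ((norm (x - y))\<^sup>2 + e k)\<bar> \<le> 2 * \<bar>ln (norm (x - y))\<bar> + ln (1 + (norm (x - y))\<^sup>2)"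
          unfolding sq[OF x, symmetric] by linarith
        then have "\<bar>ln ((norm (x - y))\<^sup>2 + e k)\<bar> * \<bar>?\<psi> x\<bar> \<le>
          (2 * \<bar>ln (norm (x - y))\<bar> + ln (1 + (norm (x - y))\<^sup>2)) * \<bar>?\<psi> x\<bar>"
          by (intro mult_right_mono) auto
        then show "norm (ln ((norm (x - y))\<^sup>2 + e k) * ?\<psi> x) \<le> ?dom x"
          by (simp add: abs_mult distrib_right)
      qed
    qed measurable
    moreover have "(\<integral>x. ln ((norm (x - y))\<^sup>2 + e k) * ?\<psi> x \<partial>lborel) =
      - c * (\<integral>z. ?w z * \<phi> (y + sqrt (e k) *\<^sub>R z) \<partial>lborel)" for k
    proof -
      have [measurable]: "\<phi> \<in> borel_measurable borel"
        by (rule borel_measurable_continuous_onI[OF test_function_continuous[OF \<phi>]])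
      let ?F = "\<lambda>x. e k ^ n / ((norm (x - y))\<^sup>2 + e k) ^ (2 * n) * \<phi> x"
      have "(\<integral>x. ?F x \<partial>lborel) = \<bar>sqrt (e k)\<bar> ^ DIM('a) * (\<integral>z. ?F (y + sqrt (e k) *\<^sub>R z) \<partial>lborel)"
        using e(1)[of k] by (intro lborel_integral_affine) auto
      also have "\<dots> = (\<integral>z. ?w z * \<phi> (y + sqrt (e k) *\<^sub>R z) \<partial>lborel)"
      proof -
        have "\<bar>sqrt (e k)\<bar> ^ DIM('a) * ?F (y + sqrt (e k) *\<^sub>R z) = ?w z * \<phi> (y + sqrt (e k) *\<^sub>R z)" for z
        proof -
          have s: "sqrt (e k) ^ DIM('a) = e k ^ n"
            using e(1)[of k] by (simp add: d power_mult)
          have "(norm (y + sqrt (e k) *\<^sub>R z - y))\<^sup>2 + e k = e k * ((norm z)\<^sup>2 + 1)"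
            using e(1)[of k] by (simp add: power_mult_distrib algebra_simps)
          then have "?F (y + sqrt (e k) *\<^sub>R z) =
            e k ^ n / (e k ^ (2 * n) * ((norm z)\<^sup>2 + 1) ^ (2 * n)) * \<phi> (y + sqrt (e k) *\<^sub>R z)"
            by (simp only: power_mult_distrib)
          moreover have "e k ^ (2 * n) = e k ^ n * e k ^ n" by (simp add: mult_2 power_add)
          ultimately show ?thesis using e(1)[of k] by (simp add: s)
        qed
        then show ?thesis by (simp only: integral_mult_right_zero[symmetric])
      qed
      finally show ?thesis
        unfolding log_regularized_distr[OF d e(1) \<phi>] c_def by simp
    qed
    ultimately have l1: "(\<lambda>k. - c * (\<integral>z. ?w z * \<phi> (y + sqrt (e k) *\<^sub>R z) \<partial>lborel)) \<longlonglongrightarrow>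
      2 * (\<integral>x. ln (norm (x - y)) * ?\<psi> x \<partial>lborel)" by simp
    have "(\<lambda>k. \<integral>z. ?w z * \<phi> (y + sqrt (e k) *\<^sub>R z) \<partial>lborel) \<longlonglongrightarrow> (\<integral>z. ?w z * \<phi> y \<partial>lborel)"
    proof -
      have c\<phi>: "continuous_on UNIV \<phi>" by (rule test_function_continuous[OF \<phi>])
      then have [measurable]: "\<phi> \<in> borel_measurable borel" by (rule borel_measurable_continuous_onI)
      obtain R where R: "\<And>x. R < norm x \<Longrightarrow> \<phi> x = 0" using \<phi> by (auto simp: test_function_iff)
      obtain C where C: "0 < C" "\<And>x. \<bar>\<phi> x\<bar> \<le> C"
        using continuous_compact_support_bounded[OF c\<phi> R] by blast
      show ?thesis
      proof (rule integral_dominated_convergence)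
        show "integrable lborel (\<lambda>z. C * ?w z)" using iw by (rule integrable_mult_right)
        show "AE z in lborel. (\<lambda>k. ?w z * \<phi> (y + sqrt (e k) *\<^sub>R z)) \<longlonglongrightarrow> ?w z * \<phi> y"
        proof (rule AE_I2)
          fix z
          have "(\<lambda>k. y + sqrt (e k) *\<^sub>R z) \<longlonglongrightarrow> y + sqrt 0 *\<^sub>R z" by (intro tendsto_intros e0)
          then have "(\<lambda>k. \<phi> (y + sqrt (e k) *\<^sub>R z)) \<longlonglongrightarrow> \<phi> y"
            using c\<phi> by (intro continuous_on_tendsto_compose[OF c\<phi>]) auto
          then show "(\<lambda>k. ?w z * \<phi> (y + sqrt (e k) *\<^sub>R z)) \<longlonglongrightarrow> ?w z * \<phi> y" by (intro tendsto_intros)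
        qed
        show "AE z in lborel. norm (?w z * \<phi> (y + sqrt (e k) *\<^sub>R z)) \<le> C * ?w z" for k
          using C(2) wpos by (intro AE_I2) (auto simp: abs_mult mult.commute[of C] intro!: mult_right_mono divide_right_mono)
      qed measurable
    qed
    then have "(\<lambda>k. - c * (\<integral>z. ?w z * \<phi> (y + sqrt (e k) *\<^sub>R z) \<partial>lborel)) \<longlonglongrightarrow> - c * (J * \<phi> y)"
      unfolding J_def integral_mult_left_zero by (intro tendsto_intros)
    from LIMSEQ_unique[OF l1 this] show ?thesis by simp
  qed
  moreover have "0 < c * J / 2" using J by (simp add: c_def)
  ultimately show thesis using that by blast
qed

section \<open>Positivity of the logarithmic energy\<close>

lemma has_bochner_integral_FTC_atLeast:
  fixes f :: "real \<Rightarrow> real"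
  assumes [measurable]: "f \<in> borel_measurable borel"
    and f: "\<And>x. a \<le> x \<Longrightarrow> DERIV F x :> f x" "\<And>x. a \<le> x \<Longrightarrow> 0 \<le> f x"
    and lim: "(F \<longlongrightarrow> T) at_top" and le: "F a \<le> T"
  shows "has_bochner_integral lborel (\<lambda>x. indicator {a..} x * f x) (T - F a)"
proof (rule has_bochner_integral_nn_integral)
  have "(\<integral>\<^sup>+x. ennreal (indicator {a..} x * f x) \<partial>lborel) = (\<integral>\<^sup>+x. ennreal (f x) * indicator {a..} x \<partial>lborel)"
    by (intro nn_integral_cong) (auto simp: indicator_def)
  also have "\<dots> = T - F a" by (rule nn_integral_FTC_atLeast[OF _ f lim]) auto
  finally show "(\<integral>\<^sup>+x. ennreal (indicator {a..} x * f x) \<partial>lborel) = ennreal (T - F a)" .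
qed (use f le in \<open>auto simp: indicator_def\<close>)

lemma exp_integral_inverse:
  fixes A :: real
  assumes A: "0 < A"
  shows "has_bochner_integral lborel (\<lambda>s. indicator {0..} s * exp (- (s * A))) (1 / A)"
proof -
  have "has_bochner_integral lborel (\<lambda>s. indicator {0..} s * exp (- (s * A))) (0 - (- exp (- (0 * A)) / A))"
  proof (rule has_bochner_integral_FTC_atLeast)
    show "DERIV (\<lambda>s. - exp (- (s * A)) / A) s :> exp (- (s * A))" for s
      using A by (auto intro!: derivative_eq_intros)
    have "((\<lambda>s. exp (- (s * A))) \<longlongrightarrow> 0) at_top"
      using A by (auto intro!: filterlim_compose[OF exp_at_bot] filterlim_compose[OF filterlim_uminus_at_bot_at_top]
          filterlim_at_top_mult_tendsto_pos[OF tendsto_const] filterlim_ident)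
    then have "((\<lambda>s. - exp (- (s * A)) / A) \<longlongrightarrow> - 0 / A) at_top"
      using A by (intro tendsto_intros) auto
    then show "((\<lambda>s. - exp (- (s * A)) / A) \<longlongrightarrow> 0) at_top" by simp
  qed (use A in auto)
  then show ?thesis by simp
qed

lemma log_ratio_tendsto:
  fixes a :: real
  assumes "0 < a"
  shows "((\<lambda>t. ln (a + t) - ln (1 + t)) \<longlongrightarrow> 0) at_top"
proof -
  have "((\<lambda>t. 1 + (a - 1) / (1 + t)) \<longlongrightarrow> 1 + 0) at_top"
    by (intro tendsto_intros tendsto_divide_0[OF tendsto_const] filterlim_at_top_imp_at_infinity
        filterlim_tendsto_add_at_top[OF tendsto_const] filterlim_ident)
  moreover have "eventually (\<lambda>t. 1 + (a - 1) / (1 + t) = (a + t) / (1 + t)) at_top"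
    using eventually_gt_at_top[of 0] by eventually_elim (simp add: field_simps)
  ultimately have "((\<lambda>t. (a + t) / (1 + t)) \<longlongrightarrow> 1) at_top"
    by (simp add: filterlim_cong)
  then have "((\<lambda>t. ln ((a + t) / (1 + t))) \<longlongrightarrow> ln 1) at_top" by (intro tendsto_intros) auto
  moreover have "eventually (\<lambda>t. ln ((a + t) / (1 + t)) = ln (a + t) - ln (1 + t)) at_top"
    using eventually_gt_at_top[of 0] by eventually_elim (use assms in \<open>simp add: ln_div\<close>)
  ultimately show ?thesis by (simp add: filterlim_cong)
qed

text \<open>The integrand has constant sign, so that its absolute value integrates to \<open>|ln a|\<close>.\<close>

lemma log_as_integral:
  fixes a :: real
  assumes a: "0 < a"
  shows "has_bochner_integral lborel (\<lambda>t. indicator {0..} t * (1 / (a + t) - 1 / (1 + t))) (- ln a)"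
    and "(\<integral>t. \<bar>indicator {0..} t * (1 / (a + t) - 1 / (1 + t))\<bar> \<partial>lborel) = \<bar>ln a\<bar>"
proof -
  have D: "DERIV (\<lambda>t. ln (a + t) - ln (1 + t)) t :> 1 / (a + t) - 1 / (1 + t)" if "0 \<le> t" for t
    using a that by (auto intro!: derivative_eq_intros)
  have "has_bochner_integral lborel (\<lambda>t. indicator {0..} t * (1 / (a + t) - 1 / (1 + t))) (- ln a) \<and>
    (\<integral>t. \<bar>indicator {0..} t * (1 / (a + t) - 1 / (1 + t))\<bar> \<partial>lborel) = \<bar>ln a\<bar>"
  proof (cases "a \<le> 1")
    case True
    have s: "0 \<le> 1 / (a + t) - 1 / (1 + t)" if "0 \<le> t" for t
      using a that True by (simp add: frac_le)
    have 1: "has_bochner_integral lborel (\<lambda>t. indicator {0..} t * (1 / (a + t) - 1 / (1 + t)))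
        (0 - (ln (a + 0) - ln (1 + 0)))"
      by (rule has_bochner_integral_FTC_atLeast[OF _ D s log_ratio_tendsto[OF a]]) (use a True in auto)
    moreover have "\<bar>indicator {0..} t * (1 / (a + t) - 1 / (1 + t))\<bar> = indicator {0..} t * (1 / (a + t) - 1 / (1 + t))" for t
      using s[of t] by (auto simp: indicator_def)
    ultimately show ?thesis using True a by (simp add: has_bochner_integral_integral_eq)
  next
    case False
    have s: "0 \<le> - (1 / (a + t) - 1 / (1 + t))" if "0 \<le> t" for t
      using a that False by (simp add: frac_le)
    have "has_bochner_integral lborel (\<lambda>t. indicator {0..} t * - (1 / (a + t) - 1 / (1 + t)))
        (- 0 - - (ln (a + 0) - ln (1 + 0)))"
      by (rule has_bochner_integral_FTC_atLeast[OF _ DERIV_minus[OF D] s tendsto_minus[OF log_ratio_tendsto[OF a]]])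
         (use a False in auto)
    then have 1: "has_bochner_integral lborel (\<lambda>t. - (indicator {0..} t * (1 / (a + t) - 1 / (1 + t)))) (ln a)"
      by (simp add: algebra_simps)
    have "\<bar>indicator {0..} t * (1 / (a + t) - 1 / (1 + t))\<bar> = - (indicator {0..} t * (1 / (a + t) - 1 / (1 + t)))" for t
      using s[of t] by (auto simp: indicator_def)
    then have "(\<integral>t. \<bar>indicator {0..} t * (1 / (a + t) - 1 / (1 + t))\<bar> \<partial>lborel) = ln a"
      using has_bochner_integral_integral_eq[OF 1] by (simp only:)
    then show ?thesis using has_bochner_integral_minus[OF 1] False by simp
  qed
  then show "has_bochner_integral lborel (\<lambda>t. indicator {0..} t * (1 / (a + t) - 1 / (1 + t))) (- ln a)"
    and "(\<integral>t. \<bar>indicator {0..} t * (1 / (a + t) - 1 / (1 + t))\<bar> \<partial>lborel) = \<bar>ln a\<bar>" by auto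
qed

section \<open>Positive semidefinite kernels as mixtures of Gaussians\<close>

lemma gaussian_integrable:
  fixes s :: real
  assumes s: "0 < s"
  shows "integrable lborel (\<lambda>z::'a::euclidean_space. exp (- (s * (norm z)\<^sup>2)))"
proof -
  define d where "d = DIM('a)"
  have d: "0 < d" by (simp add: d_def)
  \<comment> \<open>The two requirements on \<open>c\<close>: \<open>c \<le> 1\<close> gives
    \<open>c (w + 1) \<le> 1 + c w \<le> exp (c w)\<close>, and \<open>c d \<le> s\<close> keeps the
    \<open>d\<close>-th power of this below \<open>exp (s w)\<close>.\<close>
  define c where "c = min 1 (s / d)"
  have c: "0 < c" "c \<le> 1" "c * d \<le> s" using s d by (auto simp: c_def min_def field_simps)
  show ?thesis
  proof (rule Bochner_Integration.integrable_bound)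
    show "integrable lborel (\<lambda>z::'a. (1 / c ^ d) * (1 / ((norm z)\<^sup>2 + 1) ^ d))"
      unfolding d_def by (intro integrable_mult_right inverse_power_integrable)
    show "AE z in lborel. norm (exp (- (s * (norm (z::'a))\<^sup>2))) \<le> norm ((1 / c ^ d) * (1 / ((norm z)\<^sup>2 + 1) ^ d))"
    proof (rule AE_I2)
      fix z :: 'a
      let ?w = "(norm z)\<^sup>2"
      have "c * (?w + 1) \<le> 1 + c * ?w" using c by (simp add: algebra_simps)
      also have "\<dots> \<le> exp (c * ?w)" by (rule exp_ge_add_one_self)
      finally have "(c * (?w + 1)) ^ d \<le> exp (c * ?w) ^ d" using c by (intro power_mono) auto
      also have "\<dots> = exp (c * d * ?w)" by (simp add: exp_of_nat_mult[symmetric] mult_ac)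
      also have "\<dots> \<le> exp (s * ?w)" using c by (auto intro!: mult_right_mono)
      finally have le: "(c * (?w + 1)) ^ d \<le> exp (s * ?w)" .
      have p: "0 < (c * (?w + 1)) ^ d" using c by (intro zero_less_power mult_pos_pos add_nonneg_pos) auto
      have "exp (- (s * ?w)) = 1 / exp (s * ?w)" by (simp add: exp_minus inverse_eq_divide)
      also have "\<dots> \<le> 1 / (c * (?w + 1)) ^ d" using le p by (intro divide_left_mono) auto
      finally show "norm (exp (- (s * ?w))) \<le> norm ((1 / c ^ d) * (1 / (?w + 1) ^ d))"
        using c by (simp add: power_mult_distrib)
    qed
  qed auto
qed

text \<open>A Gaussian is the convolution square of a narrower one. With \<open>m\<close> the
  midpoint of \<open>x\<close> and \<open>y\<close>, the parallelogram law reads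
  \<open>2 |x - z|^2 + 2 |y - z|^2 = 4 |z - m|^2 + |x - y|^2\<close>, and integrating over
  \<open>z\<close> leaves a constant independent of \<open>x\<close> and \<open>y\<close>.\<close>

lemma gaussian_convolution:
  fixes s :: real
  assumes s: "0 < s"
  obtains c :: real where "0 < c" "\<And>x y :: 'a::euclidean_space. has_bochner_integral lborel
      (\<lambda>z. exp (- (2 * s * (norm (x - z))\<^sup>2)) * exp (- (2 * s * (norm (y - z))\<^sup>2)))
      (c * exp (- (s * (norm (x - y))\<^sup>2)))"
proof -
  let ?g = "\<lambda>z::'a. exp (- (4 * s * (norm z)\<^sup>2))"
  have ig: "integrable lborel ?g" using gaussian_integrable[of "4 * s"] s by simp
  define c where "c = (\<integral>z. ?g z \<partial>lborel)"
  have "0 < c" unfolding c_def by (rule lborel_integral_pos[OF ig]) simp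
  moreover have "has_bochner_integral lborel
      (\<lambda>z. exp (- (2 * s * (norm (x - z))\<^sup>2)) * exp (- (2 * s * (norm (y - z))\<^sup>2)))
      (c * exp (- (s * (norm (x - y))\<^sup>2)))" for x y :: 'a
  proof -
    define m where "m = (1 / 2) *\<^sub>R (x + y)"
    have "integrable lborel (\<lambda>z. ?g (- m + 1 *\<^sub>R z))" by (rule lborel_integrable_affine[OF ig]) simp
    moreover have "(\<integral>z. ?g (- m + 1 *\<^sub>R z) \<partial>lborel) = c"
      unfolding c_def using lborel_integral_affine[of ?g 1 "- m"] by simp
    ultimately have "has_bochner_integral lborel (\<lambda>z. ?g (- m + 1 *\<^sub>R z)) c"
      by (simp add: has_bochner_integral_iff)
    then have "has_bochner_integral lborel (\<lambda>z. ?g (- m + 1 *\<^sub>R z) * exp (- (s * (norm (x - y))\<^sup>2)))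
        (c * exp (- (s * (norm (x - y))\<^sup>2)))"
      by (rule has_bochner_integral_mult_left)
    moreover have "?g (- m + 1 *\<^sub>R z) * exp (- (s * (norm (x - y))\<^sup>2)) =
      exp (- (2 * s * (norm (x - z))\<^sup>2)) * exp (- (2 * s * (norm (y - z))\<^sup>2))" for z
    proof -
      have "4 * (norm (- m + z))\<^sup>2 + (norm (x - y))\<^sup>2 = 2 * (norm (x - z))\<^sup>2 + 2 * (norm (y - z))\<^sup>2"
        unfolding power2_norm_eq_inner m_def
        by (simp add: inner_add_left inner_add_right inner_diff_left inner_diff_right inner_commute algebra_simps)
      then have "s * (4 * (norm (- m + z))\<^sup>2 + (norm (x - y))\<^sup>2) =
          s * (2 * (norm (x - z))\<^sup>2 + 2 * (norm (y - z))\<^sup>2)" by simp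
      then have "- (4 * s * (norm (- m + z))\<^sup>2) + - (s * (norm (x - y))\<^sup>2) =
          - (2 * s * (norm (x - z))\<^sup>2) + - (2 * s * (norm (y - z))\<^sup>2)"
        by (simp add: algebra_simps)
      then show ?thesis by (simp only: exp_add[symmetric] scaleR_one)
    qed
    ultimately show ?thesis by (simp only:)
  qed
  ultimately show thesis using that by blast
qed

text \<open>Mixtures lead from Gaussian kernels to \<open>1 / (|x - y|\<^sup>2 + t)\<close> and then to the logarithm.\<close>

lemma integral_mixture_nonneg:
  fixes F :: "'p \<Rightarrow> 't \<Rightarrow> real"
  assumes sf: "sigma_finite_measure P" "sigma_finite_measure N"
    and F[measurable]: "case_prod F \<in> borel_measurable (P \<Otimes>\<^sub>M N)"
    and i: "AE p in P. integrable N (F p)"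
    and a: "integrable P (\<lambda>p. \<integral>t. \<bar>F p t\<bar> \<partial>N)"
    and nn: "AE t in N. 0 \<le> (\<integral>p. F p t \<partial>P)"
  shows "0 \<le> (\<integral>p. \<integral>t. F p t \<partial>N \<partial>P)"
proof -
  interpret P: sigma_finite_measure P by fact
  interpret N: sigma_finite_measure N by fact
  interpret pair_sigma_finite P N ..
  have "integrable (P \<Otimes>\<^sub>M N) (case_prod F)"
    by (rule Fubini_integrable) (use i a in auto)
  then have "(\<integral>p. \<integral>t. F p t \<partial>N \<partial>P) = (\<integral>t. \<integral>p. F p t \<partial>P \<partial>N)"
    by (rule Fubini_integral[symmetric])
  also have "0 \<le> \<dots>" using nn by (rule integral_nonneg_AE)
  finally show ?thesis .
qed

text \<open>Setting for quadratic forms with a signed density \<open>h\<close>: a kernel is tested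
  against \<open>h x * h y\<close> on the product measure, and boundedness of \<open>h\<close>
  transfers integrability from the kernel to the form.\<close>

locale bounded_weight = finite_measure M for M :: "'a::euclidean_space measure" +
  fixes h :: "'a \<Rightarrow> real" and C :: real
  assumes sets_M[measurable_cong]: "sets M = sets borel"
    and h[measurable]: "h \<in> borel_measurable borel" and h_le: "\<And>x. \<bar>h x\<bar> \<le> C"
begin

definition hh :: "'a \<times> 'a \<Rightarrow> real" where "hh p = h (fst p) * h (snd p)"

sublocale MM: finite_measure "M \<Otimes>\<^sub>M M"
  by (rule finite_measure_pair_measure) unfold_locales

lemma C_nonneg: "0 \<le> C" using h_le[of 0] by simp

lemma hh_measurable[measurable]: "hh \<in> borel_measurable (M \<Otimes>\<^sub>M M)"
  unfolding hh_def[abs_def] by measurable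

lemma hh_le: "\<bar>hh p\<bar> \<le> C * C"
  unfolding hh_def abs_mult by (intro mult_mono h_le C_nonneg) auto

lemma h_integrable: "integrable M h"
  by (rule integrable_const_bound[of _ C]) (use h_le in auto)

lemma hh_integral: "integrable (M \<Otimes>\<^sub>M M) hh" "(\<integral>p. hh p \<partial>(M \<Otimes>\<^sub>M M)) = (\<integral>x. h x \<partial>M)\<^sup>2"
proof -
  interpret pair_sigma_finite M M ..
  show i: "integrable (M \<Otimes>\<^sub>M M) hh"
    by (rule MM.integrable_const_bound[of _ "C * C"]) (use hh_le in auto)
  show "(\<integral>p. hh p \<partial>(M \<Otimes>\<^sub>M M)) = (\<integral>x. h x \<partial>M)\<^sup>2"
    using integral_fst'[OF i] by (simp add: hh_def[abs_def] power2_eq_square)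
qed

text \<open>A rank-one kernel yields the square of a single integral. All kernels below are mixtures
  built on this case.\<close>

lemma product_kernel_nonneg:
  assumes [measurable]: "f \<in> borel_measurable borel" and f: "\<And>x. \<bar>f x\<bar> \<le> D"
  shows "0 \<le> (\<integral>p. f (fst p) * f (snd p) * hh p \<partial>(M \<Otimes>\<^sub>M M))"
proof -
  have D: "0 \<le> D" using f[of 0] by simp
  interpret fh: bounded_weight M "\<lambda>x. f x * h x" "D * C"
    by unfold_locales (auto simp: sets_M abs_mult intro!: mult_mono f h_le D)
  show ?thesis using fh.hh_integral(2) by (simp add: fh.hh_def hh_def mult_ac)
qed

text \<open>For fixed \<open>z\<close> the integrand of \<open>gaussian_convolution\<close> is a
  rank-one kernel.\<close>

lemma gaussian_kernel_nonneg:
  assumes s: "0 < s"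
  shows "0 \<le> (\<integral>p. exp (- (s * (norm (fst p - snd p))\<^sup>2)) * hh p \<partial>(M \<Otimes>\<^sub>M M))"
proof -
  obtain c where c: "0 < c" and conv: "\<And>x y :: 'a. has_bochner_integral lborel
      (\<lambda>z. exp (- (2 * s * (norm (x - z))\<^sup>2)) * exp (- (2 * s * (norm (y - z))\<^sup>2)))
      (c * exp (- (s * (norm (x - y))\<^sup>2)))"
    using gaussian_convolution[OF s, where 'a = 'a] by blast
  let ?k = "\<lambda>p (z :: 'a). exp (- (2 * s * (norm (fst p - z))\<^sup>2)) * exp (- (2 * s * (norm (snd p - z))\<^sup>2))"
  let ?F = "\<lambda>p z. ?k p z * hh p"
  have int: "integrable lborel (?k p)" "(\<integral>z. ?k p z \<partial>lborel) = c * exp (- (s * (norm (fst p - snd p))\<^sup>2))" for p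
    using conv[of "fst p" "snd p"] by (auto simp: has_bochner_integral_iff)
  have "0 \<le> (\<integral>p. \<integral>z. ?F p z \<partial>lborel \<partial>(M \<Otimes>\<^sub>M M))"
  proof (rule integral_mixture_nonneg)
    show "sigma_finite_measure (M \<Otimes>\<^sub>M M)" "sigma_finite_measure (lborel :: 'a measure)" by unfold_locales
    show "case_prod ?F \<in> borel_measurable ((M \<Otimes>\<^sub>M M) \<Otimes>\<^sub>M lborel)" by measurable
    show "AE p in M \<Otimes>\<^sub>M M. integrable lborel (?F p)"
      using int(1) by (intro AE_I2 integrable_mult_left) auto
    have abs: "(\<integral>z. \<bar>?F p z\<bar> \<partial>lborel) = c * exp (- (s * (norm (fst p - snd p))\<^sup>2)) * \<bar>hh p\<bar>" for p
      unfolding int(2)[symmetric] abs_mult by simp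
    show "integrable (M \<Otimes>\<^sub>M M) (\<lambda>p. \<integral>z. \<bar>?F p z\<bar> \<partial>lborel)"
      unfolding abs
    proof (rule MM.integrable_const_bound[of _ "c * 1 * (C * C)"])
      show "AE p in M \<Otimes>\<^sub>M M. norm (c * exp (- (s * (norm (fst p - snd p))\<^sup>2)) * \<bar>hh p\<bar>) \<le> c * 1 * (C * C)"
      proof (rule AE_I2)
        fix p
        have "c * exp (- (s * (norm (fst p - snd p))\<^sup>2)) * \<bar>hh p\<bar> \<le> c * 1 * (C * C)"
        proof (rule mult_mono[OF _ hh_le])
          show "c * exp (- (s * (norm (fst p - snd p))\<^sup>2)) \<le> c * 1"
            using c s by (intro mult_left_mono) auto
        qed (use c in auto)
        then show "norm (c * exp (- (s * (norm (fst p - snd p))\<^sup>2)) * \<bar>hh p\<bar>) \<le> c * 1 * (C * C)"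
          using c by (simp add: abs_mult)
      qed
    qed measurable
    show "AE z in lborel. 0 \<le> (\<integral>p. ?F p z \<partial>(M \<Otimes>\<^sub>M M))"
    proof (rule AE_I2)
      fix z
      show "0 \<le> (\<integral>p. ?F p z \<partial>(M \<Otimes>\<^sub>M M))"
        by (rule product_kernel_nonneg[of "\<lambda>x. exp (- (2 * s * (norm (x - z))\<^sup>2))" 1]) (use s in auto)
    qed
  qed
  also have "(\<integral>p. \<integral>z. ?F p z \<partial>lborel \<partial>(M \<Otimes>\<^sub>M M)) =
      c * (\<integral>p. exp (- (s * (norm (fst p - snd p))\<^sup>2)) * hh p \<partial>(M \<Otimes>\<^sub>M M))"
    unfolding integral_mult_left_zero int(2) by (simp add: mult.assoc)
  finally show ?thesis using c by (simp add: zero_le_mult_iff)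
qed

text \<open>A mixture of Gaussians, by \<open>1 / A = \<integral> exp (- s A) ds\<close> over
  \<open>s \<ge> 0\<close> with \<open>A = |x - y|^2 + t\<close>; the factor
  \<open>exp (- s t)\<close> does not involve \<open>x\<close> and \<open>y\<close>.\<close>

lemma resolvent_kernel_nonneg:
  assumes t: "0 < t"
  shows "0 \<le> (\<integral>p. 1 / ((norm (fst p - snd p))\<^sup>2 + t) * hh p \<partial>(M \<Otimes>\<^sub>M M))"
proof -
  let ?A = "\<lambda>p :: 'a \<times> 'a. (norm (fst p - snd p))\<^sup>2 + t"
  let ?k = "\<lambda>p s. indicator {0..} s * exp (- (s * ?A p))"
  let ?F = "\<lambda>p s. ?k p s * hh p"
  have A: "0 < ?A p" "t \<le> ?A p" for p using t by (auto intro: add_nonneg_pos)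
  have int: "integrable lborel (?k p)" "(\<integral>s. ?k p s \<partial>lborel) = 1 / ?A p" for p
    using exp_integral_inverse[OF A(1)] by (auto simp: has_bochner_integral_iff)
  have "0 \<le> (\<integral>p. \<integral>s. ?F p s \<partial>lborel \<partial>(M \<Otimes>\<^sub>M M))"
  proof (rule integral_mixture_nonneg)
    show "sigma_finite_measure (M \<Otimes>\<^sub>M M)" "sigma_finite_measure (lborel :: real measure)" by unfold_locales
    show "case_prod ?F \<in> borel_measurable ((M \<Otimes>\<^sub>M M) \<Otimes>\<^sub>M lborel)" by measurable
    show "AE p in M \<Otimes>\<^sub>M M. integrable lborel (?F p)"
      using int(1) by (intro AE_I2 integrable_mult_left) auto
    have abs: "(\<integral>z. \<bar>?F p z\<bar> \<partial>lborel) = 1 / ?A p * \<bar>hh p\<bar>" for p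
      unfolding int(2)[symmetric] abs_mult by simp
    show "integrable (M \<Otimes>\<^sub>M M) (\<lambda>p. \<integral>z. \<bar>?F p z\<bar> \<partial>lborel)"
      unfolding abs
    proof (rule MM.integrable_const_bound[of _ "1 / t * (C * C)"])
      have "1 / ?A p \<le> 1 / t" for p using A t by (intro divide_left_mono) auto
      then have "1 / ?A p * \<bar>hh p\<bar> \<le> 1 / t * (C * C)" for p
        using hh_le t by (intro mult_mono) auto
      moreover have "norm (1 / ?A p * \<bar>hh p\<bar>) = 1 / ?A p * \<bar>hh p\<bar>" for p
        using A(1)[of p] by (simp add: abs_mult)
      ultimately show "AE p in M \<Otimes>\<^sub>M M. norm (1 / ?A p * \<bar>hh p\<bar>) \<le> 1 / t * (C * C)"
        by (intro AE_I2) metis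
    qed measurable
    show "AE s in lborel. 0 \<le> (\<integral>p. ?F p s \<partial>(M \<Otimes>\<^sub>M M))"
    proof (rule AE_I2)
      fix s :: real
      have "?F p s = (indicator {0..} s * exp (- (s * t))) * (exp (- (s * (norm (fst p - snd p))\<^sup>2)) * hh p)" for p
      proof -
        have "exp (- (s * ?A p)) = exp (- (s * t)) * exp (- (s * (norm (fst p - snd p))\<^sup>2))"
          by (simp add: exp_add[symmetric] algebra_simps)
        then show ?thesis by (simp only: mult.assoc)
      qed
      then have eq: "(\<integral>p. ?F p s \<partial>(M \<Otimes>\<^sub>M M)) = (indicator {0..} s * exp (- (s * t))) *
          (\<integral>p. exp (- (s * (norm (fst p - snd p))\<^sup>2)) * hh p \<partial>(M \<Otimes>\<^sub>M M))"
        by (simp only: integral_mult_right_zero)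
      \<comment> \<open>The indicator removes \<open>s < 0\<close>; at \<open>s = 0\<close> the
        kernel is the constant 1 and the form is the square of the integral of
        \<open>h\<close>.\<close>
      consider "s < 0" | "s = 0" | "0 < s" by linarith
      then show "0 \<le> (\<integral>p. ?F p s \<partial>(M \<Otimes>\<^sub>M M))"
      proof cases
        case 2 then show ?thesis unfolding eq by (simp add: hh_integral)
      next
        case 3 show ?thesis unfolding eq using gaussian_kernel_nonneg[OF 3] by simp
      qed simp
    qed
  qed
  also have "(\<integral>p. \<integral>s. ?F p s \<partial>lborel \<partial>(M \<Otimes>\<^sub>M M)) = (\<integral>p. 1 / ?A p * hh p \<partial>(M \<Otimes>\<^sub>M M))"
    by (simp only: integral_mult_left_zero int(2))
  finally show ?thesis .
qed

text \<open>The identity \<open>- ln a = \<integral> (1 / (a + t) - 1 / (1 + t)) dt\<close> with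
  \<open>a = |x - y|^2\<close> makes the logarithm a mixture of resolvent kernels minus constant
  kernels. The constants contribute the square of the integral of \<open>h\<close>, which is 0 by
  assumption. As the integrand has constant sign in \<open>t\<close>, its L1 norm is
  \<open>|ln a|\<close>, and \<open>int_log\<close> justifies Fubini.\<close>

lemma log_kernel_nonneg:
  assumes zero: "(\<integral>x. h x \<partial>M) = 0"
    and atom: "AE p in M \<Otimes>\<^sub>M M. fst p \<noteq> snd p"
    and int_log: "integrable (M \<Otimes>\<^sub>M M) (\<lambda>p. ln (norm (fst p - snd p)))"
  shows "0 \<le> (\<integral>p. - ln (norm (fst p - snd p)) * hh p \<partial>(M \<Otimes>\<^sub>M M))"
proof -
  let ?r = "\<lambda>p :: 'a \<times> 'a. (norm (fst p - snd p))\<^sup>2"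
  let ?k = "\<lambda>p t. indicator {0..} t * (1 / (?r p + t) - 1 / (1 + t))"
  let ?F = "\<lambda>p t. ?k p t * hh p"
  have r: "0 < ?r p" "ln (?r p) = 2 * ln (norm (fst p - snd p))" if "fst p \<noteq> snd p" for p :: "'a \<times> 'a"
    using that by (simp_all add: ln_realpow)
  have "0 \<le> (\<integral>p. \<integral>t. ?F p t \<partial>lborel \<partial>(M \<Otimes>\<^sub>M M))"
  proof (rule integral_mixture_nonneg)
    show "sigma_finite_measure (M \<Otimes>\<^sub>M M)" "sigma_finite_measure (lborel :: real measure)" by unfold_locales
    show "case_prod ?F \<in> borel_measurable ((M \<Otimes>\<^sub>M M) \<Otimes>\<^sub>M lborel)" by measurable
    show "AE p in M \<Otimes>\<^sub>M M. integrable lborel (?F p)"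
      using atom
    proof eventually_elim
      fix p :: "'a \<times> 'a" assume "fst p \<noteq> snd p"
      from log_as_integral(1)[OF r(1)[OF this]] show "integrable lborel (?F p)"
        by (intro integrable_mult_left) (simp add: has_bochner_integral_iff)
    qed
    have abs: "AE p in M \<Otimes>\<^sub>M M. 2 * \<bar>ln (norm (fst p - snd p))\<bar> * \<bar>hh p\<bar> = (\<integral>t. \<bar>?F p t\<bar> \<partial>lborel)"
      using atom
    proof eventually_elim
      fix p :: "'a \<times> 'a" assume p: "fst p \<noteq> snd p"
      have 1: "(\<integral>t. \<bar>?F p t\<bar> \<partial>lborel) = (\<integral>t. \<bar>?k p t\<bar> \<partial>lborel) * \<bar>hh p\<bar>"
        by (simp only: abs_mult[of _ "hh p"] integral_mult_left_zero)
      show "2 * \<bar>ln (norm (fst p - snd p))\<bar> * \<bar>hh p\<bar> = (\<integral>t. \<bar>?F p t\<bar> \<partial>lborel)"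
        unfolding 1 log_as_integral(2)[OF r(1)[OF p]] r(2)[OF p] by (simp add: abs_mult)
    qed
    have "integrable (M \<Otimes>\<^sub>M M) (\<lambda>p. 2 * \<bar>ln (norm (fst p - snd p))\<bar> * \<bar>hh p\<bar>)"
    proof (rule Bochner_Integration.integrable_bound)
      show "integrable (M \<Otimes>\<^sub>M M) (\<lambda>p. (2 * (C * C)) * ln (norm (fst p - snd p)))"
        using int_log by (rule integrable_mult_right)
      show "AE p in M \<Otimes>\<^sub>M M. norm (2 * \<bar>ln (norm (fst p - snd p))\<bar> * \<bar>hh p\<bar>) \<le>
          norm ((2 * (C * C)) * ln (norm (fst p - snd p)))"
      proof (rule AE_I2)
        fix p :: "'a \<times> 'a"
        have "\<bar>ln (norm (fst p - snd p))\<bar> * \<bar>hh p\<bar> \<le> \<bar>ln (norm (fst p - snd p))\<bar> * (C * C)"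
          by (intro mult_left_mono hh_le) auto
        then show "norm (2 * \<bar>ln (norm (fst p - snd p))\<bar> * \<bar>hh p\<bar>) \<le>
            norm ((2 * (C * C)) * ln (norm (fst p - snd p)))"
          using C_nonneg by (simp add: abs_mult mult_ac)
      qed
    qed measurable
    then show "integrable (M \<Otimes>\<^sub>M M) (\<lambda>p. \<integral>t. \<bar>?F p t\<bar> \<partial>lborel)"
      by (rule integrable_cong_AE_imp) (measurable, use abs in auto)
    show "AE t in lborel. 0 \<le> (\<integral>p. ?F p t \<partial>(M \<Otimes>\<^sub>M M))"
      using AE_lborel_singleton[of "0 :: real"]
    proof eventually_elim
      fix t :: real assume t: "t \<noteq> 0"
      show "0 \<le> (\<integral>p. ?F p t \<partial>(M \<Otimes>\<^sub>M M))"
      proof (cases "0 < t")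
      case True
      have A: "0 < ?r p + t" "t \<le> ?r p + t" for p using True by (auto intro: add_nonneg_pos)
      have "integrable (M \<Otimes>\<^sub>M M) (\<lambda>p. 1 / (?r p + t) * hh p)"
      proof (rule MM.integrable_const_bound[of _ "1 / t * (C * C)"])
        have "1 / (?r p + t) \<le> 1 / t" for p using A True by (intro divide_left_mono) auto
        then have "1 / (?r p + t) * \<bar>hh p\<bar> \<le> 1 / t * (C * C)" for p
          using hh_le True by (intro mult_mono) auto
        moreover have "norm (1 / (?r p + t) * hh p) = 1 / (?r p + t) * \<bar>hh p\<bar>" for p
          using A(1)[of p] by (simp add: abs_mult)
        ultimately show "AE p in M \<Otimes>\<^sub>M M. norm (1 / (?r p + t) * hh p) \<le> 1 / t * (C * C)"
          by (intro AE_I2) metis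
      qed measurable
      moreover have "integrable (M \<Otimes>\<^sub>M M) (\<lambda>p. 1 / (1 + t) * hh p)"
        using hh_integral(1) by (rule integrable_mult_right)
      moreover have "?F p t = 1 / (?r p + t) * hh p - 1 / (1 + t) * hh p" for p
        using True by (simp add: left_diff_distrib)
      ultimately have "(\<integral>p. ?F p t \<partial>(M \<Otimes>\<^sub>M M)) =
          (\<integral>p. 1 / (?r p + t) * hh p \<partial>(M \<Otimes>\<^sub>M M)) - 1 / (1 + t) * (\<integral>p. hh p \<partial>(M \<Otimes>\<^sub>M M))"
        by (simp only: Bochner_Integration.integral_diff integral_mult_right_zero)
      then show ?thesis using resolvent_kernel_nonneg[OF True] by (simp add: hh_integral zero)
    next
      case False then show ?thesis using t by simp
      qed
    qed
  qed
  also have "(\<integral>p. \<integral>t. ?F p t \<partial>lborel \<partial>(M \<Otimes>\<^sub>M M)) = (\<integral>p. 2 * (- ln (norm (fst p - snd p)) * hh p) \<partial>(M \<Otimes>\<^sub>M M))"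
  proof (rule integral_cong_AE)
    show "AE p in M \<Otimes>\<^sub>M M. (\<integral>t. ?F p t \<partial>lborel) = 2 * (- ln (norm (fst p - snd p)) * hh p)"
      using atom
    proof eventually_elim
      fix p :: "'a \<times> 'a" assume p: "fst p \<noteq> snd p"
      have "(\<integral>t. ?F p t \<partial>lborel) = - ln (?r p) * hh p"
        by (simp only: integral_mult_left_zero has_bochner_integral_integral_eq[OF log_as_integral(1)[OF r(1)[OF p]]])
      then show "(\<integral>t. ?F p t \<partial>lborel) = 2 * (- ln (norm (fst p - snd p)) * hh p)"
        unfolding r(2)[OF p] by simp
    qed
  qed measurable
  finally show ?thesis by simp
qed

end

section \<open>Gibbs measures of repulsive kernels\<close>

text \<open>The slope of \<open>ln\<close> on \<open>(0, C]\<close> is at least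
  \<open>1 / C\<close>. This strong monotonicity is the source of the L2 gain in
  \<open>gibbs_antimonotone\<close>.\<close>

lemma diff_ln_diff_ge:
  fixes s t C :: real
  assumes "0 < s" "s \<le> C" "0 < t" "t \<le> C"
  shows "(s - t)\<^sup>2 / C \<le> (s - t) * (ln s - ln t)"
proof -
  have main: "(u - v)\<^sup>2 / C \<le> (u - v) * (ln u - ln v)"
    if "0 < v" "v \<le> u" "u \<le> C" for u v :: real
  proof -
    have "ln (v / u) \<le> v / u - 1" using that by (intro ln_le_minus_one) auto
    then have "(u - v) / u \<le> ln u - ln v" using that by (simp add: ln_div field_simps)
    moreover have "(u - v) / C \<le> (u - v) / u" using that by (intro divide_left_mono) auto
    ultimately have "(u - v) * ((u - v) / C) \<le> (u - v) * (ln u - ln v)"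
      using that by (intro mult_left_mono) auto
    then show ?thesis by (simp add: power2_eq_square)
  qed
  show ?thesis
  proof (cases "t \<le> s")
    case True then show ?thesis using main assms by simp
  next
    case False
    then have "(t - s)\<^sup>2 / C \<le> (t - s) * (ln t - ln s)" using main assms by simp
    then show ?thesis by (simp add: power2_commute algebra_simps)
  qed
qed

text \<open>What the fixed point argument uses of the logarithm. \<open>q_bound\<close> is the
  hypothesis of a Schur test; positivity is asked only for functions of integral 0, such as
  differences of probability densities.\<close>

locale repulsive_kernel = finite_measure M for M :: "'a measure" +
  fixes q :: "'a \<Rightarrow> 'a \<Rightarrow> real" and B a :: real
  assumes q_measurable[measurable]: "case_prod q \<in> borel_measurable (M \<Otimes>\<^sub>M M)"
    and q_nonneg: "x \<in> space M \<Longrightarrow> y \<in> space M \<Longrightarrow> 0 \<le> q x y"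
    and q_sym: "x \<in> space M \<Longrightarrow> y \<in> space M \<Longrightarrow> q x y = q y x"
    and q_integrable: "x \<in> space M \<Longrightarrow> integrable M (q x)"
    and q_bound: "x \<in> space M \<Longrightarrow> (\<integral>y. q x y \<partial>M) \<le> B"
    and cond_pos_def: "h \<in> borel_measurable M \<Longrightarrow> (\<And>x. x \<in> space M \<Longrightarrow> \<bar>h x\<bar> \<le> C) \<Longrightarrow>
          (\<integral>x. h x \<partial>M) = 0 \<Longrightarrow> 0 \<le> (\<integral>x. h x * (\<integral>y. q x y * h y \<partial>M) \<partial>M)"
    and a_pos: "0 < a" and B_pos: "0 < B"
    and mass_pos: "0 < measure M (space M)"
begin

section \<open>Bounded functions, potentials and the energy form\<close>

definition bdd :: "('a \<Rightarrow> real) \<Rightarrow> bool" where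
  "bdd h \<longleftrightarrow> h \<in> borel_measurable M \<and> (\<exists>C. \<forall>x\<in>space M. \<bar>h x\<bar> \<le> C)"

definition pot :: "('a \<Rightarrow> real) \<Rightarrow> 'a \<Rightarrow> real" where
  "pot h x = (\<integral>y. q x y * h y \<partial>M)"

definition energy :: "('a \<Rightarrow> real) \<Rightarrow> ('a \<Rightarrow> real) \<Rightarrow> real" where
  "energy f g = (\<integral>x. f x * pot g x \<partial>M)"

definition partition_fun :: "('a \<Rightarrow> real) \<Rightarrow> real" where
  "partition_fun p = (\<integral>x. exp (- (a * pot p x)) \<partial>M)"

definition gibbs :: "('a \<Rightarrow> real) \<Rightarrow> 'a \<Rightarrow> real" where
  "gibbs p x = exp (- (a * pot p x)) / partition_fun p"

text \<open>An upper bound for \<open>1 / partition_fun p\<close>, obtained from Jensen's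
  inequality, since the mean of \<open>pot p\<close> is at most \<open>B\<close> divided by the
  total mass.\<close>

definition gibbs_bound :: real where
  "gibbs_bound = exp (a * B / measure M (space M)) / measure M (space M)"

text \<open>The upper bound is built in so that the class is preserved by \<open>gibbs\<close> and
  by convex combinations, and so that one constant serves for the whole iteration.\<close>

definition is_density :: "('a \<Rightarrow> real) \<Rightarrow> bool" where
  "is_density p \<longleftrightarrow> p \<in> borel_measurable M \<and> (\<forall>x\<in>space M. 0 \<le> p x \<and> p x \<le> gibbs_bound) \<and>
     (\<integral>x. p x \<partial>M) = 1"

lemma bddI: "h \<in> borel_measurable M \<Longrightarrow> (\<And>x. x \<in> space M \<Longrightarrow> \<bar>h x\<bar> \<le> C) \<Longrightarrow> bdd h"
  by (auto simp: bdd_def)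

lemma bddE:
  assumes "bdd h"
  obtains C where "h \<in> borel_measurable M" "0 \<le> C" "\<And>x. x \<in> space M \<Longrightarrow> \<bar>h x\<bar> \<le> C"
proof -
  obtain C where "h \<in> borel_measurable M" "\<forall>x\<in>space M. \<bar>h x\<bar> \<le> C"
    using assms by (auto simp: bdd_def)
  then show thesis using that[of "\<bar>C\<bar>"] by (meson abs_ge_self abs_ge_zero order_trans)
qed

lemma bdd_measurable[measurable_dest]: "bdd h \<Longrightarrow> h \<in> borel_measurable M"
  by (simp add: bdd_def)

lemma bdd_integrable: "bdd h \<Longrightarrow> integrable M h"
  by (erule bddE) (rule integrable_const_bound, rule AE_I2, auto)

lemma bdd_const: "bdd (\<lambda>_. c)"
  by (rule bddI[of _ "\<bar>c\<bar>"]) auto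

lemma bdd_add:
  assumes "bdd f" "bdd g" shows "bdd (\<lambda>x. f x + g x)"
proof -
  obtain C D where "\<And>x. x \<in> space M \<Longrightarrow> \<bar>f x\<bar> \<le> C" "\<And>x. x \<in> space M \<Longrightarrow> \<bar>g x\<bar> \<le> D"
    using assms by (metis bddE)
  then show ?thesis using assms
    by (intro bddI[of _ "C + D"]) (auto intro: order_trans[OF abs_triangle_ineq] add_mono)
qed

lemma bdd_mult:
  assumes "bdd f" "bdd g" shows "bdd (\<lambda>x. f x * g x)"
proof -
  obtain C where C: "0 \<le> C" "\<And>x. x \<in> space M \<Longrightarrow> \<bar>f x\<bar> \<le> C" using assms by (metis bddE)
  obtain D where D: "0 \<le> D" "\<And>x. x \<in> space M \<Longrightarrow> \<bar>g x\<bar> \<le> D" using assms by (metis bddE)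
  show ?thesis using assms C D
    by (intro bddI[of _ "C * D"]) (auto simp: abs_mult intro!: mult_mono)
qed

lemma bdd_scale: "bdd f \<Longrightarrow> bdd (\<lambda>x. c * f x)"
  using bdd_mult[OF bdd_const] .

lemma bdd_diff: "bdd f \<Longrightarrow> bdd g \<Longrightarrow> bdd (\<lambda>x. f x - g x)"
  using bdd_add[of f "\<lambda>x. (-1) * g x"] bdd_scale[of g "-1"] by simp

lemma q_mult_integrable:
  assumes "bdd h" "x \<in> space M" shows "integrable M (\<lambda>y. q x y * h y)"
proof -
  obtain C where C: "h \<in> borel_measurable M" "0 \<le> C" "\<And>x. x \<in> space M \<Longrightarrow> \<bar>h x\<bar> \<le> C"
    using assms by (metis bddE)
  note [measurable] = C(1)
  show ?thesis
  proof (rule Bochner_Integration.integrable_bound)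
    show "integrable M (\<lambda>y. C * q x y)" using q_integrable assms by auto
    show "(\<lambda>y. q x y * h y) \<in> borel_measurable M" using assms(2) by measurable
    show "AE y in M. norm (q x y * h y) \<le> norm (C * q x y)"
      using C assms(2) q_nonneg
      by (intro AE_I2) (auto simp: abs_mult mult.commute[of C] intro!: mult_left_mono)
  qed
qed

lemma pot_abs_le:
  assumes "h \<in> borel_measurable M" "\<And>x. x \<in> space M \<Longrightarrow> \<bar>h x\<bar> \<le> C" "0 \<le> C" "x \<in> space M"
  shows "\<bar>pot h x\<bar> \<le> C * B"
proof -
  have b: "bdd h" using assms by (intro bddI)
  have "\<bar>pot h x\<bar> \<le> (\<integral>y. \<bar>q x y * h y\<bar> \<partial>M)"
    unfolding pot_def by (rule integral_abs_bound)
  also have "\<dots> \<le> (\<integral>y. C * q x y \<partial>M)"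
  proof (rule integral_mono)
    show "integrable M (\<lambda>y. \<bar>q x y * h y\<bar>)" using q_mult_integrable[OF b assms(4)] by (rule integrable_abs)
    show "integrable M (\<lambda>y. C * q x y)" using q_integrable assms by auto
    show "\<bar>q x y * h y\<bar> \<le> C * q x y" if "y \<in> space M" for y
      using assms q_nonneg that by (auto simp: abs_mult mult.commute[of C] intro!: mult_left_mono)
  qed
  also have "\<dots> \<le> C * B" using assms q_bound by (auto intro!: mult_left_mono)
  finally show ?thesis .
qed

lemma bdd_pot:
  assumes "bdd h" shows "bdd (pot h)"
proof -
  obtain C where C: "h \<in> borel_measurable M" "0 \<le> C" "\<And>x. x \<in> space M \<Longrightarrow> \<bar>h x\<bar> \<le> C"
    using assms by (metis bddE)
  note [measurable] = C(1)
  have "pot h \<in> borel_measurable M" unfolding pot_def[abs_def] by measurable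
  then show ?thesis using pot_abs_le[OF C(1,3,2)] by (intro bddI) auto
qed

lemma pot_add: "bdd f \<Longrightarrow> bdd g \<Longrightarrow> x \<in> space M \<Longrightarrow> pot (\<lambda>y. f y + g y) x = pot f x + pot g x"
  by (simp add: pot_def distrib_left q_mult_integrable)

lemma pot_scale: "pot (\<lambda>y. c * f y) x = c * pot f x"
  unfolding pot_def by (simp add: mult.left_commute)

lemma pot_diff: "bdd f \<Longrightarrow> bdd g \<Longrightarrow> x \<in> space M \<Longrightarrow> pot (\<lambda>y. f y - g y) x = pot f x - pot g x"
  by (simp add: pot_def right_diff_distrib q_mult_integrable)

lemma pair_integrable:
  assumes f: "bdd f" and g: "bdd g"
  shows "integrable (M \<Otimes>\<^sub>M M) (\<lambda>(x, y). f x * q x y * g y)"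
proof -
  interpret pair_sigma_finite M M ..
  note [measurable] = bdd_measurable[OF f] bdd_measurable[OF g]
  have ag: "bdd (\<lambda>y. \<bar>g y\<bar>)" using g unfolding bdd_def by auto
  have af: "bdd (\<lambda>y. \<bar>f y\<bar>)" using f unfolding bdd_def by auto
  have eq: "(\<integral>y. norm (f x * q x y * g y) \<partial>M) = \<bar>f x\<bar> * pot (\<lambda>y. \<bar>g y\<bar>) x" if "x \<in> space M" for x
    unfolding pot_def
    by (subst integral_mult_right_zero[symmetric], intro Bochner_Integration.integral_cong)
       (use q_nonneg that in \<open>auto simp: abs_mult\<close>)
  show ?thesis
  proof (rule Fubini_integrable)
    show "(\<lambda>(x, y). f x * q x y * g y) \<in> borel_measurable (M \<Otimes>\<^sub>M M)" by measurable
    show "integrable M (\<lambda>x. \<integral>y. norm (case (x, y) of (x, y) \<Rightarrow> f x * q x y * g y) \<partial>M)"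
      using bdd_integrable[OF bdd_mult[OF af bdd_pot[OF ag]]] eq
      by (subst Bochner_Integration.integrable_cong[OF refl, of _ _ "\<lambda>x. \<bar>f x\<bar> * pot (\<lambda>y. \<bar>g y\<bar>) x"]) auto
    show "AE x in M. integrable M (\<lambda>y. case (x, y) of (x, y) \<Rightarrow> f x * q x y * g y)"
      using q_mult_integrable[OF g] by (auto simp: mult.assoc)
  qed
qed

lemma energy_pair:
  assumes f: "bdd f" and g: "bdd g"
  shows "energy f g = (\<integral>z. (case z of (x, y) \<Rightarrow> f x * q x y * g y) \<partial>(M \<Otimes>\<^sub>M M))"
proof -
  interpret pair_sigma_finite M M ..
  show ?thesis using integral_fst[OF pair_integrable[OF f g]]
    by (simp add: energy_def pot_def mult.assoc)
qed

lemma energy_sym: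
  assumes f: "bdd f" and g: "bdd g" shows "energy f g = energy g f"
proof -
  interpret pair_sigma_finite M M ..
  have "energy f g = (\<integral>y. (\<integral>x. f x * q x y * g y \<partial>M) \<partial>M)"
    using integral_snd[OF pair_integrable[OF f g]] energy_pair[OF f g] by simp
  also have "\<dots> = (\<integral>y. g y * pot f y \<partial>M)"
    unfolding pot_def
  proof (intro Bochner_Integration.integral_cong refl)
    fix y assume y: "y \<in> space M"
    show "(\<integral>x. f x * q x y * g y \<partial>M) = g y * (\<integral>x. q y x * f x \<partial>M)"
      by (subst integral_mult_right_zero[symmetric], intro Bochner_Integration.integral_cong refl)
         (use y q_sym in \<open>auto simp: mult_ac\<close>)
  qed
  finally show ?thesis by (simp add: energy_def)
qed

text \<open>Schur test: \<open>2 h(x) h(y) \<le> h(x)^2 + h(y)^2\<close>, and by symmetry of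
  \<open>q\<close> both squares give the same integral, bounded through
  \<open>q_bound\<close>.\<close>

lemma energy_schur:
  assumes h: "bdd h" shows "energy h h \<le> B * (\<integral>x. (h x)\<^sup>2 \<partial>M)"
proof -
  have h2: "bdd (\<lambda>x. (h x)\<^sup>2)" using bdd_mult[OF h h] by (simp add: power2_eq_square)
  have i1: "integrable (M \<Otimes>\<^sub>M M) (\<lambda>(x, y). (h x)\<^sup>2 * q x y * 1)"
    by (rule pair_integrable[OF h2 bdd_const])
  have i2: "integrable (M \<Otimes>\<^sub>M M) (\<lambda>(x, y). 1 * q x y * (h y)\<^sup>2)"
    by (rule pair_integrable[OF bdd_const h2])
  have "energy h h \<le> (\<integral>z. ((case z of (x, y) \<Rightarrow> (h x)\<^sup>2 * q x y * 1)
      + (case z of (x, y) \<Rightarrow> 1 * q x y * (h y)\<^sup>2)) / 2 \<partial>(M \<Otimes>\<^sub>M M))"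
    unfolding energy_pair[OF h h]
  proof (rule integral_mono)
    show "integrable (M \<Otimes>\<^sub>M M) (\<lambda>(x, y). h x * q x y * h y)" by (rule pair_integrable[OF h h])
    show "integrable (M \<Otimes>\<^sub>M M) (\<lambda>z. ((case z of (x, y) \<Rightarrow> (h x)\<^sup>2 * q x y * 1)
      + (case z of (x, y) \<Rightarrow> 1 * q x y * (h y)\<^sup>2)) / 2)" using i1 i2 by auto
    fix z assume "z \<in> space (M \<Otimes>\<^sub>M M)"
    then obtain x y where z: "z = (x, y)" "x \<in> space M" "y \<in> space M"
      by (auto simp: space_pair_measure)
    have "0 \<le> q x y * (h x - h y)\<^sup>2" using q_nonneg z by simp
    then show "(case z of (x, y) \<Rightarrow> h x * q x y * h y) \<le> ((case z of (x, y) \<Rightarrow> (h x)\<^sup>2 * q x y * 1)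
      + (case z of (x, y) \<Rightarrow> 1 * q x y * (h y)\<^sup>2)) / 2"
      using z by (simp add: power2_eq_square algebra_simps)
  qed
  also have "\<dots> = (energy (\<lambda>x. (h x)\<^sup>2) (\<lambda>_. 1) + energy (\<lambda>_. 1) (\<lambda>x. (h x)\<^sup>2)) / 2"
    unfolding energy_pair[OF h2 bdd_const] energy_pair[OF bdd_const h2] using i1 i2 by simp
  also have "\<dots> = energy (\<lambda>x. (h x)\<^sup>2) (\<lambda>_. 1)" using energy_sym[OF h2 bdd_const] by simp
  also have "\<dots> \<le> (\<integral>x. B * (h x)\<^sup>2 \<partial>M)"
    unfolding energy_def
  proof (rule integral_mono)
    show "integrable M (\<lambda>x. (h x)\<^sup>2 * pot (\<lambda>_. 1) x)"
      by (intro bdd_integrable bdd_mult h2 bdd_pot bdd_const)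
    show "integrable M (\<lambda>x. B * (h x)\<^sup>2)" by (intro bdd_integrable bdd_scale h2)
    fix x assume "x \<in> space M"
    then show "(h x)\<^sup>2 * pot (\<lambda>_. 1) x \<le> B * (h x)\<^sup>2"
      using q_bound by (auto simp: pot_def mult.commute[of B] intro!: mult_left_mono)
  qed
  finally show ?thesis by simp
qed

lemma energy_comb:
  assumes f: "bdd f" and g: "bdd g"
  shows "energy (\<lambda>x. s * f x + t * g x) (\<lambda>x. s * f x + t * g x) =
    s\<^sup>2 * energy f f + 2 * s * t * energy f g + t\<^sup>2 * energy g g"
proof -
  have "energy (\<lambda>x. s * f x + t * g x) (\<lambda>x. s * f x + t * g x) =
    (\<integral>x. s\<^sup>2 * (f x * pot f x) + s * t * (f x * pot g x) + s * t * (g x * pot f x)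
      + t\<^sup>2 * (g x * pot g x) \<partial>M)"
    unfolding energy_def
    by (intro Bochner_Integration.integral_cong refl)
       (simp add: pot_add bdd_scale f g pot_scale algebra_simps power2_eq_square)
  also have "\<dots> = s\<^sup>2 * energy f f + s * t * energy f g + s * t * energy g f + t\<^sup>2 * energy g g"
    unfolding energy_def
    using f g by (simp add: bdd_integrable bdd_mult bdd_pot)
  also have "energy g f = energy f g" by (rule energy_sym[OF g f])
  finally show ?thesis by simp
qed

lemma energy_nonneg: "bdd h \<Longrightarrow> (\<integral>x. h x \<partial>M) = 0 \<Longrightarrow> 0 \<le> energy h h"
  unfolding energy_def pot_def by (erule bddE) (rule cond_pos_def, auto)

section \<open>Gibbs densities and the uniqueness of fixed points\<close>

lemma gibbs_bound_pos: "0 < gibbs_bound"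
  using mass_pos by (simp add: gibbs_bound_def)

lemma density_bdd: "is_density p \<Longrightarrow> bdd p"
  by (auto simp: is_density_def intro!: bddI[of _ gibbs_bound])

lemma pot_nonneg: "is_density p \<Longrightarrow> x \<in> space M \<Longrightarrow> 0 \<le> pot p x"
  unfolding pot_def is_density_def using q_nonneg by (intro integral_nonneg_AE AE_I2) auto

lemma bdd_exp_pot:
  assumes "bdd p" shows "bdd (\<lambda>x. exp (- (a * pot p x)))"
proof -
  obtain C where "pot p \<in> borel_measurable M" "0 \<le> C" "\<And>x. x \<in> space M \<Longrightarrow> \<bar>pot p x\<bar> \<le> C"
    using bdd_pot[OF assms] by (metis bddE)
  note C = this
  note [measurable] = C(1)
  show ?thesis
  proof (rule bddI)
    show "(\<lambda>x. exp (- (a * pot p x))) \<in> borel_measurable M" by measurable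
    fix x assume "x \<in> space M"
    then have "- pot p x \<le> C" using C(3)[of x] by linarith
    then have "a * - pot p x \<le> a * C" using a_pos by (intro mult_left_mono) auto
    then show "\<bar>exp (- (a * pot p x))\<bar> \<le> exp (a * C)" by simp
  qed
qed

text \<open>Jensen's inequality for \<open>exp\<close>, carried out with the tangent line at
  \<open>- s\<close>, where \<open>s\<close> is \<open>a\<close> times the bound
  \<open>B / ?m\<close> for the mean of \<open>pot p\<close>.\<close>

lemma partition_fun_ge:
  assumes p: "is_density p"
  shows "measure M (space M) * exp (- a * B / measure M (space M)) \<le> partition_fun p"
proof -
  let ?m = "measure M (space M)"
  define s where "s = a * B / ?m"
  have sm: "s * ?m = a * B" using mass_pos by (simp add: s_def)
  note b = density_bdd[OF p]
  \<comment> \<open>Symmetry exchanges \<open>pot p\<close>, for which no bound independent of the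
    size of \<open>p\<close> is at hand, for \<open>pot 1 \<le> B\<close>; the density then enters
    only through its mass 1.\<close>
  have "(\<integral>x. pot p x \<partial>M) = energy (\<lambda>_. 1) p" by (simp add: energy_def)
  also have "\<dots> = energy p (\<lambda>_. 1)" by (rule energy_sym[OF bdd_const b])
  also have "\<dots> \<le> (\<integral>x. B * p x \<partial>M)"
    unfolding energy_def
  proof (rule integral_mono)
    show "integrable M (\<lambda>x. p x * pot (\<lambda>_. 1) x)"
      by (intro bdd_integrable bdd_mult b bdd_pot bdd_const)
    show "integrable M (\<lambda>x. B * p x)" by (intro bdd_integrable bdd_scale b)
    fix x assume "x \<in> space M"
    then show "p x * pot (\<lambda>_. 1) x \<le> B * p x"
      using q_bound p by (auto simp: pot_def is_density_def mult.commute[of B] intro!: mult_left_mono)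
  qed
  also have "\<dots> = B" using p by (simp add: is_density_def)
  finally have I: "(\<integral>x. pot p x \<partial>M) \<le> B" .
  have "?m * exp (- s) \<le> exp (- s) * (?m + s * ?m - a * (\<integral>x. pot p x \<partial>M))"
  proof -
    have "?m \<le> ?m + s * ?m - a * (\<integral>x. pot p x \<partial>M)" unfolding sm using I a_pos by simp
    then show ?thesis by (subst mult.commute) (rule mult_left_mono, auto)
  qed
  also have "\<dots> = (\<integral>x. exp (- s) * (1 + s - a * pot p x) \<partial>M)"
    using bdd_integrable[OF bdd_pot[OF b]] by (simp add: algebra_simps)
  also have "\<dots> \<le> partition_fun p"
    unfolding partition_fun_def
  proof (rule integral_mono)
    show "integrable M (\<lambda>x. exp (- s) * (1 + s - a * pot p x))"
      using bdd_integrable[OF bdd_pot[OF b]] by simp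
    show "integrable M (\<lambda>x. exp (- (a * pot p x)))" by (rule bdd_integrable[OF bdd_exp_pot[OF b]])
    fix x
    have "exp (- s) * (1 + (s - a * pot p x)) \<le> exp (- s) * exp (s - a * pot p x)"
      by (intro mult_left_mono exp_ge_add_one_self) auto
    then show "exp (- s) * (1 + s - a * pot p x) \<le> exp (- (a * pot p x))"
      by (simp add: exp_add[symmetric] algebra_simps)
  qed
  finally show ?thesis by (simp add: s_def)
qed

lemma partition_fun_pos:
  assumes "bdd p" shows "0 < partition_fun p"
proof -
  have "partition_fun p \<noteq> 0"
  proof
    assume "partition_fun p = 0"
    then have "AE x in M. exp (- (a * pot p x)) = 0"
      unfolding partition_fun_def
      by (subst (asm) integral_nonneg_eq_0_iff_AE) (auto intro!: bdd_integrable[OF bdd_exp_pot[OF assms]] simp del: minus_mult_right)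
    then have "AE x in M. False" by simp
    then show False using mass_pos by (auto simp: ae_filter_eq_bot_iff measure_def trivial_limit_def[symmetric])
  qed
  moreover have "0 \<le> partition_fun p" unfolding partition_fun_def by (intro integral_nonneg_AE) auto
  ultimately show ?thesis by simp
qed

lemma gibbs_pos: "bdd p \<Longrightarrow> 0 < gibbs p x"
  by (simp add: gibbs_def partition_fun_pos)

lemma bdd_gibbs: "bdd p \<Longrightarrow> bdd (gibbs p)"
  using bdd_scale[OF bdd_exp_pot, of p "1 / partition_fun p"] by (simp add: gibbs_def[abs_def])

lemma gibbs_integral: "bdd p \<Longrightarrow> (\<integral>x. gibbs p x \<partial>M) = 1"
  using partition_fun_pos[of p] unfolding gibbs_def by (simp add: partition_fun_def[of p])

lemma gibbs_density:
  assumes p: "is_density p" shows "is_density (gibbs p)"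
  unfolding is_density_def
proof (intro conjI ballI)
  note b = density_bdd[OF p]
  show "gibbs p \<in> borel_measurable M" using bdd_gibbs[OF b] by auto
  show "(\<integral>x. gibbs p x \<partial>M) = 1" by (rule gibbs_integral[OF b])
  fix x assume x: "x \<in> space M"
  show "0 \<le> gibbs p x" using gibbs_pos[OF b] by (rule less_imp_le)
  have "gibbs p x \<le> 1 / partition_fun p"
    unfolding gibbs_def using pot_nonneg[OF p x] a_pos partition_fun_pos[OF b]
    by (intro divide_right_mono) auto
  also have "\<dots> \<le> 1 / (measure M (space M) * exp (- a * B / measure M (space M)))"
    using partition_fun_ge[OF p] mass_pos partition_fun_pos[OF b] by (intro divide_left_mono) auto
  also have "\<dots> = gibbs_bound" by (simp add: gibbs_bound_def exp_minus field_simps)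
  finally show "gibbs p x \<le> gibbs_bound" .
qed

text \<open>Since \<open>ln \<circ> gibbs\<close> is \<open>-a \<cdot> pot\<close> up to a constant and \<open>ln\<close> is monotone, \<open>gibbs\<close> reverses the
  order induced by the energy form, with a quantitative gain in \<open>L\<^sup>2\<close>.\<close>

lemma gibbs_antimonotone:
  assumes p1: "bdd p1" and p2: "bdd p2"
    and C: "0 < C" "\<And>x. x \<in> space M \<Longrightarrow> gibbs p1 x \<le> C" "\<And>x. x \<in> space M \<Longrightarrow> gibbs p2 x \<le> C"
  shows "energy (\<lambda>x. p1 x - p2 x) (\<lambda>x. gibbs p1 x - gibbs p2 x) \<le>
    - (\<integral>x. (gibbs p1 x - gibbs p2 x)\<^sup>2 \<partial>M) / (a * C)"
proof -
  let ?H = "\<lambda>x. gibbs p1 x - gibbs p2 x"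
  \<comment> \<open>This constant cancels the normalizations in
    \<open>ln (gibbs p1) - ln (gibbs p2)\<close>. Adding \<open>c * ?H\<close> under the integral is
    free because \<open>?H\<close> has integral 0.\<close>
  define c where "c = (ln (partition_fun p1) - ln (partition_fun p2)) / a"
  have bh: "bdd (\<lambda>x. p1 x - p2 x)" and bH: "bdd ?H"
    using p1 p2 by (auto intro: bdd_diff bdd_gibbs)
  have H0: "(\<integral>x. ?H x \<partial>M) = 0"
    using p1 p2 gibbs_integral bdd_gibbs by (simp add: bdd_integrable)
  have "energy (\<lambda>x. p1 x - p2 x) ?H = energy ?H (\<lambda>x. p1 x - p2 x)"
    by (rule energy_sym[OF bh bH])
  also have "\<dots> = (\<integral>x. ?H x * pot (\<lambda>x. p1 x - p2 x) x + c * ?H x \<partial>M)"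
    unfolding energy_def using bh bH H0
    by (subst Bochner_Integration.integral_add)
       (auto intro!: bdd_integrable bdd_mult[OF bH bdd_pot[OF bh]] bdd_scale[OF bH])
  also have "\<dots> \<le> (\<integral>x. - 1 / (a * C) * (?H x)\<^sup>2 \<partial>M)"
  proof (rule integral_mono)
    show "integrable M (\<lambda>x. ?H x * pot (\<lambda>x. p1 x - p2 x) x + c * ?H x)"
      by (intro bdd_integrable bdd_add bdd_mult bdd_pot bdd_scale bh bH)
    show "integrable M (\<lambda>x. - 1 / (a * C) * (?H x)\<^sup>2)"
      unfolding power2_eq_square by (intro bdd_integrable bdd_mult bdd_scale bH)
    fix x assume x: "x \<in> space M"
    have g: "0 < gibbs p1 x" "0 < gibbs p2 x" using p1 p2 gibbs_pos by auto
    have l: "ln (gibbs p x) = - a * pot p x - ln (partition_fun p)" if "bdd p" for p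
      using partition_fun_pos[OF that] by (simp add: gibbs_def ln_div)
    have e: "pot (\<lambda>x. p1 x - p2 x) x + c = - (ln (gibbs p1 x) - ln (gibbs p2 x)) / a"
      using a_pos by (simp add: l p1 p2 pot_diff x c_def field_simps)
    have "(?H x)\<^sup>2 / C \<le> ?H x * (ln (gibbs p1 x) - ln (gibbs p2 x))"
      using diff_ln_diff_ge g C x by auto
    then have "(?H x)\<^sup>2 / C / a \<le> ?H x * (ln (gibbs p1 x) - ln (gibbs p2 x)) / a"
      using a_pos by (intro divide_right_mono) auto
    moreover have "?H x * pot (\<lambda>x. p1 x - p2 x) x + c * ?H x
        = - (?H x * (ln (gibbs p1 x) - ln (gibbs p2 x)) / a)"
    proof -
      have "?H x * pot (\<lambda>x. p1 x - p2 x) x + c * ?H x = ?H x * (pot (\<lambda>x. p1 x - p2 x) x + c)"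
        by (simp add: algebra_simps)
      also have "\<dots> = - (?H x * (ln (gibbs p1 x) - ln (gibbs p2 x)) / a)"
        unfolding e by (simp only: minus_divide_left mult_minus_right times_divide_eq_right)
      finally show ?thesis .
    qed
    moreover have "- 1 / (a * C) * (?H x)\<^sup>2 = - ((?H x)\<^sup>2 / C / a)"
      by (simp add: mult.commute)
    ultimately show "?H x * pot (\<lambda>x. p1 x - p2 x) x + c * ?H x \<le> - 1 / (a * C) * (?H x)\<^sup>2"
      by linarith
  qed
  finally show ?thesis by simp
qed

lemma pot_cong_AE:
  assumes "f \<in> borel_measurable M" "g \<in> borel_measurable M" "AE x in M. f x = g x" "x \<in> space M"
  shows "pot f x = pot g x"
  unfolding pot_def using assms by (intro integral_cong_AE) auto

text \<open>The difference has integral 0, hence nonnegative energy, while antimonotonicity makes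
  this energy at most a negative multiple of the squared L2 norm. Equality is thus almost
  everywhere, and then at every point because \<open>gibbs p\<close> depends on \<open>p\<close>
  only through integrals.\<close>

theorem gibbs_fixed_point_unique:
  assumes p1: "bdd p1" "\<And>x. x \<in> space M \<Longrightarrow> p1 x = gibbs p1 x"
    and p2: "bdd p2" "\<And>x. x \<in> space M \<Longrightarrow> p2 x = gibbs p2 x"
    and x: "x \<in> space M"
  shows "p1 x = p2 x"
proof -
  let ?h = "\<lambda>x. p1 x - p2 x"
  obtain C1 where C1: "\<And>x. x \<in> space M \<Longrightarrow> \<bar>p1 x\<bar> \<le> C1" "0 \<le> C1" using p1(1) by (metis bddE)
  obtain C2 where C2: "\<And>x. x \<in> space M \<Longrightarrow> \<bar>p2 x\<bar> \<le> C2" "0 \<le> C2" using p2(1) by (metis bddE)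
  define C where "C = C1 + C2 + 1"
  have C: "0 < C" using C1 C2 by (simp add: C_def)
  have bh: "bdd ?h" using p1 p2 by (intro bdd_diff)
  have i: "(\<integral>x. p1 x \<partial>M) = 1" "(\<integral>x. p2 x \<partial>M) = 1"
    using gibbs_integral[OF p1(1)] gibbs_integral[OF p2(1)] p1 p2
    by (simp_all cong: Bochner_Integration.integral_cong)
  have "0 \<le> energy ?h ?h"
    using i p1(1) p2(1) by (intro energy_nonneg bh) (simp add: bdd_integrable)
  also have "energy ?h ?h = energy ?h (\<lambda>x. gibbs p1 x - gibbs p2 x)"
    unfolding energy_def pot_def using p1 p2 by (auto cong: Bochner_Integration.integral_cong)
  also have "\<dots> \<le> - (\<integral>x. (gibbs p1 x - gibbs p2 x)\<^sup>2 \<partial>M) / (a * C)"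
  proof (rule gibbs_antimonotone[OF p1(1) p2(1) C])
    show "gibbs p1 x \<le> C" if "x \<in> space M" for x
      using C1(1)[OF that] C2(2) p1(2)[OF that] unfolding C_def by linarith
    show "gibbs p2 x \<le> C" if "x \<in> space M" for x
      using C2(1)[OF that] C1(2) p2(2)[OF that] unfolding C_def by linarith
  qed
  also have "(\<integral>x. (gibbs p1 x - gibbs p2 x)\<^sup>2 \<partial>M) = (\<integral>x. (?h x)\<^sup>2 \<partial>M)"
    using p1 p2 by (auto cong: Bochner_Integration.integral_cong)
  finally have "(\<integral>x. (?h x)\<^sup>2 \<partial>M) \<le> 0" using mult_pos_pos[OF C a_pos] by (simp add: divide_le_0_iff field_simps)
  moreover have "0 \<le> (\<integral>x. (?h x)\<^sup>2 \<partial>M)" by (intro integral_nonneg_AE) auto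
  ultimately have "(\<integral>x. (?h x)\<^sup>2 \<partial>M) = 0" by simp
  moreover have "integrable M (\<lambda>x. (?h x)\<^sup>2)"
    unfolding power2_eq_square by (intro bdd_integrable bdd_mult bh)
  ultimately have ae: "AE x in M. p1 x = p2 x"
    by (subst (asm) integral_nonneg_eq_0_iff_AE) auto
  have pe: "pot p1 y = pot p2 y" if "y \<in> space M" for y
    by (rule pot_cong_AE) (use p1 p2 ae that in auto)
  then have "partition_fun p1 = partition_fun p2"
    unfolding partition_fun_def by (auto cong: Bochner_Integration.integral_cong)
  then show ?thesis using p1(2)[OF x] p2(2)[OF x] pe[OF x] by (simp add: gibbs_def)
qed


text \<open>Expand the square. The cross term is at most \<open>- t I / (a C)\<close> by
  antimonotonicity and \<open>t \<le> 1/2\<close>; the last term is at most \<open>t^2 B I\<close>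
  by the Schur test, which the third condition on \<open>t\<close> turns into half of that gain. The
  other half remains.\<close>

lemma energy_relaxation:
  assumes p1: "is_density p1" and p2: "is_density p2"
    and t: "0 < t" "t \<le> 1 / 2" "t \<le> 1 / (2 * a * gibbs_bound * B)"
  shows "energy (\<lambda>x. (1 - t) * (p1 x - p2 x) + t * (gibbs p1 x - gibbs p2 x))
      (\<lambda>x. (1 - t) * (p1 x - p2 x) + t * (gibbs p1 x - gibbs p2 x))
    \<le> (1 - t)\<^sup>2 * energy (\<lambda>x. p1 x - p2 x) (\<lambda>x. p1 x - p2 x)
      - t / (2 * a * gibbs_bound) * (\<integral>x. (gibbs p1 x - gibbs p2 x)\<^sup>2 \<partial>M)"
proof -
  let ?C = gibbs_bound
  let ?h = "\<lambda>x. p1 x - p2 x" and ?H = "\<lambda>x. gibbs p1 x - gibbs p2 x"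
  define I where "I = (\<integral>x. (?H x)\<^sup>2 \<partial>M)"
  have I: "0 \<le> I" unfolding I_def by (intro integral_nonneg_AE) auto
  note C = gibbs_bound_pos
  have b: "bdd p1" "bdd p2" using p1 p2 density_bdd by auto
  have bh: "bdd ?h" and bH: "bdd ?H" using b by (auto intro: bdd_diff bdd_gibbs)
  have "energy ?h ?H \<le> - I / (a * ?C)"
    unfolding I_def using gibbs_density[OF p1] gibbs_density[OF p2]
    by (intro gibbs_antimonotone b C) (auto simp: is_density_def)
  then have "2 * (1 - t) * t * energy ?h ?H \<le> 2 * (1 - t) * t * (- I / (a * ?C))"
    using t by (intro mult_left_mono) auto
  also have "\<dots> = (- t * I / (a * ?C)) * (2 * (1 - t))" by (simp add: mult_ac)
  also have "\<dots> \<le> (- t * I / (a * ?C)) * 1"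
    using t I a_pos C by (intro mult_left_mono_neg) (auto simp: field_simps)
  finally have 1: "2 * (1 - t) * t * energy ?h ?H \<le> - t * I / (a * ?C)" by simp
  have "t\<^sup>2 * energy ?H ?H \<le> t\<^sup>2 * (B * I)"
    unfolding I_def using energy_schur[OF bH] by (intro mult_left_mono) auto
  also have "\<dots> = (t * B * I) * t" by (simp add: power2_eq_square)
  also have "\<dots> \<le> (t * B * I) * (1 / (2 * a * ?C * B))"
    using t I B_pos by (intro mult_left_mono) auto
  also have "\<dots> = t * I / (2 * a * ?C)" using B_pos by simp
  finally have 2: "t\<^sup>2 * energy ?H ?H \<le> t * I / (2 * a * ?C)" .
  have 3: "- t * I / (a * ?C) + t * I / (2 * a * ?C) = - (t / (2 * a * ?C) * I)"
    using a_pos C by (simp add: field_simps)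
  show ?thesis
    unfolding energy_comb[OF bh bH, of "1 - t" t] I_def[symmetric] using 1 2 3 by linarith
qed

lemma pot_tendsto:
  assumes P: "\<And>k. P k \<in> borel_measurable M" "\<And>k x. x \<in> space M \<Longrightarrow> \<bar>P k x\<bar> \<le> C"
    and f: "f \<in> borel_measurable M"
    and lim: "AE x in M. (\<lambda>k. P k x) \<longlonglongrightarrow> f x" and x: "x \<in> space M"
  shows "(\<lambda>k. pot (P k) x) \<longlonglongrightarrow> pot f x"
  unfolding pot_def
proof (rule integral_dominated_convergence)
  show "integrable M (\<lambda>y. C * q x y)" using q_integrable[OF x] by auto
  show "AE y in M. norm (q x y * P k y) \<le> C * q x y" for k
    using P(2) q_nonneg[OF x]
    by (intro AE_I2) (auto simp: abs_mult mult.commute[of C] intro!: mult_left_mono)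
  show "AE y in M. (\<lambda>k. q x y * P k y) \<longlonglongrightarrow> q x y * f y"
    using lim by eventually_elim (intro tendsto_intros)
qed (use P(1) f x in measurable)

text \<open>The increments \<open>h k\<close> of the relaxed iteration have energies decaying like
  \<open>r^(2k)\<close>, and the surplus term of \<open>energy_relaxation\<close> makes the squared
  L2 norms of the increments \<open>H k\<close> of the Gibbs densities decay at the same rate. From
  this \<open>h k\<close> is summable in L1, so the iterates converge almost everywhere, and the
  uniform bound on densities permits passing to the limit in potentials and partition
  functions.\<close>

theorem gibbs_fixed_point_exists:
  obtains p where "bdd p" "\<And>x. x \<in> space M \<Longrightarrow> p x = gibbs p x"
proof -
  let ?C = gibbs_bound and ?m = "measure M (space M)"
  note C = gibbs_bound_pos
  define t where "t = min (1 / 2) (1 / (2 * a * ?C * B))"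
  have t: "0 < t" "t \<le> 1 / 2" "t \<le> 1 / (2 * a * ?C * B)"
    using a_pos B_pos C by (auto simp: t_def)
  define r where "r = 1 - t"
  have r: "0 < r" "r < 1" using t by (auto simp: r_def)
  define P where "P k = ((\<lambda>p x. r * p x + t * gibbs p x) ^^ k) (\<lambda>_. 1 / ?m)" for k
  have P_Suc: "P (Suc k) x = r * P k x + t * gibbs (P k) x" for k x by (simp add: P_def)
  have P: "is_density (P k)" for k
  proof (induction k)
    case 0
    have "1 \<le> exp (a * B / ?m)" using a_pos B_pos mass_pos by simp
    then show ?case using mass_pos
      by (auto simp: P_def is_density_def gibbs_bound_def intro!: divide_right_mono)
  next
    case (Suc k)
    note g = gibbs_density[OF Suc]
    note [measurable] = bdd_measurable[OF density_bdd[OF Suc]] bdd_measurable[OF density_bdd[OF g]]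
    have "r * P k x + t * gibbs (P k) x \<le> ?C" if "x \<in> space M" for x
    proof -
      have "r * P k x + t * gibbs (P k) x \<le> r * ?C + t * ?C"
        using Suc g that r t by (intro add_mono mult_left_mono) (auto simp: is_density_def)
      then show ?thesis by (simp add: r_def algebra_simps)
    qed
    moreover have "(\<integral>x. r * P k x + t * gibbs (P k) x \<partial>M) = 1"
    proof -
      have "(\<integral>x. r * P k x + t * gibbs (P k) x \<partial>M) = r * (\<integral>x. P k x \<partial>M) + t * (\<integral>x. gibbs (P k) x \<partial>M)"
        using bdd_integrable[OF density_bdd[OF Suc]] bdd_integrable[OF density_bdd[OF g]] by simp
      then show ?thesis using Suc g by (simp add: is_density_def r_def)
    qed
    moreover have "P (Suc k) = (\<lambda>x. r * P k x + t * gibbs (P k) x)" by (simp add: P_Suc fun_eq_iff)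
    ultimately show ?case
      using Suc g r t unfolding is_density_def by (auto intro!: add_nonneg_nonneg mult_nonneg_nonneg)
  qed
  note bP = density_bdd[OF P]
  define h where "h k x = P (Suc k) x - P k x" for k x
  define H where "H k x = gibbs (P (Suc k)) x - gibbs (P k) x" for k x
  have bh: "bdd (h k)" and bH: "bdd (H k)" for k
    unfolding h_def[abs_def] H_def[abs_def] by (intro bdd_diff bdd_gibbs bP)+
  have h_Suc: "h (Suc k) x = r * h k x + t * H k x" for k x
    by (simp add: h_def H_def P_Suc[of "Suc k"] P_Suc[of k] algebra_simps)
  define E where "E k = energy (h k) (h k)" for k
  define I where "I k = (\<integral>x. (H k x)\<^sup>2 \<partial>M)" for k
  define c where "c = t / (2 * a * ?C)"
  have c: "0 < c" using t a_pos C by (simp add: c_def)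
  have I: "0 \<le> I k" for k unfolding I_def by (intro integral_nonneg_AE) auto
  have E: "0 \<le> E k" for k
    unfolding E_def
  proof (rule energy_nonneg[OF bh])
    have "(\<integral>x. h k x \<partial>M) = (\<integral>x. P (Suc k) x \<partial>M) - (\<integral>x. P k x \<partial>M)"
      unfolding h_def using bdd_integrable[OF bP] by simp
    then show "(\<integral>x. h k x \<partial>M) = 0" using P by (simp add: is_density_def)
  qed
  have E_Suc: "E (Suc k) \<le> r\<^sup>2 * E k - c * I k" for k
    using energy_relaxation[OF P P t, of "Suc k" k]
    by (simp add: E_def h_Suc[abs_def] h_def[symmetric] H_def[symmetric] I_def c_def r_def)
  have E_le: "E k \<le> r ^ k * r ^ k * E 0" for k
  proof (induction k)
    case (Suc k)
    have "E (Suc k) \<le> r\<^sup>2 * E k" using E_Suc[of k] c I[of k] by (smt (verit) mult_nonneg_nonneg)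
    also have "\<dots> \<le> r\<^sup>2 * (r ^ k * r ^ k * E 0)" using Suc by (intro mult_left_mono) auto
    finally show ?case by (simp add: power2_eq_square mult_ac)
  qed simp
  \<comment> \<open>From the weighted inequality \<open>|H| \<le> (H^2 / r^k + r^k) / 2\<close>: the
    weight \<open>r^k\<close> balances both terms, as the integral of \<open>H^2\<close> is of order
    \<open>r^(2k)\<close>.\<close>
  define D where "D = (E 0 / c + ?m) / 2"
  have H_le: "(\<integral>x. \<bar>H k x\<bar> \<partial>M) \<le> D * r ^ k" for k
  proof -
    have rk: "0 < r ^ k" using r by simp
    have "c * I k \<le> r\<^sup>2 * E k" using E_Suc[of k] E[of "Suc k"] by simp
    also have "\<dots> \<le> 1 * E k" using r E by (intro mult_right_mono) (auto simp: power_le_one_iff)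
    finally have "I k \<le> r ^ k * r ^ k * E 0 / c" using c E_le[of k] by (simp add: field_simps)
    then have i: "I k / r ^ k \<le> r ^ k * (E 0 / c)" using rk by (simp add: field_simps)
    have "(\<integral>x. \<bar>H k x\<bar> \<partial>M) \<le> (\<integral>x. (H k x * H k x / r ^ k + r ^ k) / 2 \<partial>M)"
    proof (rule integral_mono)
      show "integrable M (\<lambda>x. \<bar>H k x\<bar>)" using bdd_integrable[OF bH] by (rule integrable_abs)
      show "integrable M (\<lambda>x. (H k x * H k x / r ^ k + r ^ k) / 2)"
        using bdd_integrable[OF bdd_mult[OF bH[of k] bH[of k]]] by auto
      fix x
      have "0 \<le> (\<bar>H k x\<bar> - r ^ k)\<^sup>2 / r ^ k" using rk by simp
      also have "\<dots> = H k x * H k x / r ^ k + r ^ k - 2 * \<bar>H k x\<bar>"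
        using r by (subst power2_diff) (simp add: add_divide_distrib diff_divide_distrib power2_eq_square)
      finally show "\<bar>H k x\<bar> \<le> (H k x * H k x / r ^ k + r ^ k) / 2" by simp
    qed
    also have "\<dots> = (I k / r ^ k + r ^ k * ?m) / 2"
      using bdd_integrable[OF bdd_mult[OF bH[of k] bH[of k]]] by (simp add: I_def power2_eq_square mult.commute)
    also have "\<dots> \<le> (r ^ k * (E 0 / c) + r ^ k * ?m) / 2"
      using i by (intro divide_right_mono add_right_mono) auto
    also have "\<dots> = D * r ^ k" by (simp add: D_def algebra_simps)
    finally show ?thesis .
  qed
  define N where "N k = (\<integral>x. \<bar>h k x\<bar> \<partial>M)" for k
  have N_nonneg: "0 \<le> N k" for k unfolding N_def by (intro integral_nonneg_AE) auto
  have N_Suc: "N (Suc k) \<le> r * N k + t * D * r ^ k" for k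
  proof -
    have "N (Suc k) \<le> (\<integral>x. r * \<bar>h k x\<bar> + t * \<bar>H k x\<bar> \<partial>M)"
      unfolding N_def
    proof (rule integral_mono)
      show "integrable M (\<lambda>x. \<bar>h (Suc k) x\<bar>)" using bdd_integrable[OF bh] by (rule integrable_abs)
      show "integrable M (\<lambda>x. r * \<bar>h k x\<bar> + t * \<bar>H k x\<bar>)"
        using bdd_integrable[OF bh[of k]] bdd_integrable[OF bH[of k]] by auto
      show "\<bar>h (Suc k) x\<bar> \<le> r * \<bar>h k x\<bar> + t * \<bar>H k x\<bar>" for x
        unfolding h_Suc using abs_triangle_ineq[of "r * h k x" "t * H k x"] r t by (simp add: abs_mult)
    qed
    also have "\<dots> = r * N k + t * (\<integral>x. \<bar>H k x\<bar> \<partial>M)"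
      using bdd_integrable[OF bh[of k]] bdd_integrable[OF bH[of k]] by (simp add: N_def)
    also have "\<dots> \<le> r * N k + t * (D * r ^ k)"
      using H_le[of k] t by (intro add_left_mono mult_left_mono) auto
    finally show ?thesis by simp
  qed
  have "summable N"
  proof (rule summableI_nonneg_bounded)
    show "0 \<le> N k" for k by (rule N_nonneg)
    have g: "summable (\<lambda>k. t * D * r ^ k)" using r by (intro summable_mult summable_geometric) auto
    have D: "0 \<le> t * D * r ^ k" for k using t E[of 0] c r by (simp add: D_def)
    fix n
    \<comment> \<open>The recursion bounds the partial sum up to \<open>n\<close> by a constant plus
      \<open>r\<close> times the preceding partial sum. With \<open>r = 1 - t\<close> that sum is
      absorbed on the left, leaving the factor \<open>t\<close>.\<close>
    have "(\<Sum>k<Suc n. N k) = N 0 + (\<Sum>k<n. N (Suc k))" by (rule sum.lessThan_Suc_shift)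
    also have "\<dots> \<le> N 0 + (\<Sum>k<n. r * N k + t * D * r ^ k)"
      by (intro add_left_mono sum_mono N_Suc)
    also have "\<dots> \<le> N 0 + r * (\<Sum>k<n. N k) + (\<Sum>k. t * D * r ^ k)"
      using sum_le_suminf[OF g, of "{..<n}"] D by (simp add: sum.distrib sum_distrib_left)
    finally have "t * (\<Sum>k<n. N k) \<le> N 0 + (\<Sum>k. t * D * r ^ k)"
      using N_nonneg[of n] by (simp add: r_def algebra_simps)
    then show "(\<Sum>k<n. N k) \<le> (N 0 + (\<Sum>k. t * D * r ^ k)) / t"
      using t by (simp add: field_simps)
  qed
  note [measurable] = bdd_measurable[OF bP] bdd_measurable[OF bh]
  have "(\<integral>\<^sup>+x. (\<Sum>k. ennreal \<bar>h k x\<bar>) \<partial>M) = (\<Sum>k. \<integral>\<^sup>+x. ennreal \<bar>h k x\<bar> \<partial>M)"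
    by (rule nn_integral_suminf) measurable
  also have "\<dots> = (\<Sum>k. ennreal (N k))"
    unfolding N_def using bdd_integrable[OF bh] by (simp add: nn_integral_eq_integral)
  also have "\<dots> \<noteq> \<infinity>" using \<open>summable N\<close> N_nonneg by (simp add: suminf_ennreal2)
  finally have "AE x in M. (\<Sum>k. ennreal \<bar>h k x\<bar>) \<noteq> \<infinity>"
    by (intro nn_integral_PInf_AE) measurable
  then have conv: "AE x in M. convergent (\<lambda>k. P k x)"
  proof eventually_elim
    fix x assume "(\<Sum>k. ennreal \<bar>h k x\<bar>) \<noteq> \<infinity>"
    then have "summable (\<lambda>k. \<bar>h k x\<bar>)" by (intro summable_suminf_not_top) auto
    then have "summable (\<lambda>k. h k x)" by (rule summable_rabs_cancel)
    then have "convergent (\<lambda>n. \<Sum>k<n. h k x)" by (simp add: summable_iff_convergent)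
    then have "convergent (\<lambda>n. P 0 x + (\<Sum>k<n. h k x))" by (intro convergent_add convergent_const)
    moreover have "P 0 x + (\<Sum>k<n. h k x) = P n x" for n
      unfolding h_def by (subst sum_lessThan_telescope) simp
    ultimately show "convergent (\<lambda>k. P k x)" by simp
  qed
  \<comment> \<open>Where the iterates diverge, \<open>lim\<close> has no controlled value.
    Truncation makes \<open>f\<close> bounded everywhere and leaves the limit unchanged where it
    exists.\<close>
  define f where "f x = max 0 (min ?C (lim (\<lambda>k. P k x)))" for x
  have fm[measurable]: "f \<in> borel_measurable M" unfolding f_def[abs_def] by measurable
  have bf: "bdd f" using C by (intro bddI[of _ ?C]) (auto simp: f_def)
  have Plim: "AE x in M. (\<lambda>k. P k x) \<longlonglongrightarrow> f x"
    using conv AE_space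
  proof eventually_elim
    fix x assume x: "convergent (\<lambda>k. P k x)" "x \<in> space M"
    then have l: "(\<lambda>k. P k x) \<longlonglongrightarrow> lim (\<lambda>k. P k x)" by (simp add: convergent_LIMSEQ_iff)
    have "0 \<le> lim (\<lambda>k. P k x)" "lim (\<lambda>k. P k x) \<le> ?C"
      using P x(2) by (auto intro!: LIMSEQ_le_const[OF l] LIMSEQ_le_const2[OF l] simp: is_density_def)
    then show "(\<lambda>k. P k x) \<longlonglongrightarrow> f x" using l by (simp add: f_def)
  qed
  have pot_lim: "(\<lambda>k. pot (P k) x) \<longlonglongrightarrow> pot f x" if "x \<in> space M" for x
    by (rule pot_tendsto[where C = ?C]) (use P that Plim in \<open>auto simp: is_density_def\<close>)
  have Z_lim: "(\<lambda>k. partition_fun (P k)) \<longlonglongrightarrow> partition_fun f"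
    unfolding partition_fun_def
  proof (rule integral_dominated_convergence)
    show "integrable M (\<lambda>_. 1 :: real)" by simp
    show "AE x in M. norm (exp (- (a * pot (P k) x))) \<le> 1" for k
      using pot_nonneg[OF P] a_pos by (intro AE_I2) auto
    show "AE x in M. (\<lambda>k. exp (- (a * pot (P k) x))) \<longlonglongrightarrow> exp (- (a * pot f x))"
      by (intro AE_I2 tendsto_intros pot_lim)
  qed (use bdd_exp_pot[OF bP] bdd_exp_pot[OF bf] in auto)
  have gibbs_lim: "(\<lambda>k. gibbs (P k) x) \<longlonglongrightarrow> gibbs f x" if "x \<in> space M" for x
    unfolding gibbs_def using partition_fun_pos[OF bf]
    by (intro tendsto_intros pot_lim that Z_lim) auto
  have ff: "AE x in M. f x = gibbs f x"
    using Plim AE_space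
  proof eventually_elim
    fix x assume x: "(\<lambda>k. P k x) \<longlonglongrightarrow> f x" "x \<in> space M"
    have "(\<lambda>k. P (Suc k) x) \<longlonglongrightarrow> r * f x + t * gibbs f x"
      unfolding P_Suc using x by (intro tendsto_intros gibbs_lim)
    then have "f x = r * f x + t * gibbs f x"
      using LIMSEQ_Suc[OF x(1)] LIMSEQ_unique by blast
    then have "t * f x = t * gibbs f x" by (simp add: r_def algebra_simps)
    then show "f x = gibbs f x" using t by simp
  qed
  \<comment> \<open>So far \<open>f\<close> solves the equation only almost everywhere. Applying
    \<open>gibbs\<close> once more gives a function that solves it at every point, since potentials
    ignore null sets.\<close>
  have bg: "bdd (gibbs f)" by (rule bdd_gibbs[OF bf])
  have pe: "pot (gibbs f) x = pot f x" if "x \<in> space M" for x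
    by (rule pot_cong_AE) (use bg ff that in auto)
  then have "partition_fun (gibbs f) = partition_fun f"
    unfolding partition_fun_def by (auto cong: Bochner_Integration.integral_cong)
  then have "gibbs f x = gibbs (gibbs f) x" if "x \<in> space M" for x
    using pe[OF that] by (simp add: gibbs_def)
  then show thesis using that bg by blast
qed

end

section \<open>The logarithmic kernel with a radial weight\<close>

text \<open>On the diagonal \<open>ln 0 = 0\<close>, so the value there is finite instead of
  infinite; the diagonal is a null set for the measures in question.\<close>

definition log_kernel :: "'a::real_normed_vector \<Rightarrow> 'a \<Rightarrow> real" where
  "log_kernel x y = ln (1 + norm x) + ln (1 + norm y) - ln (norm (x - y))"

lemma log_kernel_nonneg: "0 \<le> log_kernel x y"
proof (cases "x = y")
  case False
  have "L \<le> A + B" if "\<bar>L\<bar> \<le> max 0 (- L) + A + B" "0 \<le> A" "0 \<le> B" for L A B :: real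
    using that by (auto simp: max_def split: if_splits)
  from this[OF abs_ln_norm_diff_le[of x y]] show ?thesis by (simp add: log_kernel_def)
qed (simp add: log_kernel_def)

lemma log_kernel_sym: "log_kernel x y = log_kernel y x"
  by (simp add: log_kernel_def norm_minus_commute)

lemma log_kernel_measurable[measurable (raw)]:
  fixes f g :: "'b \<Rightarrow> 'a::euclidean_space"
  assumes [measurable]: "f \<in> borel_measurable M" "g \<in> borel_measurable M"
  shows "(\<lambda>x. log_kernel (f x) (g x)) \<in> borel_measurable M"
  unfolding log_kernel_def by measurable

text \<open>The point of the bound is that its right-hand side does not depend on \<open>r\<close>.\<close>

lemma log_kernel_axis_le:
  fixes i j y :: "'a::euclidean_space"
  assumes ij: "i \<in> Basis" "j \<in> Basis" "i \<noteq> j" and r: "0 \<le> r" and y: "y \<bullet> j \<noteq> 0"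
  shows "log_kernel (r *\<^sub>R i) y \<le> 2 * ln (1 + norm y) - ln \<bar>y \<bullet> j\<bar>"
proof -
  let ?x = "r *\<^sub>R i"
  have y0: "0 < norm y" using y by auto
  have "(?x - y) \<bullet> j = - (y \<bullet> j)" using ij by (simp add: inner_diff_left inner_Basis)
  then have d1: "\<bar>y \<bullet> j\<bar> \<le> norm (?x - y)" using Basis_le_norm[OF ij(2), of "?x - y"] by simp
  have d: "0 < norm (?x - y)" using d1 y by linarith
  have "(y \<bullet> i)\<^sup>2 + (y \<bullet> j)\<^sup>2 = (\<Sum>b\<in>{i, j}. (y \<bullet> b)\<^sup>2)" using ij by simp
  also have "\<dots> \<le> (\<Sum>b\<in>Basis. (y \<bullet> b)\<^sup>2)" using ij by (intro sum_mono2) auto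
  also have "\<dots> = (norm y)\<^sup>2"
    unfolding power2_norm_eq_inner by (subst euclidean_inner[of y y]) (simp add: power2_eq_square)
  finally have s: "(y \<bullet> i)\<^sup>2 + (y \<bullet> j)\<^sup>2 \<le> (norm y)\<^sup>2" .
  have "(norm (?x - y))\<^sup>2 = r\<^sup>2 - 2 * r * (y \<bullet> i) + (norm y)\<^sup>2"
    unfolding power2_norm_eq_inner using ij
    by (simp add: inner_diff_left inner_diff_right inner_commute[of i y] power2_eq_square algebra_simps)
  \<comment> \<open>Lagrange's identity: \<open>?x - y\<close> and \<open>y\<close> span a
    parallelogram of the same area as \<open>?x\<close> and \<open>y\<close>, and that area is at
    least \<open>r * |y \<bullet> j|\<close>. Added to \<open>d1\<close>, this produces the factor
    \<open>1 + r\<close> which cancels \<open>ln (1 + |x|)\<close> in the kernel.\<close>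
  then have "(norm (?x - y) * norm y)\<^sup>2 = (r\<^sup>2 - 2 * r * (y \<bullet> i) + (norm y)\<^sup>2) * (norm y)\<^sup>2"
    by (simp add: power_mult_distrib)
  also have "\<dots> = r\<^sup>2 * ((norm y)\<^sup>2 - (y \<bullet> i)\<^sup>2) + ((norm y)\<^sup>2 - r * (y \<bullet> i))\<^sup>2"
    by (simp add: power2_eq_square algebra_simps)
  also have "\<dots> \<ge> r\<^sup>2 * (y \<bullet> j)\<^sup>2"
    using s mult_left_mono[of "(y \<bullet> j)\<^sup>2" "(norm y)\<^sup>2 - (y \<bullet> i)\<^sup>2" "r\<^sup>2"]
    by (intro add_increasing2) auto
  finally have "(r * \<bar>y \<bullet> j\<bar>)\<^sup>2 \<le> (norm (?x - y) * norm y)\<^sup>2" by (simp add: power_mult_distrib)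
  then have d2: "r * \<bar>y \<bullet> j\<bar> \<le> norm (?x - y) * norm y" by (rule power2_le_imp_le) auto
  have "(1 + r) * \<bar>y \<bullet> j\<bar> \<le> norm (?x - y) * (1 + norm y)"
    using d1 d2 by (simp add: algebra_simps)
  then have "ln ((1 + r) * \<bar>y \<bullet> j\<bar>) \<le> ln (norm (?x - y) * (1 + norm y))"
    using r y by (intro ln_mono) (auto intro!: mult_pos_pos)
  moreover have "ln ((1 + r) * \<bar>y \<bullet> j\<bar>) = ln (1 + r) + ln \<bar>y \<bullet> j\<bar>"
    using r y by (intro ln_mult_pos) auto
  moreover have "ln (norm (?x - y) * (1 + norm y)) = ln (norm (?x - y)) + ln (1 + norm y)"
    using d y0 by (intro ln_mult_pos) (auto simp: add_pos_pos)
  moreover have "norm ?x = r" using ij r by simp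
  ultimately show ?thesis by (simp add: log_kernel_def)
qed

text \<open>\<open>g\<close> stands for \<open>|K| (1 + |x|)^a\<close> and may be unbounded. Points
  are rotated to the axis \<open>i\<close>, and the component along \<open>j\<close> bounds the
  distance to that axis from below.\<close>

locale radial_weight =
  fixes g :: "real ^ 'm \<Rightarrow> real" and i j :: "real ^ 'm" and a :: real
  assumes g_cont: "continuous_on UNIV g" and g_nonneg: "\<And>x. 0 \<le> g x" and g_radial: "radial g"
    and g_nonzero: "\<exists>x. g x \<noteq> 0"
    and g_integrable: "integrable lborel g"
    and g_log_integrable: "integrable lborel (\<lambda>x. ln (1 + norm x) * g x)"
    and ij: "i \<in> Basis" "j \<in> Basis" "i \<noteq> j" and a_pos: "0 < a"
begin

section \<open>The weighted measure and the integrable bound for the kernel\<close>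

lemma g_measurable[measurable]: "g \<in> borel_measurable borel"
  using g_cont by (rule borel_measurable_continuous_onI)

definition W :: "(real ^ 'm) measure" where "W = density lborel (\<lambda>x. ennreal (g x))"

lemma sets_W[measurable_cong, simp]: "sets W = sets borel" and space_W[simp]: "space W = UNIV"
  by (simp_all add: W_def)

lemma W_integrable: "f \<in> borel_measurable borel \<Longrightarrow> integrable W f \<longleftrightarrow> integrable lborel (\<lambda>x. g x * f x)"
  unfolding W_def by (subst integrable_density) (auto simp: g_nonneg)

lemma W_integral: "f \<in> borel_measurable borel \<Longrightarrow> (\<integral>x. f x \<partial>W) = (\<integral>x. g x * f x \<partial>lborel)"
  unfolding W_def by (subst integral_density) (auto simp: g_nonneg)

lemma W_AE: "AE x in lborel. P x \<Longrightarrow> AE x in W. P x"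
  unfolding W_def by (subst AE_density) auto

lemma W_finite: "emeasure W (space W) < \<infinity>"
  unfolding W_def using g_integrable g_nonneg
  by (subst emeasure_density) (auto simp: nn_integral_eq_integral)

sublocale W: finite_measure W
  by (rule finite_measureI) (use W_finite in auto)

lemma W_measure_pos: "0 < measure W (space W)"
proof -
  have "emeasure W (space W) \<noteq> 0"
  proof
    assume "emeasure W (space W) = 0"
    then have "AE x in lborel. g x = 0"
      unfolding W_def using g_nonneg
      by (subst (asm) emeasure_density) (auto simp: nn_integral_0_iff_AE order.antisym)
    then have null: "{x. g x \<noteq> 0} \<in> null_sets lborel"
      by (subst (asm) AE_iff_null) auto
    obtain x where x: "g x \<noteq> 0" using g_nonzero by blast
    have "open {x. g x \<noteq> 0}" using g_cont by (intro open_Collect_neq continuous_intros)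
    then obtain e where e: "0 < e" "ball x e \<subseteq> {x. g x \<noteq> 0}" using x by (auto simp: open_contains_ball)
    have "ball x e \<in> null_sets lborel" by (rule null_sets_subset[OF null _ e(2)]) auto
    then have "measure lborel (ball x e) = 0" by (simp add: measure_def null_sets_def)
    then show False using content_ball_pos[OF e(1), of x] by simp
  qed
  then show ?thesis using W.emeasure_eq_measure[of "space W"] by (simp add: less_le)
qed

lemma ln_W_integrable: "integrable W (\<lambda>y. ln (1 + norm y))"
  by (subst W_integrable) (use g_log_integrable in \<open>auto simp: mult.commute\<close>)

definition dom :: "real ^ 'm \<Rightarrow> real" where
  "dom y = 2 * ln (1 + norm y) + max 0 (- ln \<bar>y \<bullet> j\<bar>)"

lemma dom_measurable[measurable]: "dom \<in> borel_measurable borel"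
  unfolding dom_def[abs_def] by measurable

lemma dom_nonneg: "0 \<le> dom y"
  by (simp add: dom_def)

text \<open>Boundedness of \<open>g\<close> is available only on the unit ball. Outside,
  \<open>- ln |y \<bullet> j| \<le> ln (|y| / |y \<bullet> j|)\<close>, which is homogeneous of
  degree 0; against a radial weight such a function acts as a constant factor, so integrability of
  \<open>g\<close> suffices.\<close>

lemma log_slab_W_integrable: "integrable W (\<lambda>y. max 0 (- ln \<bar>y \<bullet> j\<bar>))"
proof -
  have cb[measurable]: "cball 0 1 \<in> sets (borel :: (real ^ 'm) measure)" by (simp add: borel_closed)
  obtain D where D: "0 < D" "\<And>x. x \<in> cball 0 1 \<Longrightarrow> g x \<le> D"
  proof -
    have "compact (g ` cball 0 1)"
      using g_cont by (intro compact_continuous_image continuous_on_subset[OF g_cont]) auto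
    then obtain D where D: "0 < D" "\<forall>y\<in>g ` cball 0 1. norm y \<le> D"
      using compact_imp_bounded bounded_pos by metis
    then show thesis using that[of D] by (auto simp: abs_le_iff)
  qed
  let ?s = "\<lambda>y. max 0 (- ln \<bar>y \<bullet> j\<bar>)"
  define k where "k y = ennreal (if y \<bullet> j = 0 then 0 else ln (norm y / \<bar>y \<bullet> j\<bar>))" for y
  have km[measurable]: "k \<in> borel_measurable borel" unfolding k_def[abs_def] by measurable
  have hom: "k (c *\<^sub>R y) = k y" if "0 < c" for c y using that by (simp add: k_def abs_mult)
  have fin: "(\<integral>\<^sup>+y. k y * indicator (cball 0 1) y \<partial>lborel) < \<infinity>"
  proof -
    have "(\<integral>\<^sup>+y. k y * indicator (cball 0 1) y \<partial>lborel) \<le>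
      (\<integral>\<^sup>+y. ennreal (?s y) * indicator (cball 0 1) y \<partial>lborel)"
    proof (intro nn_integral_mono)
      fix y
      show "k y * indicator (cball 0 1) y \<le> ennreal (?s y) * indicator (cball 0 1) y"
      proof (cases "y \<bullet> j = 0 \<or> 1 < norm y")
        case False
        then have n: "0 < norm y" by auto
        then have l: "ln (norm y) \<le> 0" using False by simp
        from n l have "ln (norm y / \<bar>y \<bullet> j\<bar>) \<le> ?s y"
          using False by (simp add: ln_div max_def)
        then show ?thesis using False by (auto simp: k_def intro: ennreal_leI)
      qed (auto simp: k_def)
    qed
    also have "\<dots> < \<infinity>" by (rule log_slab_nn_integral_finite[OF ij(2)])
    finally show ?thesis .
  qed
  obtain C where C: "C < \<infinity>" "\<And>g. g \<in> borel_measurable borel \<Longrightarrow>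
      (\<integral>\<^sup>+y. k y * g (norm y) \<partial>lborel) = C * (\<integral>\<^sup>+y. g (norm y) \<partial>(lborel :: (real ^ 'm) measure))"
    using nn_integral_homogeneous_radial[OF km hom fin] by blast
  define G where "G r = ennreal (g (r *\<^sub>R i))" for r
  have G[measurable]: "G \<in> borel_measurable borel" unfolding G_def[abs_def] by measurable
  have gG: "G (norm y) = ennreal (g y)" for y
    unfolding G_def by (rule arg_cong[OF g_radial[unfolded radial_def, rule_format]]) (simp add: ij)
  have "(\<integral>\<^sup>+y. ennreal (norm (g y * ?s y)) \<partial>lborel) \<le>
    (\<integral>\<^sup>+y. ennreal D * (ennreal (?s y) * indicator (cball 0 1) y) + k y * G (norm y) \<partial>lborel)"
  proof (intro nn_integral_mono)
    fix y
    show "ennreal (norm (g y * ?s y)) \<le> ennreal D * (ennreal (?s y) * indicator (cball 0 1) y) + k y * G (norm y)"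
    proof (cases "norm y \<le> 1")
      case True
      then have "norm (g y * ?s y) \<le> D * ?s y"
        using D(2)[of y] g_nonneg[of y] by (auto simp: abs_mult intro!: mult_right_mono)
      then have "ennreal (norm (g y * ?s y)) \<le> ennreal (D * ?s y)" by (rule ennreal_leI)
      also have "\<dots> = ennreal D * (ennreal (?s y) * indicator (cball 0 1) y)"
        using D(1) True by (simp add: ennreal_mult')
      finally show ?thesis by (simp add: add_increasing2)
    next
      case False
      have "ennreal (?s y) \<le> k y"
      proof (cases "y \<bullet> j = 0")
        case False
        have "\<bar>y \<bullet> j\<bar> \<le> norm y" by (rule Basis_le_norm[OF ij(2)])
        then have "0 \<le> ln (norm y / \<bar>y \<bullet> j\<bar>)" using False by simp
        moreover have "ln (norm y / \<bar>y \<bullet> j\<bar>) = ln (norm y) - ln \<bar>y \<bullet> j\<bar>"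
          using False by (auto simp: ln_div)
        moreover have "0 \<le> ln (norm y)" using \<open>\<not> norm y \<le> 1\<close> by simp
        ultimately have "?s y \<le> ln (norm y / \<bar>y \<bullet> j\<bar>)" by (auto simp: max_def)
        then show ?thesis using False by (auto simp: k_def intro: ennreal_leI)
      qed simp
      then have "ennreal (?s y) * ennreal (g y) \<le> k y * G (norm y)"
        unfolding gG by (rule mult_right_mono) simp
      moreover have "ennreal (norm (g y * ?s y)) = ennreal (?s y) * ennreal (g y)"
        using g_nonneg[of y] by (simp add: abs_mult mult.commute[of "g y"] ennreal_mult')
      ultimately show ?thesis by (simp add: add_increasing)
    qed
  qed
  also have "\<dots> = ennreal D * (\<integral>\<^sup>+y. ennreal (?s y) * indicator (cball 0 1) y \<partial>lborel) + C * (\<integral>\<^sup>+y. ennreal (g y) \<partial>lborel)"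
  proof -
    have "(\<integral>\<^sup>+y. k y * ennreal (g y) \<partial>lborel) = C * (\<integral>\<^sup>+y. ennreal (g y) \<partial>lborel)"
      using C(2)[OF G] by (simp add: gG)
    then show ?thesis by (subst nn_integral_add) (simp_all add: nn_integral_cmult gG)
  qed
  also have "\<dots> < \<infinity>"
    using log_slab_nn_integral_finite[OF ij(2)] C(1) g_integrable g_nonneg
    by (auto simp: ennreal_mult_less_top nn_integral_eq_integral)
  finally have "integrable lborel (\<lambda>y. g y * ?s y)"
    by (intro integrableI_bounded) auto
  then show ?thesis by (subst W_integrable) auto
qed

lemma dom_integrable: "integrable W dom"
  unfolding dom_def[abs_def] using ln_W_integrable log_slab_W_integrable by auto

lemma log_kernel_le_dom:
  "0 \<le> r \<Longrightarrow> AE y in W. \<bar>log_kernel (r *\<^sub>R i) y\<bar> \<le> dom y"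
proof (rule W_AE)
  assume r: "0 \<le> r"
  show "AE y in lborel. \<bar>log_kernel (r *\<^sub>R i) y\<bar> \<le> dom y"
    using AE_lborel_inner_neq[OF ij(2), of 0]
  proof eventually_elim
    fix y assume "y \<bullet> j \<noteq> 0"
    from log_kernel_axis_le[OF ij r this] log_kernel_nonneg[of "r *\<^sub>R i" y]
    show "\<bar>log_kernel (r *\<^sub>R i) y\<bar> \<le> dom y" by (simp add: dom_def)
  qed
qed

section \<open>Rotation invariance, uniform bounds and positivity of the kernel\<close>

lemma orthogonal_measurable:
  fixes T :: "real ^ 'm \<Rightarrow> real ^ 'm"
  assumes "orthogonal_transformation T" shows "T \<in> borel_measurable borel"
proof -
  have "bounded_linear T"
    using orthogonal_transformation_linear[OF assms] by (simp only: linear_conv_bounded_linear)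
  then show ?thesis by (intro borel_measurable_continuous_onI linear_continuous_on)
qed

lemma W_orthogonal:
  assumes T: "orthogonal_transformation T" shows "distr W borel T = W"
proof -
  have [measurable]: "T \<in> borel_measurable borel" by (rule orthogonal_measurable[OF T])
  have "g (T x) = g x" for x
    by (rule g_radial[unfolded radial_def, rule_format, OF orthogonal_transformation_norm[OF T]])
  then have "distr W borel T = distr (density lborel (\<lambda>x. ennreal (g (T x)))) borel T"
    by (simp add: W_def)
  also have "\<dots> = density (distr lborel borel T) (\<lambda>x. ennreal (g x))"
    by (subst density_distr) simp_all
  finally show ?thesis by (simp add: lborel_distr_orthogonal[OF T] W_def)
qed

lemma log_kernel_orthogonal:
  assumes T: "orthogonal_transformation T" shows "log_kernel (T x) (T y) = log_kernel x y"
proof -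
  have "T x - T y = T (x - y)"
    by (simp add: linear_diff[OF orthogonal_transformation_linear[OF T]])
  then show ?thesis by (simp add: log_kernel_def orthogonal_transformation_norm[OF T])
qed

lemma to_axis:
  fixes x :: "real ^ 'm"
  obtains T where "orthogonal_transformation T" "T x = norm x *\<^sub>R i"
proof -
  have "norm x = norm (norm x *\<^sub>R i)" using ij by simp
  then obtain T where "orthogonal_transformation T" "T x = norm x *\<^sub>R i"
    by (rule orthogonal_transformation_exists)
  then show thesis by (rule that)
qed

text \<open>The measure and the kernel are both invariant under orthogonal maps, so \<open>x\<close>
  may be rotated onto the axis, where \<open>dom\<close> is a bound independent of the
  radius.\<close>

lemma kernel_integrable_bound:
  shows "integrable W (log_kernel x)" and "(\<integral>y. log_kernel x y \<partial>W) \<le> (\<integral>y. dom y \<partial>W)"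
proof -
  obtain T where T: "orthogonal_transformation T" "T x = norm x *\<^sub>R i" by (rule to_axis)
  have [measurable]: "T \<in> borel_measurable borel" by (rule orthogonal_measurable[OF T(1)])
  let ?z = "norm x *\<^sub>R i"
  have d: "AE y in W. \<bar>log_kernel ?z y\<bar> \<le> dom y" by (rule log_kernel_le_dom) simp
  have i: "integrable W (log_kernel ?z)"
    by (rule Bochner_Integration.integrable_bound[OF dom_integrable])
       (use d dom_nonneg in \<open>auto simp: abs_of_nonneg\<close>)
  have "log_kernel x = (\<lambda>y. log_kernel ?z (T y))"
    using log_kernel_orthogonal[OF T(1), of x] by (simp add: T(2) fun_eq_iff)
  note eq = this
  have "integrable (distr W borel T) (log_kernel ?z)" using i by (simp add: W_orthogonal[OF T(1)])
  then show "integrable W (log_kernel x)"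
    unfolding eq by (subst (asm) integrable_distr_eq) auto
  have "(\<integral>y. log_kernel x y \<partial>W) = (\<integral>y. log_kernel ?z y \<partial>distr W borel T)"
    unfolding eq by (rule integral_distr[symmetric]) auto
  also have "\<dots> = (\<integral>y. log_kernel ?z y \<partial>W)" by (simp add: W_orthogonal[OF T(1)])
  also have "\<dots> \<le> (\<integral>y. dom y \<partial>W)"
    by (rule integral_mono_AE[OF i dom_integrable]) (use d in auto)
  finally show "(\<integral>y. log_kernel x y \<partial>W) \<le> (\<integral>y. dom y \<partial>W)" .
qed

lemma log_W_integrable: "integrable W (\<lambda>y. ln (norm (x - y)))"
proof -
  have "integrable W (\<lambda>y. ln (1 + norm x) + ln (1 + norm y) - log_kernel x y)"
    using ln_W_integrable kernel_integrable_bound(1) by auto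
  then show ?thesis by (simp add: log_kernel_def)
qed

text \<open>\<open>ln |x - y|\<close> is the difference of the nonnegative functions
  \<open>ln (1 + |x|) + ln (1 + |y|)\<close> and \<open>log_kernel x y\<close>, so its absolute
  value is at most their sum; the integral of the latter in \<open>y\<close> is bounded uniformly in
  \<open>x\<close>.\<close>

lemma log_pair_integrable: "integrable (W \<Otimes>\<^sub>M W) (\<lambda>p. ln (norm (fst p - snd p)))"
proof -
  interpret pair_sigma_finite W W ..
  have "integrable (W \<Otimes>\<^sub>M W) (\<lambda>(x, y). ln (norm (x - y)))"
  proof (rule Fubini_integrable)
    show "AE x in W. integrable W (\<lambda>y. case (x, y) of (x, y) \<Rightarrow> ln (norm (x - y)))"
      using log_W_integrable by auto
    let ?m = "measure W (space W)"
    show "integrable W (\<lambda>x. \<integral>y. norm (case (x, y) of (x, y) \<Rightarrow> ln (norm (x - y))) \<partial>W)"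
    proof (rule Bochner_Integration.integrable_bound)
      let ?b = "\<lambda>x. ln (1 + norm x) * ?m + (\<integral>y. ln (1 + norm y) \<partial>W) + (\<integral>y. dom y \<partial>W)"
      show "integrable W ?b" using ln_W_integrable by auto
      show "AE x in W. norm (\<integral>y. norm (case (x, y) of (x, y) \<Rightarrow> ln (norm (x - y))) \<partial>W) \<le> norm (?b x)"
      proof (rule AE_I2)
        fix x
        have "(\<integral>y. \<bar>ln (norm (x - y))\<bar> \<partial>W) \<le> (\<integral>y. (ln (1 + norm x) + ln (1 + norm y)) + log_kernel x y \<partial>W)"
        proof (rule integral_mono)
          show "integrable W (\<lambda>y. \<bar>ln (norm (x - y))\<bar>)" using log_W_integrable by (rule integrable_abs)
          show "integrable W (\<lambda>y. (ln (1 + norm x) + ln (1 + norm y)) + log_kernel x y)"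
            using ln_W_integrable kernel_integrable_bound(1) by auto
          fix y
          have "ln (norm (x - y)) = (ln (1 + norm x) + ln (1 + norm y)) - log_kernel x y"
            by (simp add: log_kernel_def)
          then show "\<bar>ln (norm (x - y))\<bar> \<le> (ln (1 + norm x) + ln (1 + norm y)) + log_kernel x y"
            using log_kernel_nonneg[of x y] ln_ge_zero[of "1 + norm x"] ln_ge_zero[of "1 + norm y"]
            by (simp only: abs_le_iff) auto
        qed
        also have "\<dots> \<le> ?b x"
          using ln_W_integrable kernel_integrable_bound[of x] by simp
        finally have le: "(\<integral>y. \<bar>ln (norm (x - y))\<bar> \<partial>W) \<le> ?b x" .
        moreover have "0 \<le> (\<integral>y. \<bar>ln (norm (x - y))\<bar> \<partial>W)" by (intro integral_nonneg_AE) auto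
        ultimately show "norm (\<integral>y. norm (case (x, y) of (x, y) \<Rightarrow> ln (norm (x - y))) \<partial>W) \<le> norm (?b x)"
          by simp
      qed
    qed measurable
  qed measurable
  then show ?thesis by (simp add: case_prod_unfold)
qed

lemma W_pair_off_diagonal: "AE p in W \<Otimes>\<^sub>M W. fst p \<noteq> snd p"
proof -
  interpret pair_sigma_finite W W ..
  have "AE y in W. y \<noteq> x" for x by (rule W_AE[OF AE_lborel_singleton])
  then have "AE y in W. x \<noteq> y" for x by (simp add: eq_commute[of x])
  then have "AE x in W. AE y in W. fst (x, y) \<noteq> snd (x, y)" by simp
  moreover have "{p \<in> space (W \<Otimes>\<^sub>M W). fst p \<noteq> snd p} \<in> sets (W \<Otimes>\<^sub>M W)"
  proof -
    have "{p :: (real ^ 'm) \<times> (real ^ 'm). fst p \<noteq> snd p} \<in> sets (borel \<Otimes>\<^sub>M borel)"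
      unfolding borel_prod by (intro borel_open open_Collect_neq continuous_intros)
    moreover have "sets (W \<Otimes>\<^sub>M W) = sets (borel \<Otimes>\<^sub>M borel)" by (intro sets_pair_measure_cong sets_W)
    ultimately show ?thesis by (simp add: space_pair_measure)
  qed
  ultimately show ?thesis by (intro AE_pair_measure)
qed

text \<open>The two correction terms of the kernel disappear for \<open>h\<close> of integral 0:
  \<open>ln (1 + |x|)\<close> multiplies the vanishing inner integral, and
  \<open>ln (1 + |y|)\<close> leaves a constant \<open>c\<close> that the outer integral
  removes.\<close>

lemma W_kernel_cond_pos_def:
  assumes hm: "h \<in> borel_measurable W" and h_le: "\<And>x. x \<in> space W \<Longrightarrow> \<bar>h x\<bar> \<le> C"
    and zero: "(\<integral>x. h x \<partial>W) = 0"
  shows "0 \<le> (\<integral>x. h x * (\<integral>y. log_kernel x y * h y \<partial>W) \<partial>W)"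
proof -
  interpret pair_sigma_finite W W ..
  have hb: "h \<in> borel_measurable borel" using hm by simp
  interpret h: bounded_weight W h C
    by unfold_locales (use hb h_le in auto)
  note [measurable] = hb
  have mult: "integrable W (\<lambda>y. f y * h y)" if "integrable W f" for f
  proof (rule Bochner_Integration.integrable_bound)
    show "integrable W (\<lambda>y. C * f y)" using that by auto
    show "AE y in W. norm (f y * h y) \<le> norm (C * f y)"
      using h.h_le h.C_nonneg
      by (intro AE_I2) (auto simp: abs_mult mult.commute[of C] intro!: mult_left_mono)
  qed (use borel_measurable_integrable[OF that] hm in measurable)
  define c where "c = (\<integral>y. ln (1 + norm y) * h y \<partial>W)"
  let ?L = "\<lambda>x. \<integral>y. ln (norm (x - y)) * h y \<partial>W"
  have "(\<integral>y. log_kernel x y * h y \<partial>W) = c - ?L x" for x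
  proof -
    have "(\<integral>y. log_kernel x y * h y \<partial>W) =
      (\<integral>y. ln (1 + norm x) * h y + ln (1 + norm y) * h y - ln (norm (x - y)) * h y \<partial>W)"
      by (simp add: log_kernel_def algebra_simps)
    also have "\<dots> = ln (1 + norm x) * (\<integral>y. h y \<partial>W) + c - ?L x"
      unfolding c_def using mult[OF ln_W_integrable] mult[OF log_W_integrable[of x]] h.h_integrable by simp
    finally show ?thesis by (simp add: zero)
  qed
  note inner = this
  have ip: "integrable (W \<Otimes>\<^sub>M W) (\<lambda>(x, y). h x * (ln (norm (x - y)) * h y))"
  proof (rule Bochner_Integration.integrable_bound)
    show "integrable (W \<Otimes>\<^sub>M W) (\<lambda>p. (C * C) * ln (norm (fst p - snd p)))"
      using log_pair_integrable by (rule integrable_mult_right)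
    show "AE p in W \<Otimes>\<^sub>M W. norm (case p of (x, y) \<Rightarrow> h x * (ln (norm (x - y)) * h y)) \<le>
        norm ((C * C) * ln (norm (fst p - snd p)))"
    proof (rule AE_I2)
      fix p :: "(real ^ 'm) \<times> (real ^ 'm)"
      have "\<bar>ln (norm (fst p - snd p))\<bar> * \<bar>h.hh p\<bar> \<le> \<bar>ln (norm (fst p - snd p))\<bar> * (C * C)"
        by (intro mult_left_mono h.hh_le) auto
      then show "norm (case p of (x, y) \<Rightarrow> h x * (ln (norm (x - y)) * h y)) \<le>
          norm ((C * C) * ln (norm (fst p - snd p)))"
        using h.C_nonneg by (simp add: h.hh_def abs_mult mult_ac case_prod_beta)
    qed
  qed measurable
  have iL: "integrable W (\<lambda>x. h x * ?L x)"
    using integrable_fst[OF ip] by simp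
  have "(\<integral>x. h x * (\<integral>y. log_kernel x y * h y \<partial>W) \<partial>W) = (\<integral>x. c * h x - h x * ?L x \<partial>W)"
    unfolding inner by (simp add: algebra_simps)
  also have "\<dots> = - (\<integral>x. h x * ?L x \<partial>W)" using iL h.h_integrable zero by simp
  also have "\<dots> = - (\<integral>p. (case p of (x, y) \<Rightarrow> h x * (ln (norm (x - y)) * h y)) \<partial>(W \<Otimes>\<^sub>M W))"
    using integral_fst[OF ip] by simp
  also have "\<dots> = (\<integral>p. - ln (norm (fst p - snd p)) * h.hh p \<partial>(W \<Otimes>\<^sub>M W))"
    by (subst integral_minus[symmetric]) (auto simp: h.hh_def mult_ac case_prod_beta)
  also have "\<dots> \<ge> 0"
    by (rule h.log_kernel_nonneg[OF zero W_pair_off_diagonal log_pair_integrable])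
  finally show ?thesis .
qed

text \<open>The summand 1 makes the bound strictly positive, as \<open>B_pos\<close>
  demands.\<close>

sublocale R: repulsive_kernel W log_kernel "(\<integral>y. dom y \<partial>W) + 1" a
proof
  show "case_prod log_kernel \<in> borel_measurable (W \<Otimes>\<^sub>M W)"
    unfolding case_prod_beta by measurable
  show "(\<integral>y. log_kernel x y \<partial>W) \<le> (\<integral>y. dom y \<partial>W) + 1" for x
    using kernel_integrable_bound(2)[of x] by simp
  have "0 \<le> (\<integral>y. dom y \<partial>W)" using dom_nonneg by (intro integral_nonneg_AE) auto
  then show "0 < (\<integral>y. dom y \<partial>W) + 1" by simp
  show "0 \<le> (\<integral>x. h x * (\<integral>y. log_kernel x y * h y \<partial>W) \<partial>W)"
    if "h \<in> borel_measurable W" "\<And>x. x \<in> space W \<Longrightarrow> \<bar>h x\<bar> \<le> C" "(\<integral>x. h x \<partial>W) = 0" for h C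
    by (rule W_kernel_cond_pos_def[OF that])
  show "log_kernel x y = log_kernel y x" for x y :: "real ^ 'm" by (rule log_kernel_sym)
qed (use log_kernel_nonneg kernel_integrable_bound(1) a_pos W_measure_pos in auto)

end

section \<open>The radial Gibbs state: continuity, behaviour at infinity and equation of its
  potential\<close>

context radial_weight
begin

lemma pot_orthogonal:
  assumes T: "orthogonal_transformation T" and p: "p \<in> borel_measurable borel"
  shows "R.pot p (T x) = R.pot (\<lambda>y. p (T y)) x"
proof -
  have [measurable]: "T \<in> borel_measurable borel" by (rule orthogonal_measurable[OF T])
  note [measurable] = p
  have "R.pot p (T x) = (\<integral>z. log_kernel (T x) z * p z \<partial>distr W borel T)"
    by (simp add: R.pot_def W_orthogonal[OF T])
  also have "\<dots> = (\<integral>y. log_kernel (T x) (T y) * p (T y) \<partial>W)"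
    by (rule integral_distr) measurable
  finally show ?thesis by (simp add: R.pot_def log_kernel_orthogonal[OF T])
qed

lemma W_integral_orthogonal:
  fixes f :: "real ^ 'm \<Rightarrow> real"
  assumes T: "orthogonal_transformation T" and f: "f \<in> borel_measurable borel"
  shows "(\<integral>x. f (T x) \<partial>W) = (\<integral>x. f x \<partial>W)"
proof -
  have "T \<in> borel_measurable W" using orthogonal_measurable[OF T] by simp
  then have "(\<integral>x. f x \<partial>distr W borel T) = (\<integral>x. f (T x) \<partial>W)"
    by (rule integral_distr[OF _ f])
  then show ?thesis by (simp add: W_orthogonal[OF T])
qed

text \<open>For orthogonal \<open>T\<close>, \<open>p \<circ> T\<close> is again a fixed point,
  because potentials commute with \<open>T\<close> and the partition function is unchanged.
  Uniqueness holds at every point, so the invariance does too.\<close>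

theorem gibbs_state:
  obtains p where "R.bdd p" "\<And>x. p x = R.gibbs p x" "\<And>x. R.pot p x = R.pot p (norm x *\<^sub>R i)"
proof -
  obtain p where bp: "R.bdd p" and p_space: "\<And>x. x \<in> space W \<Longrightarrow> p x = R.gibbs p x"
    using R.gibbs_fixed_point_exists by blast
  have p: "p x = R.gibbs p x" for x by (rule p_space) simp
  have pm: "p \<in> borel_measurable borel" using R.bdd_measurable[OF bp] by simp
  have inv: "p (T x) = p x" if T: "orthogonal_transformation T" for T x
  proof -
    have [measurable]: "T \<in> borel_measurable borel" by (rule orthogonal_measurable[OF T])
    note [measurable] = pm
    have potm: "R.pot p \<in> borel_measurable borel" using R.bdd_measurable[OF R.bdd_pot[OF bp]] by simp
    have b: "R.bdd (\<lambda>y. p (T y))" using bp unfolding R.bdd_def by auto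
    have "R.partition_fun (\<lambda>y. p (T y)) = (\<integral>x. exp (- (a * R.pot p (T x))) \<partial>W)"
      unfolding R.partition_fun_def pot_orthogonal[OF T pm] ..
    also have "\<dots> = R.partition_fun p"
      unfolding R.partition_fun_def using potm by (intro W_integral_orthogonal[OF T]) measurable
    finally have "R.gibbs (\<lambda>y. p (T y)) x = R.gibbs p (T x)" for x
      by (simp add: R.gibbs_def pot_orthogonal[OF T pm])
    then have fp: "p (T x) = R.gibbs (\<lambda>y. p (T y)) x" for x by (simp add: p[symmetric])
    show ?thesis
      by (rule R.gibbs_fixed_point_unique[OF b fp bp p]) simp
  qed
  have "R.pot p x = R.pot p (norm x *\<^sub>R i)" for x
  proof -
    obtain T where T: "orthogonal_transformation T" "T x = norm x *\<^sub>R i" by (rule to_axis)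
    have "R.pot p (T x) = R.pot p x"
      unfolding pot_orthogonal[OF T(1) pm] inv[OF T(1)] ..
    then show ?thesis by (simp add: T(2))
  qed
  with bp p show thesis by (rule that)
qed

lemma kernel_mult_le_dom:
  assumes p: "\<And>x. \<bar>p x\<bar> \<le> C" and r: "0 \<le> r"
  shows "AE y in W. norm (log_kernel (r *\<^sub>R i) y * p y) \<le> C * dom y"
  using log_kernel_le_dom[OF r]
proof eventually_elim
  fix y assume "\<bar>log_kernel (r *\<^sub>R i) y\<bar> \<le> dom y"
  then have "\<bar>log_kernel (r *\<^sub>R i) y\<bar> * \<bar>p y\<bar> \<le> dom y * C"
    using p[of y] dom_nonneg[of y] by (intro mult_mono) auto
  then show "norm (log_kernel (r *\<^sub>R i) y * p y) \<le> C * dom y" by (simp add: abs_mult mult.commute)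
qed

lemma pot_axis_tendsto:
  assumes p: "R.bdd p" and r: "\<And>k. 0 \<le> r k" "r \<longlonglongrightarrow> s"
  shows "(\<lambda>k. R.pot p (r k *\<^sub>R i)) \<longlonglongrightarrow> R.pot p (s *\<^sub>R i)"
proof -
  obtain C where C: "p \<in> borel_measurable W" "0 \<le> C" "\<And>x. x \<in> space W \<Longrightarrow> \<bar>p x\<bar> \<le> C"
    using R.bddE[OF p] by metis
  have [measurable]: "p \<in> borel_measurable borel" using C(1) by simp
  show ?thesis
    unfolding R.pot_def
  proof (rule integral_dominated_convergence)
    show "integrable W (\<lambda>y. C * dom y)" using dom_integrable by auto
    show "AE y in W. norm (log_kernel (r k *\<^sub>R i) y * p y) \<le> C * dom y" for k
      by (rule kernel_mult_le_dom) (use C r in auto)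
    have "AE y in W. y \<noteq> s *\<^sub>R i" by (rule W_AE[OF AE_lborel_singleton])
    then show "AE y in W. (\<lambda>k. log_kernel (r k *\<^sub>R i) y * p y) \<longlonglongrightarrow> log_kernel (s *\<^sub>R i) y * p y"
    proof eventually_elim
      fix y assume y: "y \<noteq> s *\<^sub>R i"
      show "(\<lambda>k. log_kernel (r k *\<^sub>R i) y * p y) \<longlonglongrightarrow> log_kernel (s *\<^sub>R i) y * p y"
        unfolding log_kernel_def using y r(2)
        by (intro tendsto_intros) (auto simp: add_nonneg_eq_0_iff add_pos_nonneg intro!: less_imp_neq[symmetric])
    qed
  qed measurable
qed

lemma log_kernel_axis_at_top: "((\<lambda>r. log_kernel (r *\<^sub>R i) y) \<longlongrightarrow> ln (1 + norm y)) at_top"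
proof -
  define b where "b = norm y"
  have b: "0 \<le> b" by (simp add: b_def)
  have "((\<lambda>r. ln (1 + r) - ln (norm (r *\<^sub>R i - y))) \<longlongrightarrow> 0) at_top"
  proof (rule tendsto_sandwich)
    have ev: "eventually (\<lambda>r. b + 1 < r) at_top" by (rule eventually_gt_at_top)
    have n: "norm (r *\<^sub>R i) = r" if "b + 1 < r" for r using that b ij by simp
    show "eventually (\<lambda>r. ln (1 + r) - ln (r + b) \<le> ln (1 + r) - ln (norm (r *\<^sub>R i - y))) at_top"
      using ev
    proof eventually_elim
      fix r assume r: "b + 1 < r"
      have "norm (r *\<^sub>R i - y) \<le> r + b" "r - b \<le> norm (r *\<^sub>R i - y)"
        using norm_triangle_ineq4[of "r *\<^sub>R i" y] norm_triangle_ineq2[of "r *\<^sub>R i" y] n[OF r] by (auto simp: b_def)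
      then show "ln (1 + r) - ln (r + b) \<le> ln (1 + r) - ln (norm (r *\<^sub>R i - y))"
        using r by (intro diff_left_mono ln_mono) auto
    qed
    show "eventually (\<lambda>r. ln (1 + r) - ln (norm (r *\<^sub>R i - y)) \<le> ln (1 + r) - ln (r - b)) at_top"
      using ev
    proof eventually_elim
      fix r assume r: "b + 1 < r"
      have "r - b \<le> norm (r *\<^sub>R i - y)"
        using norm_triangle_ineq2[of "r *\<^sub>R i" y] n[OF r] by (auto simp: b_def)
      then show "ln (1 + r) - ln (norm (r *\<^sub>R i - y)) \<le> ln (1 + r) - ln (r - b)"
        using r by (intro diff_left_mono ln_mono) auto
    qed
    show "((\<lambda>r. ln (1 + r) - ln (r + b)) \<longlongrightarrow> 0) at_top" by real_asymp
    show "((\<lambda>r. ln (1 + r) - ln (r - b)) \<longlongrightarrow> 0) at_top" by real_asymp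
  qed
  then have "((\<lambda>r. (ln (1 + r) - ln (norm (r *\<^sub>R i - y))) + ln (1 + norm y)) \<longlongrightarrow> 0 + ln (1 + norm y)) at_top"
    by (intro tendsto_intros)
  moreover have "eventually (\<lambda>r. (ln (1 + r) - ln (norm (r *\<^sub>R i - y))) + ln (1 + norm y) =
      log_kernel (r *\<^sub>R i) y) at_top"
    using eventually_ge_at_top[of 0] by eventually_elim (use ij in \<open>simp add: log_kernel_def\<close>)
  ultimately show ?thesis by (simp add: filterlim_cong)
qed

lemma pot_axis_at_top:
  assumes p: "R.bdd p"
  shows "((\<lambda>r. R.pot p (r *\<^sub>R i)) \<longlongrightarrow> (\<integral>y. ln (1 + norm y) * p y \<partial>W)) at_top"
proof -
  obtain C where C: "p \<in> borel_measurable W" "0 \<le> C" "\<And>x. x \<in> space W \<Longrightarrow> \<bar>p x\<bar> \<le> C"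
    using R.bddE[OF p] by metis
  have [measurable]: "p \<in> borel_measurable borel" using C(1) by simp
  show ?thesis
    unfolding R.pot_def
  proof (rule integral_dominated_convergence_at_top)
    show "integrable W (\<lambda>y. C * dom y)" using dom_integrable by auto
    show "eventually (\<lambda>r. AE y in W. norm (log_kernel (r *\<^sub>R i) y * p y) \<le> C * dom y) at_top"
      using eventually_ge_at_top[of 0]
      by eventually_elim (rule kernel_mult_le_dom, use C in auto)
    show "AE y in W. ((\<lambda>r. log_kernel (r *\<^sub>R i) y * p y) \<longlongrightarrow> ln (1 + norm y) * p y) at_top"
      by (intro AE_I2 tendsto_intros log_kernel_axis_at_top)
  qed measurable
qed

text \<open>The dominating function serves points of one axis only. Continuity is thus a statement
  about the radius, carried over to all points by radiality.\<close>

lemma pot_continuous: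
  assumes p: "R.bdd p" and rad: "\<And>x. R.pot p x = R.pot p (norm x *\<^sub>R i)"
  shows "continuous_on UNIV (R.pot p)"
  unfolding continuous_on_sequentially
proof (intro allI ballI impI, elim conjE)
  fix f :: "nat \<Rightarrow> real ^ 'm" and x assume "f \<longlonglongrightarrow> x"
  then have "(\<lambda>k. norm (f k)) \<longlonglongrightarrow> norm x" by (rule tendsto_norm)
  then have "(\<lambda>k. R.pot p (norm (f k) *\<^sub>R i)) \<longlonglongrightarrow> R.pot p (norm x *\<^sub>R i)"
    by (intro pot_axis_tendsto[OF p]) auto
  then show "(R.pot p \<circ> f) \<longlonglongrightarrow> R.pot p x" by (simp add: rad[symmetric] o_def)
qed

lemma bdd_mult_integrable:
  assumes p: "R.bdd p" and f: "integrable W f" shows "integrable W (\<lambda>y. f y * p y)"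
proof -
  obtain C where C: "p \<in> borel_measurable W" "0 \<le> C" "\<And>x. x \<in> space W \<Longrightarrow> \<bar>p x\<bar> \<le> C"
    using R.bddE[OF p] by metis
  show ?thesis
  proof (rule Bochner_Integration.integrable_bound)
    show "integrable W (\<lambda>y. C * f y)" using f by auto
    show "(\<lambda>y. f y * p y) \<in> borel_measurable W"
      using C(1) borel_measurable_integrable[OF f] by measurable
    show "AE y in W. norm (f y * p y) \<le> norm (C * f y)"
      using C by (intro AE_I2) (auto simp: abs_mult mult.commute[of C] intro!: mult_left_mono)
  qed
qed

text \<open>Mass 1 gives \<open>ln (1 + |x|)\<close> the coefficient 1; this is what later fixes the
  growth rate as exactly \<alpha>.\<close>

lemma log_potential_eq_pot:
  assumes p: "R.bdd p" and p1: "(\<integral>x. p x \<partial>W) = 1"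
  shows "(\<integral>y. ln (norm (x - y)) * p y \<partial>W) =
    ln (1 + norm x) + (\<integral>y. ln (1 + norm y) * p y \<partial>W) - R.pot p x"
proof -
  have "(\<integral>y. ln (norm (x - y)) * p y \<partial>W) =
    (\<integral>y. ln (1 + norm x) * p y + ln (1 + norm y) * p y - log_kernel x y * p y \<partial>W)"
    by (simp add: log_kernel_def algebra_simps)
  also have "\<dots> = ln (1 + norm x) * (\<integral>y. p y \<partial>W) + (\<integral>y. ln (1 + norm y) * p y \<partial>W) - R.pot p x"
    unfolding R.pot_def
    using R.bdd_integrable[OF p] bdd_mult_integrable[OF p ln_W_integrable]
      bdd_mult_integrable[OF p kernel_integrable_bound(1)[of x]] by simp
  finally show ?thesis by (simp add: p1)
qed

text \<open>Fubini reduces the claim to the fundamental solution at each \<open>y\<close>. Absolute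
  integrability rests on the bound \<open>D + D * ln (1 + |y|)\<close> for the inner integral and on
  the integrability of \<open>ln (1 + |y|)\<close> under \<open>W\<close>.\<close>

lemma log_potential_distr:
  fixes \<phi> :: "real ^ 'm \<Rightarrow> real"
  assumes p: "R.bdd p" and \<phi>: "test_function \<phi>"
    and fund: "\<And>y. (\<integral>x. ln (norm (x - y)) * neg_laplacian_power n \<phi> x \<partial>lborel) = - \<gamma> * \<phi> y"
  shows "(\<integral>x. (\<integral>y. ln (norm (x - y)) * p y \<partial>W) * neg_laplacian_power n \<phi> x \<partial>lborel) =
    - \<gamma> * (\<integral>x. g x * p x * \<phi> x \<partial>lborel)"
proof -
  let ?\<psi> = "neg_laplacian_power n \<phi>"
  interpret pair_sigma_finite W "lborel :: (real ^ 'm) measure" ..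
  have \<psi>t: "test_function ?\<psi>" by (rule test_function_neg_laplacian_power[OF \<phi>])
  then obtain R where R: "\<And>x. R < norm x \<Longrightarrow> ?\<psi> x = 0" by (auto simp: test_function_iff)
  have c\<psi>: "continuous_on UNIV ?\<psi>" by (rule test_function_continuous[OF \<psi>t])
  have [measurable]: "?\<psi> \<in> borel_measurable borel" by (rule borel_measurable_continuous_onI[OF c\<psi>])
  have [measurable]: "\<phi> \<in> borel_measurable borel"
    by (rule borel_measurable_continuous_onI[OF test_function_continuous[OF \<phi>]])
  obtain C where C: "0 < C" "\<And>x. \<bar>?\<psi> x\<bar> \<le> C"
    using continuous_compact_support_bounded[OF c\<psi> R] by blast
  obtain D where D: "0 \<le> D" "\<And>y. integrable lborel (\<lambda>x. ln (norm (x - y)) * ?\<psi> x)"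
    "\<And>y. (\<integral>x. \<bar>ln (norm (x - y)) * ?\<psi> x\<bar> \<partial>lborel) \<le> D + D * ln (1 + norm y)"
    using log_norm_diff_local_integrable[of ?\<psi> C R] C R by auto
  have pm[measurable]: "p \<in> borel_measurable borel" using R.bdd_measurable[OF p] by simp
  let ?F = "\<lambda>y x. p y * (ln (norm (x - y)) * ?\<psi> x)"
  have "integrable (W \<Otimes>\<^sub>M lborel) (case_prod ?F)"
  proof (rule Fubini_integrable)
    show "case_prod ?F \<in> borel_measurable (W \<Otimes>\<^sub>M lborel)" unfolding case_prod_beta by measurable
    show "AE y in W. integrable lborel (\<lambda>x. case (y, x) of (y, x) \<Rightarrow> ?F y x)"
      using D(2) by (intro AE_I2) simp
    show "integrable W (\<lambda>y. \<integral>x. norm (case (y, x) of (y, x) \<Rightarrow> ?F y x) \<partial>lborel)"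
    proof (rule Bochner_Integration.integrable_bound)
      show "integrable W (\<lambda>y. (D + D * ln (1 + norm y)) * p y)"
        using ln_W_integrable by (intro bdd_mult_integrable[OF p]) auto
      show "AE y in W. norm (\<integral>x. norm (case (y, x) of (y, x) \<Rightarrow> ?F y x) \<partial>lborel) \<le>
          norm ((D + D * ln (1 + norm y)) * p y)"
      proof (rule AE_I2)
        fix y
        have "(\<integral>x. norm (?F y x) \<partial>lborel) = \<bar>p y\<bar> * (\<integral>x. \<bar>ln (norm (x - y)) * ?\<psi> x\<bar> \<partial>lborel)"
          by (simp add: abs_mult)
        also have "\<dots> \<le> \<bar>p y\<bar> * (D + D * ln (1 + norm y))"
          by (intro mult_left_mono D) auto
        finally have le: "(\<integral>x. norm (?F y x) \<partial>lborel) \<le> \<bar>p y\<bar> * (D + D * ln (1 + norm y))" .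
        have "0 \<le> (\<integral>x. norm (?F y x) \<partial>lborel)" by (intro integral_nonneg_AE) auto
        moreover have "0 \<le> D + D * ln (1 + norm y)" using D(1) by auto
        ultimately show "norm (\<integral>x. norm (case (y, x) of (y, x) \<Rightarrow> ?F y x) \<partial>lborel) \<le>
          norm ((D + D * ln (1 + norm y)) * p y)" using le by (simp add: abs_mult mult.commute)
      qed
    qed (unfold case_prod_beta, measurable)
  qed
  from Fubini_integral[OF this]
  have "(\<integral>x. (\<integral>y. ?F y x \<partial>W) \<partial>lborel) = (\<integral>y. (\<integral>x. ?F y x \<partial>lborel) \<partial>W)" by simp
  also have "\<dots> = (\<integral>y. - \<gamma> * (p y * \<phi> y) \<partial>W)"
    by (simp only: integral_mult_right_zero fund mult.left_commute[of _ "- \<gamma>"])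
  also have "\<dots> = - \<gamma> * (\<integral>x. g x * p x * \<phi> x \<partial>lborel)"
    by (simp only: integral_mult_right_zero, subst W_integral) (simp_all add: mult.assoc)
  also have "(\<integral>x. (\<integral>y. ?F y x \<partial>W) \<partial>lborel) =
      (\<integral>x. (\<integral>y. ln (norm (x - y)) * p y \<partial>W) * ?\<psi> x \<partial>lborel)"
  proof (rule Bochner_Integration.integral_cong[OF refl])
    fix x
    have "(\<integral>y. ?F y x \<partial>W) = (\<integral>y. (ln (norm (x - y)) * p y) * ?\<psi> x \<partial>W)" by (simp only: mult_ac)
    also have "\<dots> = (\<integral>y. ln (norm (x - y)) * p y \<partial>W) * ?\<psi> x" by (rule integral_mult_left_zero)
    finally show "(\<integral>y. ?F y x \<partial>W) = (\<integral>y. ln (norm (x - y)) * p y \<partial>W) * ?\<psi> x" .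
  qed
  finally show ?thesis .
qed

end

text \<open>Green's identity against the constant 1. It shows that additive constants in
  \<open>u\<close> do not affect the equation.\<close>

lemma neg_laplacian_power_integral_zero:
  fixes \<phi> :: "'a::euclidean_space \<Rightarrow> real"
  assumes \<phi>: "test_function \<phi>" and n: "0 < n"
  shows "(\<integral>x. neg_laplacian_power n \<phi> x \<partial>lborel) = 0"
proof -
  obtain k where k: "n = Suc k" using n gr0_implies_Suc by blast
  have pc: "partial b (\<lambda>_ :: 'a. 1 :: real) = (\<lambda>_. 0)" "partial b (\<lambda>_ :: 'a. 0 :: real) = (\<lambda>_. 0)" for b :: 'a
    by (intro ext partial_const)+
  have "(\<integral>x. 1 * laplacian (neg_laplacian_power k \<phi>) x \<partial>lborel) =
      (\<integral>x. laplacian (\<lambda>_. 1) x * neg_laplacian_power k \<phi> x \<partial>lborel)"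
    by (rule green_test_function) (auto simp: pc test_function_neg_laplacian_power[OF \<phi>])
  then show ?thesis by (simp add: k neg_laplacian_power_Suc laplacian_def pc)
qed

section \<open>Choice of the constants and assembly of the solution\<close>

theorem theorem1p7:
  fixes n :: nat
    and K :: "real ^ 'm \<Rightarrow> real"
    and \<alpha> :: real
  assumes "n \<ge> 2"
    and "CARD('m) = 2 * n"
    and "\<exists>x. K x \<noteq> 0"
    and "\<And>x. K x \<le> 0"
    and "continuous_on UNIV K"
    and "radial K"
    and "alpha1 n K > 0"
    and "0 < \<alpha>" and "ereal \<alpha> < alpha1 n K"
  shows "\<exists>u :: real ^ 'm \<Rightarrow> real.
           radial u \<and> is_solution n K u \<and>
           (\<exists>l::real. ((\<lambda>x. u x - \<alpha> * ln (norm x)) \<longlongrightarrow> l) at_infinity)"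
proof -
  note n = assms(1) and dim = assms(2) and \<alpha> = assms(8)
  \<comment> \<open>If \<open>u\<close> grows like \<open>\<alpha> ln |x|\<close>, then
    \<open>exp (2 n u)\<close> grows like \<open>|x|^a\<close>. This growth is put into the weight
    \<open>g\<close>, and the remaining factor is bounded.\<close>
  define a where "a = 2 * real n * \<alpha>"
  have a: "0 < a" using n \<alpha> by (simp add: a_def)
  define g where "g x = - K x * (1 + norm x) powr a" for x
  have npos: "0 < 1 + norm x" for x :: "real ^ 'm" by (simp add: add_pos_nonneg)
  have g_cont: "continuous_on UNIV g"
    unfolding g_def[abs_def] using assms(5) npos by (intro continuous_intros) (auto simp: less_imp_neq[symmetric])
  have g_nonneg: "0 \<le> g x" for x using assms(4)[of x] by (simp add: g_def mult_nonpos_nonneg)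
  have [measurable]: "K \<in> borel_measurable borel" "g \<in> borel_measurable borel"
    using assms(5) g_cont by (auto intro: borel_measurable_continuous_onI)
  \<comment> \<open>An exponent strictly above \<alpha>: the surplus power \<open>e\<close>
    dominates the logarithm, which makes \<open>ln (1 + |x|) * g x\<close> integrable.\<close>
  obtain \<beta> where \<beta>: "\<alpha> < \<beta>" "integrable lborel (\<lambda>x. K x * (1 + norm x) powr (2 * real n * \<beta>))"
    using assms(9) unfolding alpha1_def less_Sup_iff by auto
  define e where "e = 2 * real n * (\<beta> - \<alpha>)"
  have e: "0 < e" using \<beta>(1) n by (simp add: e_def)
  have ae: "2 * real n * \<beta> = a + e" by (simp add: a_def e_def algebra_simps)
  have int_e: "integrable lborel (\<lambda>x. g x * (1 + norm x) powr e)"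
  proof -
    have "g x * (1 + norm x) powr e = - (K x * (1 + norm x) powr (2 * real n * \<beta>))" for x
      unfolding ae g_def by (simp add: powr_add)
    then show ?thesis using \<beta>(2) by simp
  qed
  have g_int: "integrable lborel g"
  proof (rule Bochner_Integration.integrable_bound[OF int_e])
    have "g x * 1 \<le> g x * (1 + norm x) powr e" for x
      using g_nonneg e by (intro mult_left_mono ge_one_powr_ge_zero) auto
    then show "AE x in lborel. norm (g x) \<le> norm (g x * (1 + norm x) powr e)"
      using g_nonneg by (intro AE_I2) (auto simp: abs_mult)
  qed auto
  have g_log: "integrable lborel (\<lambda>x. ln (1 + norm x) * g x)"
  proof (rule Bochner_Integration.integrable_bound)
    show "integrable lborel (\<lambda>x. g x * (1 + norm x) powr e / e)" using int_e by auto
    show "AE x in lborel. norm (ln (1 + norm x) * g x) \<le> norm (g x * (1 + norm x) powr e / e)"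
    proof (rule AE_I2)
      fix x :: "real ^ 'm"
      have "ln (1 + norm x) \<le> (1 + norm x) powr e / e" by (rule ln_powr_bound) (use e in auto)
      then have "ln (1 + norm x) * g x \<le> ((1 + norm x) powr e / e) * g x"
        using g_nonneg by (rule mult_right_mono)
      then show "norm (ln (1 + norm x) * g x) \<le> norm (g x * (1 + norm x) powr e / e)"
        using g_nonneg[of x] e by (simp add: abs_mult mult.commute)
    qed
  qed measurable
  obtain i j :: "real ^ 'm" where ij: "i \<in> Basis" "j \<in> Basis" "i \<noteq> j"
  proof -
    have "2 \<le> card (Basis :: (real ^ 'm) set)" using n dim by simp
    then show thesis using that card_le_Suc0_iff_eq[of "Basis :: (real ^ 'm) set"] by force
  qed
  interpret radial_weight g i j a
  proof
    show "radial g" using assms(6) unfolding radial_def g_def by metis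
    show "\<exists>x. g x \<noteq> 0" using assms(3) npos by (auto simp: g_def less_imp_neq[symmetric])
  qed (use g_cont g_nonneg g_int g_log ij a in auto)
  obtain p where p: "R.bdd p" "\<And>x. p x = R.gibbs p x" "\<And>x. R.pot p x = R.pot p (norm x *\<^sub>R i)"
    using gibbs_state by blast
  have p1: "(\<integral>x. p x \<partial>W) = 1"
    using R.gibbs_integral[OF p(1)] by (simp add: p(2)[symmetric])
  have dimD: "DIM(real ^ 'm) = 2 * n" using dim by simp
  obtain \<gamma> where \<gamma>: "0 < \<gamma>" "\<And>\<phi> (y :: real ^ 'm). test_function \<phi> \<Longrightarrow>
      (\<integral>x. ln (norm (x - y)) * neg_laplacian_power n \<phi> x \<partial>lborel) = - \<gamma> * \<phi> y"
    using log_fundamental_solution[OF dimD] by blast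
  define Z where "Z = R.partition_fun p"
  have Z: "0 < Z" unfolding Z_def by (rule R.partition_fun_pos[OF p(1)])
  \<comment> \<open>Chosen so that \<open>exp (2 n c)\<close> turns the factor \<open>Z\<close> of
    the Gibbs density into \<open>\<alpha> \<gamma>\<close>, the constant that the fundamental
    solution produces on the other side.\<close>
  define c where "c = ln (\<alpha> * \<gamma> / Z) / (2 * real n)"
  have ec: "exp (2 * real n * c) = \<alpha> * \<gamma> / Z" using n \<alpha> \<gamma>(1) Z by (simp add: c_def)
  define u where "u x = \<alpha> * ln (1 + norm x) - \<alpha> * R.pot p x + c" for x
  have u_rad: "radial u"
    unfolding radial_def
  proof (intro allI impI)
    fix x y :: "real ^ 'm" assume "norm x = norm y"
    then show "u x = u y" unfolding u_def using p(3)[of x] p(3)[of y] by simp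
  qed
  have u_cont: "continuous_on UNIV u"
    unfolding u_def[abs_def] using pot_continuous[OF p(1,3)] npos
    by (intro continuous_intros) (auto simp: less_imp_neq[symmetric])
  have rhs: "K x * exp (2 * real n * u x) = - (\<alpha> * \<gamma>) * (g x * p x)" for x
  proof -
    have "2 * real n * u x = a * ln (1 + norm x) + - (a * R.pot p x) + 2 * real n * c"
      by (simp add: u_def a_def algebra_simps)
    then have "exp (2 * real n * u x) =
        exp (a * ln (1 + norm x)) * exp (- (a * R.pot p x)) * exp (2 * real n * c)"
      by (simp only: exp_add)
    moreover have "exp (a * ln (1 + norm x)) = (1 + norm x) powr a"
      using npos[of x] by (simp add: powr_def)
    moreover have "exp (- (a * R.pot p x)) = Z * p x"
      using Z by (subst p(2)) (simp add: R.gibbs_def Z_def)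
    ultimately show ?thesis using Z by (simp add: ec g_def)
  qed
  \<comment> \<open>The same constant is the additive term when \<open>u\<close> is written as
    \<alpha> times a pure logarithmic potential and the limit of
    \<open>u x - \<alpha> ln |x|\<close> at infinity.\<close>
  define c' where "c' = c - \<alpha> * (\<integral>y. ln (1 + norm y) * p y \<partial>W)"
  have u_eq: "u x = \<alpha> * (\<integral>y. ln (norm (x - y)) * p y \<partial>W) + c'" for x
    unfolding log_potential_eq_pot[OF p(1) p1] u_def c'_def by (simp add: algebra_simps)
  have "is_solution n K u"
    unfolding is_solution_def neg_laplacian_power_eq_distr_def
  proof (intro conjI allI impI u_cont)
    fix \<phi> :: "real ^ 'm \<Rightarrow> real" assume \<phi>: "test_function \<phi>"
    let ?\<psi> = "neg_laplacian_power n \<phi>"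
    have \<psi>t: "test_function ?\<psi>" by (rule test_function_neg_laplacian_power[OF \<phi>])
    then obtain R where R: "\<And>x. R < norm x \<Longrightarrow> ?\<psi> x = 0" by (auto simp: test_function_iff)
    note c\<psi> = test_function_continuous[OF \<psi>t]
    have i1: "integrable lborel ?\<psi>" by (rule continuous_compact_support_integrable[OF c\<psi> R])
    have i2: "integrable lborel (\<lambda>x. u x * ?\<psi> x)"
      using R by (intro continuous_compact_support_integrable[where R = R] continuous_intros u_cont c\<psi>) auto
    have "u x * ?\<psi> x - c' * ?\<psi> x = \<alpha> * ((\<integral>y. ln (norm (x - y)) * p y \<partial>W) * ?\<psi> x)" for x
      unfolding u_eq by (simp add: algebra_simps)
    then have "(\<integral>x. u x * ?\<psi> x - c' * ?\<psi> x \<partial>lborel) =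
        \<alpha> * (\<integral>x. (\<integral>y. ln (norm (x - y)) * p y \<partial>W) * ?\<psi> x \<partial>lborel)"
      by (simp only: integral_mult_right_zero)
    also have "\<dots> = \<alpha> * (- \<gamma> * (\<integral>x. g x * p x * \<phi> x \<partial>lborel))"
      by (subst log_potential_distr[OF p(1) \<phi> \<gamma>(2)[OF \<phi>]]) simp
    also have "\<dots> = (\<integral>x. - (\<alpha> * \<gamma>) * (g x * p x) * \<phi> x \<partial>lborel)"
      by (simp add: mult.assoc)
    also have "(\<integral>x. u x * ?\<psi> x - c' * ?\<psi> x \<partial>lborel) = (\<integral>x. u x * ?\<psi> x \<partial>lborel)"
      using i1 i2 neg_laplacian_power_integral_zero[OF \<phi>] n by simp
    finally show "(\<integral>x. u x * ?\<psi> x \<partial>lborel) = (\<integral>x. K x * exp (2 * real n * u x) * \<phi> x \<partial>lborel)"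
      unfolding rhs .
  qed
  moreover have "((\<lambda>x. u x - \<alpha> * ln (norm x)) \<longlongrightarrow> c') at_infinity"
  proof -
    have 1: "((\<lambda>r. \<alpha> * (ln (1 + r) - ln r)) \<longlongrightarrow> 0) at_top" by real_asymp
    have "((\<lambda>r. \<alpha> * (ln (1 + r) - ln r) - \<alpha> * R.pot p (r *\<^sub>R i) + c) \<longlongrightarrow>
        0 - \<alpha> * (\<integral>y. ln (1 + norm y) * p y \<partial>W) + c) at_top"
      by (intro tendsto_intros 1 pot_axis_at_top[OF p(1)])
    then have "((\<lambda>x :: real ^ 'm. \<alpha> * (ln (1 + norm x) - ln (norm x)) - \<alpha> * R.pot p (norm x *\<^sub>R i) + c) \<longlongrightarrow>
        0 - \<alpha> * (\<integral>y. ln (1 + norm y) * p y \<partial>W) + c) at_infinity"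
      by (rule filterlim_compose[OF _ filterlim_norm_at_top])
    moreover have "\<alpha> * (ln (1 + norm x) - ln (norm x)) - \<alpha> * R.pot p (norm x *\<^sub>R i) + c = u x - \<alpha> * ln (norm x)" for x
      using p(3)[of x] by (simp add: u_def algebra_simps)
    moreover have "0 - \<alpha> * (\<integral>y. ln (1 + norm y) * p y \<partial>W) + c = c'" by (simp add: c'_def)
    ultimately show ?thesis by (simp only:)
  qed
  ultimately show ?thesis using u_rad by blast
qed

end
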